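(* Let $\varphi$ be a non-constant entire function of exponential type and let $C_\varphi:=\{z\in\mathbb{C}:|\varphi(z)|=1\}$. (1) If $K\subset\mathbb{C}$ is a compact and convex set such that $K\cap C_\varphi$ contains a continuum, then there is a function $f\in\mathcal{FHC}(\varphi(D),H(\mathbb{C}))$ that is of exponential type and satisfies $K(f)\subset K$. (2) There is no function $f\in\mathcal{FHC}(\varphi(D),H(\mathbb{C}))$ that is of exponential type and such that $K(f)$ is a singleton.
   Context: A continuum is a compact connected set with more than one point. $H(\mathbb{C})$ is the space of entire functions with the topology of locally uniform convergence. An entire function $f$ is of exponential type if $\limsup_{r\to\infty}\frac{\log M_f(r)}{r}<+\infty$, where $M_f(r)=\max_{|z|=r}|f(z)|$. For an entire function $\varphi(z)=\sum_{n\ge 0}c_nz^n$ of exponential type, $\varphi(D):H(\mathbb{C})\to H(\mathbb{C})$ is the continuous linear operator $\varphi(D)f=\sum_{n\ge0}c_nf^{(n)}$. The lower density of a discrete set $\Lambda\subset\mathbb{C}$ is $\liminf_{r\to\infty}\#\{\lambda\in\Lambda:|\lambda|\le r\}/r$. For a continuous linear operator $T:X\to X$ on a topological vector space $X$, $\mathcal{FHC}(T,X)$ is the set of frequently hypercyclic vectors, i.e. of all $x\in X$ such that for every non-empty open $U\subset X$ the set $\{n\in\mathbb{N}:T^nx\in U\}$ has positive lower density. For an entire function $f$ of exponential type, $K(f)\subset\mathbb{C}$ denotes its conjugate indicator diagram: the smallest compact convex set such that the Borel transform $\mathcal{B}f(z)=\sum_{n\ge0}f^{(n)}(0)/z^{n+1}$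 (holomorphic near $\infty$) has an analytic continuation to $\mathbb{C}\setminus K(f)$ ($K(0)=\emptyset$). Equivalently, $K(f)$ is the compact convex set with $r\,h_f(\Theta)=\sup\{\mathrm{Re}(re^{i\Theta}u):u\in K(f)\}$, where $h_f(\Theta)=\limsup_{r\to\infty}\frac{\log|f(re^{i\Theta})|}{r}$. *)

theory Defs
  imports "HOL-Complex_Analysis.Complex_Analysis"
begin

definition continuum :: "complex set \<Rightarrow> bool" where
  "continuum S \<longleftrightarrow> compact S \<and> connected S \<and> (\<exists>x\<in>S. \<exists>y\<in>S. x \<noteq> y)"

definition max_modulus :: "(complex \<Rightarrow> complex) \<Rightarrow> real \<Rightarrow> real" where
  "max_modulus f r = (SUP z\<in>sphere 0 r. cmod (f z))"

text \<open>For \<open>f = 0\<close> the convention \<open>ln 0 = 0\<close> is harmless: the zero function is of exponential type.\<close>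

definition exponential_type :: "(complex \<Rightarrow> complex) \<Rightarrow> bool" where
  "exponential_type f \<longleftrightarrow> f holomorphic_on UNIV \<and>
     Limsup at_top (\<lambda>r::real. ereal (ln (max_modulus f r) / r)) < \<infinity>"

text \<open>The space of entire functions with the topology of locally uniform (equivalently, compact)
  convergence, whose basic neighbourhoods of \<open>f\<close> are the sets of entire functions uniformly
  \<open>e\<close>-close to \<open>f\<close> on a compact set \<open>L\<close>.\<close>

definition entire_space :: "(complex \<Rightarrow> complex) topology" where
  "entire_space = topology (\<lambda>U. U \<subseteq> {f. f holomorphic_on UNIV} \<and>
     (\<forall>f\<in>U. \<exists>L e. compact L \<and> e > 0 \<and>
        {g. g holomorphic_on UNIV \<and> (\<forall>z\<in>L. dist (g z) (f z) < e)} \<subseteq> U))"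

lemma openin_entire_space:
  "openin entire_space U \<longleftrightarrow> U \<subseteq> {f. f holomorphic_on UNIV} \<and>
     (\<forall>f\<in>U. \<exists>L e. compact L \<and> e > 0 \<and>
        {g. g holomorphic_on UNIV \<and> (\<forall>z\<in>L. dist (g z) (f z) < e)} \<subseteq> U)"
proof -
  let ?N = "\<lambda>f L e. {g::complex \<Rightarrow> complex. g holomorphic_on UNIV \<and> (\<forall>z\<in>L. dist (g z) (f z) < e)}"
  let ?P = "\<lambda>U. U \<subseteq> {f. f holomorphic_on UNIV} \<and>
     (\<forall>f\<in>U. \<exists>L e. compact L \<and> e > (0::real) \<and> ?N f L e \<subseteq> U)"
  have mono: "?N f L' e' \<subseteq> ?N f L e" if "L \<subseteq> L'" "e' \<le> e" for f L L' and e e' :: real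
    using that by (auto intro: less_le_trans)
  have "istopology ?P"
    unfolding istopology_def
  proof (intro conjI allI impI)
    fix S T assume S: "?P S" and T: "?P T"
    show "S \<inter> T \<subseteq> {f. f holomorphic_on UNIV}" using S by (meson Int_lower1 order_trans)
    show "\<forall>f\<in>S \<inter> T. \<exists>L e. compact L \<and> e > (0::real) \<and> ?N f L e \<subseteq> S \<inter> T"
    proof
      fix f assume f: "f \<in> S \<inter> T"
      from conjunct2[OF S] f obtain L d where 1: "compact L" "d > (0::real)" "?N f L d \<subseteq> S"
        by (meson IntD1)
      from conjunct2[OF T] f obtain M e where 2: "compact M" "e > (0::real)" "?N f M e \<subseteq> T"
        by (meson IntD2)
      have "?N f (L \<union> M) (min d e) \<subseteq> S \<inter> T"
        by (intro Int_greatest order_trans[OF mono 1(3)] order_trans[OF mono 2(3)]) simp_all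
      moreover have "compact (L \<union> M)" "min d e > 0"
        using 1 2 by (simp_all add: compact_Un)
      ultimately show "\<exists>L e. compact L \<and> e > (0::real) \<and> ?N f L e \<subseteq> S \<inter> T"
        by meson
    qed
  next
    fix K assume K: "\<forall>U\<in>K. ?P U"
    show "\<Union>K \<subseteq> {f. f holomorphic_on UNIV}" using K by (meson Sup_least)
    show "\<forall>f\<in>\<Union>K. \<exists>L e. compact L \<and> e > (0::real) \<and> ?N f L e \<subseteq> \<Union>K"
    proof
      fix f assume "f \<in> \<Union>K"
      then obtain U where U: "U \<in> K" "f \<in> U" by (rule UnionE)
      from conjunct2[OF bspec[OF K U(1)]] U(2)
      obtain L e where "compact L" "e > (0::real)" "?N f L e \<subseteq> U" by meson
      then show "\<exists>L e. compact L \<and> e > (0::real) \<and> ?N f L e \<subseteq> \<Union>K"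
        using Union_upper[OF U(1)] by (meson order_trans)
    qed
  qed
  then show ?thesis unfolding entire_space_def by (subst topology_inverse') simp_all
qed

lemma topspace_entire_space: "topspace entire_space = {f. f holomorphic_on UNIV}"
proof -
  have "openin entire_space {f. f holomorphic_on UNIV}"
    unfolding openin_entire_space
  proof (intro conjI ballI order_refl)
    fix f :: "complex \<Rightarrow> complex"
    show "\<exists>L e. compact L \<and> e > (0::real) \<and>
        {g. g holomorphic_on UNIV \<and> (\<forall>z\<in>L. dist (g z) (f z) < e)} \<subseteq> {f. f holomorphic_on UNIV}"
      by (rule exI[of _ "{}"], rule exI[of _ 1]) simp
  qed
  moreover have "topspace entire_space \<subseteq> {f. f holomorphic_on UNIV}"
    using openin_topspace[of entire_space] openin_entire_space by metis
  ultimately show ?thesis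
    by (intro subset_antisym openin_subset)
qed

text \<open>For \<open>\<phi>\<close> of exponential type and \<open>f\<close> entire, this is \<open>\<phi>(D) f\<close>, with the Taylor coefficients of \<open>\<phi>\<close>
  at \<open>0\<close> as weights; the series converges locally uniformly, so it may be summed pointwise.\<close>

definition diff_operator :: "(complex \<Rightarrow> complex) \<Rightarrow> (complex \<Rightarrow> complex) \<Rightarrow> complex \<Rightarrow> complex" where
  "diff_operator \<phi> f z = (\<Sum>n. (deriv ^^ n) \<phi> 0 / fact n * (deriv ^^ n) f z)"

text \<open>Intended for discrete (that is, locally finite) sets, where the cardinality is that of a finite set.\<close>

definition lower_density :: "complex set \<Rightarrow> ereal" where
  "lower_density \<Lambda> =
     Liminf at_top (\<lambda>r::real. ereal (real (card {l \<in> \<Lambda>. cmod l \<le> r}) / r))"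

definition freq_hypercyclic :: "('a \<Rightarrow> 'a) \<Rightarrow> 'a topology \<Rightarrow> 'a set" where
  "freq_hypercyclic T X = {x \<in> topspace X. \<forall>U. openin X U \<and> U \<noteq> {} \<longrightarrow>
     lower_density (of_nat ` {n::nat. (T ^^ n) x \<in> U}) > 0}"

definition borel_transform :: "(complex \<Rightarrow> complex) \<Rightarrow> complex \<Rightarrow> complex" where
  "borel_transform f z = (\<Sum>n. (deriv ^^ n) f 0 / z ^ (n + 1))"

text \<open>The series defining the Borel transform converges only near infinity; a continuation to the
  complement of \<open>K\<close> is a holomorphic function there that agrees with the series near infinity.
  \<open>LEAST\<close> refers to inclusion of sets.\<close>

definition conj_indicator_diagram :: "(complex \<Rightarrow> complex) \<Rightarrow> complex set" where
  "conj_indicator_diagram f = (LEAST K. compact K \<and> convex K \<and>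
     (\<exists>g. g holomorphic_on (- K) \<and> (\<forall>\<^sub>F z in at_infinity. g z = borel_transform f z)))"

end

theory Submission
  imports Defs
begin

text \<open>Write \<open>T\<close> for \<open>\<phi>(D)\<close>.

  Existence. Near a point of the continuum where \<open>\<phi>' \<noteq> 0\<close> there is a local inverse \<open>\<psi>\<close> with
  \<open>\<phi>(\<psi>(u)) = exp u\<close>, and by connectedness the continuum contains an arc \<open>\<psi>(\<i> t)\<close>, \<open>t\<close> in an interval.
  The integrals \<open>x(z) = \<integral> w(u) exp (\<psi>(u) z) du\<close> over subsegments, with \<open>w\<close> vanishing at the ends,
  have the orbit \<open>x\<^sub>n(z) = \<integral> w(u) exp (n u) exp (\<psi>(u) z) du\<close> for all integers \<open>n\<close>, which is \<open>O(1 / n\<^sup>2)\<close>,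
  and their linear combinations are dense among the entire functions. A sum of backward translates
  of a dense sequence of such combinations, placed at sufficiently separated sets of positive lower
  density, is frequently hypercyclic, and its Borel transform is a locally uniform limit of Cauchy
  transforms of functionals living on the arc.

  Non-existence. If \<open>K(f) = {a}\<close> and \<open>c = \<phi>(a) \<noteq> 0\<close>, then deforming the Borel contour to small circles around
  \<open>a\<close> gives \<open>T\<^sup>n f(0) = c\<^sup>n p(n)\<close> with \<open>p\<close> entire of minimal exponential type. Put \<open>q(z) = p(z) p\<^sup>*(z)\<close>, where
  \<open>p\<^sup>*(z)\<close> is the conjugate of \<open>p\<close> at the conjugate of \<open>z\<close>. Frequent visits to a set where \<open>\<bar>T f(0)\<bar>\<close> exceeds both
  \<open>\<bar>f(0)\<bar>\<close> and \<open>\<bar>T\<^sup>2 f(0)\<bar>\<close> make \<open>\<bar>c\<bar>\<^sup>2 q(z + 1) - q(z)\<close> change sign on a set of intervals \<open>(n, n + 1)\<close> of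
  positive lower density, which is too many zeros for a non-zero function of minimal type. If \<open>c = 0\<close>, the
  orbit tends to zero at the origin.\<close>

section \<open>Entire functions of exponential type\<close>

text \<open>Both halves rest on one device. A functional bounded on the continuous functions over a
  compact set commutes with uniformly convergent series. So its pairing with
  \<open>exp (\<psi> u * z)\<close> is entire, \<open>diff_operator \<phi>\<close> acts on this by
  inserting the factor \<open>\<phi> (\<psi> u)\<close>, and near infinity the pairing with
  \<open>1 / (z - \<psi> u)\<close> is the Borel transform. Circles around the singular point,
  imaginary segments and pairs of points are the instances needed. For existence, the obstacle is
  that dense approximants come with uncontrolled decay constants. Approximant \<open>l\<close> is
  used only at positions whose distance to all others is at least \<open>N l\<close>, and
  \<open>N\<close> is chosen after the constants, so that the square root of the distance absorbs
  them. Decay is required uniformly over kernels holomorphic near the segment, so that one estimate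
  serves the orbit and the Borel transform. For non-existence, squared moduli are compared because
  they ignore the argument of \<open>c\<close> and because, on the real line, the squared modulus of
  \<open>p\<close> extends to an entire function of minimal type: growth and decrease of the orbit
  become real zeros of one fixed function.\<close>

lemma powser_sums_higher_deriv:
  fixes f :: "complex \<Rightarrow> complex"
  assumes "\<And>h. (\<lambda>n. a n * h ^ n) sums f (z + h)"
  shows "(deriv ^^ n) f z = fact n * a n"
proof -
  have "(f \<circ> (\<lambda>x. z + x)) has_fps_expansion Abs_fps a"
    by (intro has_fps_expansionI always_eventually) (use assms in auto)
  from fps_nth_fps_expansion[OF this, of n] show ?thesis
    by (simp add: higher_deriv_shift_0[of n f z])
qed

lemma entire_powser:
  assumes "f holomorphic_on UNIV"
  shows "(\<lambda>n. (deriv ^^ n) f z / fact n * (w - z) ^ n) sums f w"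
  by (rule holomorphic_power_series[where r = "dist z w + 1"])
     (use holomorphic_on_subset[OF assms subset_UNIV] in auto)

lemma entire_powser_abs_summable:
  assumes "f holomorphic_on UNIV" and "0 \<le> r"
  shows "summable (\<lambda>n. cmod ((deriv ^^ n) f 0 / fact n) * r ^ n)"
proof -
  have "summable (\<lambda>n. (deriv ^^ n) f 0 / fact n * (complex_of_real (r + 1)) ^ n)"
    using entire_powser[OF assms(1), of 0 "complex_of_real (r + 1)"] by (simp add: sums_iff)
  then have "summable (\<lambda>n. cmod ((deriv ^^ n) f 0 / fact n * complex_of_real r ^ n))"
    by (rule powser_insidea) (use assms in \<open>simp del: of_real_add\<close>)
  then show ?thesis
    using assms by (simp add: norm_mult norm_power norm_divide)
qed

lemma entire_taylor_uniform_limit: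
  assumes h: "h holomorphic_on UNIV" and R: "0 \<le> R"
  shows "uniform_limit (cball 0 R) (\<lambda>m z. \<Sum>n<m. (deriv ^^ n) h 0 / fact n * z ^ n) h sequentially"
proof -
  let ?c = "\<lambda>n. (deriv ^^ n) h 0 / fact n"
  have "uniform_limit (cball 0 R) (\<lambda>m z. \<Sum>n<m. ?c n * z ^ n) (\<lambda>z. \<Sum>n. ?c n * z ^ n) sequentially"
  proof (rule Weierstrass_m_test)
    show "norm (?c n * z ^ n) \<le> cmod (?c n) * R ^ n" if "z \<in> cball 0 R" for n z
      using that unfolding norm_mult norm_power by (intro mult_left_mono power_mono) auto
    show "summable (\<lambda>n. cmod (?c n) * R ^ n)" by (rule entire_powser_abs_summable[OF h R])
  qed
  moreover have "(\<Sum>n. ?c n * z ^ n) = h z" for z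
    using entire_powser[OF h, of 0 z] by (simp add: sums_iff)
  ultimately show ?thesis by simp
qed

lemma exponential_typeD:
  assumes "exponential_type f"
  obtains C A where "C > 0" "A > 0" "\<And>z. cmod (f z) \<le> C * exp (A * cmod z)"
proof -
  have hol: "f holomorphic_on UNIV"
    using assms by (simp add: exponential_type_def)
  from assms have "Limsup at_top (\<lambda>r::real. ereal (ln (max_modulus f r) / r)) \<noteq> \<infinity>"
    by (simp add: exponential_type_def)
  with assms obtain a where "Limsup at_top (\<lambda>r::real. ereal (ln (max_modulus f r) / r)) < ereal a"
    unfolding exponential_type_def using less_PInf_Ex_of_nat by blast
  then have "\<forall>\<^sub>F r in at_top. ereal (ln (max_modulus f r) / r) < ereal a"
    by (rule Limsup_lessD)
  then obtain r0 where r0: "\<And>r. r \<ge> r0 \<Longrightarrow> ln (max_modulus f r) / r < a"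
    unfolding eventually_at_top_linorder by auto
  define A where "A = max a 1"
  define r1 where "r1 = max r0 1"
  have "bounded (f ` cball 0 r1)"
    by (intro compact_imp_bounded compact_continuous_image holomorphic_on_imp_continuous_on
          holomorphic_on_subset[OF hol subset_UNIV] compact_cball)
  then obtain B where B: "B > 0" "\<And>z. cmod z \<le> r1 \<Longrightarrow> cmod (f z) \<le> B"
    unfolding bounded_pos by auto
  have "cmod (f z) \<le> max B 1 * exp (A * cmod z)" for z
  proof (cases "cmod z \<le> r1")
    case True
    have "cmod (f z) \<le> max B 1 * 1" using B(2)[OF True] by simp
    also have "\<dots> \<le> max B 1 * exp (A * cmod z)"
      by (intro mult_left_mono) (auto simp: A_def)
    finally show ?thesis .
  next
    case False
    define r where "r = cmod z"
    have r: "r \<ge> r0" "r \<ge> 1" using False by (auto simp: r_def r1_def)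
    have "bdd_above ((\<lambda>z. cmod (f z)) ` sphere 0 r)"
      by (intro bounded_imp_bdd_above compact_imp_bounded compact_continuous_image continuous_intros
           holomorphic_on_imp_continuous_on[OF holomorphic_on_subset[OF hol subset_UNIV]]) auto
    then have le: "cmod (f z) \<le> max_modulus f r"
      unfolding max_modulus_def by (intro cSUP_upper) (auto simp: r_def)
    have "max_modulus f r \<le> exp (A * r)"
    \<comment> \<open>The logarithmic bound can be exponentiated only when the maximum modulus is
      positive; otherwise \<open>ln\<close> gives no information and the claim is trivial.\<close>
    proof (cases "max_modulus f r > 0")
      case True
      have "ln (max_modulus f r) \<le> a * r"
        using r0[OF r(1)] r(2) by (simp add: field_simps)
      also have "\<dots> \<le> A * r" using r by (intro mult_right_mono) (auto simp: A_def)
      finally show ?thesis using True by (metis exp_le_cancel_iff exp_ln)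
    next
      case False
      then show ?thesis by (meson exp_ge_zero not_le order_trans)
    qed
    also have "\<dots> \<le> max B 1 * exp (A * r)" by simp
    finally show ?thesis using le by (simp add: r_def)
  qed
  then show ?thesis by (intro that[of "max B 1" A]) (auto simp: A_def)
qed

lemma exponential_typeI:
  assumes "f holomorphic_on UNIV" and "\<And>z. cmod (f z) \<le> C * exp (A * cmod z)"
  shows "exponential_type f"
proof -
  \<comment> \<open>\<open>D \<ge> 1\<close> and \<open>B \<ge> 0\<close> make
    \<open>ln D + B * r\<close> non-negative, which covers \<open>max_modulus f r = 0\<close> with
    its default \<open>ln 0 = 0\<close>, and give \<open>ln D \<le> ln D * r\<close> for
    \<open>r \<ge> 1\<close>.\<close>
  define D where "D = max 1 C"
  define B where "B = max 0 A"
  have le: "cmod (f z) \<le> D * exp (B * cmod z)" for z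
  proof -
    have "cmod (f z) \<le> C * exp (A * cmod z)" by fact
    also have "\<dots> \<le> D * exp (B * cmod z)"
      by (intro mult_mono) (auto simp: D_def B_def mult_right_mono)
    finally show ?thesis .
  qed
  have "ln (max_modulus f r) / r \<le> ln D + B" if "r \<ge> 1" for r
  proof -
    have "max_modulus f r \<le> D * exp (B * r)"
      unfolding max_modulus_def
    proof (rule cSUP_least)
      show "sphere (0::complex) r \<noteq> {}" using that by simp
      show "cmod (f z) \<le> D * exp (B * r)" if "z \<in> sphere 0 r" for z
        using le[of z] that by simp
    qed
    then have "ln (max_modulus f r) \<le> ln D + B * r"
    proof (cases "max_modulus f r > 0")
      case True
      then have "ln (max_modulus f r) \<le> ln (D * exp (B * r))"
        using \<open>max_modulus f r \<le> D * exp (B * r)\<close> by simp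
      also have "\<dots> = ln D + B * r" by (simp add: ln_mult D_def)
      finally show ?thesis .
    next
      case False
      have "max_modulus f r \<ge> 0"
      proof -
        have "bdd_above ((\<lambda>z. cmod (f z)) ` sphere 0 r)"
          by (rule bdd_aboveI[of _ "D * exp (B * r)"]) (use le in auto)
        moreover have "complex_of_real r \<in> sphere 0 r" using that by simp
        ultimately have "cmod (f (complex_of_real r)) \<le> max_modulus f r"
          unfolding max_modulus_def by (metis (mono_tags, lifting) cSUP_upper)
        then show ?thesis by (meson norm_ge_zero order_trans)
      qed
      with False have "max_modulus f r = 0" by simp
      then show ?thesis using that by (simp add: D_def B_def)
    qed
    also have "\<dots> \<le> ln D * r + B * r"
      using that by (simp add: D_def mult_le_cancel_left1)
    finally show ?thesis using that by (simp add: field_simps)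
  qed
  then have "Limsup at_top (\<lambda>r::real. ereal (ln (max_modulus f r) / r)) \<le> ereal (ln D + B)"
    by (intro Limsup_bounded) (auto simp: eventually_at_top_linorder)
  also have "\<dots> < \<infinity>" by simp
  finally show ?thesis using assms by (simp add: exponential_type_def)
qed

text \<open>Cauchy's inequality on the circle of radius \<open>n / A\<close>, the minimiser of
  \<open>exp (A * r) / r ^ n\<close>; with \<open>fact n \<le> n ^ n\<close> only
  \<open>(A * exp 1) ^ n\<close> remains. Geometric growth of the derivatives is the form in which
  exponential type is used: it makes the Borel series converge near infinity and
  \<open>diff_operator\<close> continuous.\<close>

lemma exponential_type_deriv_bound:
  assumes "exponential_type f"
  obtains C \<tau> where "C > 0" "\<tau> > 0" "\<And>n. cmod ((deriv ^^ n) f 0) \<le> C * \<tau> ^ n"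
proof -
  have hol: "f holomorphic_on UNIV"
    using assms by (simp add: exponential_type_def)
  obtain C A where CA: "C > 0" "A > 0" "\<And>z. cmod (f z) \<le> C * exp (A * cmod z)"
    using exponential_typeD[OF assms] by blast
  have "cmod ((deriv ^^ n) f 0) \<le> C * (A * exp 1) ^ n" for n
  proof (cases "n = 0")
    case True
    then show ?thesis using CA(3)[of 0] by simp
  next
    case False
    define r where "r = real n / A"
    have r: "r > 0" using False CA by (simp add: r_def)
    have "cmod ((deriv ^^ n) f 0) \<le> fact n * (C * exp (A * r)) / r ^ n"
    proof (rule Cauchy_inequality)
      show "cmod (f x) \<le> C * exp (A * r)" if "cmod (0 - x) = r" for x
        using CA(3)[of x] that by simp
    qed (use r in \<open>simp_all add: holomorphic_on_imp_continuous_on holomorphic_on_subset[OF hol subset_UNIV]\<close>)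
    also have "\<dots> = (fact n / real n ^ n) * (C * (A * exp 1) ^ n)"
      using CA False by (simp add: r_def power_divide power_mult_distrib flip: exp_of_nat_mult)
    also have "\<dots> \<le> 1 * (C * (A * exp 1) ^ n)"
    proof (rule mult_right_mono)
      have "fact n \<le> real n ^ n" using fact_le_power[of n, where ?'a = real] by simp
      then show "fact n / real n ^ n \<le> (1::real)" using False by simp
      show "0 \<le> C * (A * exp 1) ^ n" using CA by simp
    qed
    finally show ?thesis by simp
  qed
  then show ?thesis using CA by (intro that[of C "A * exp 1"]) auto
qed

section \<open>Bounded functionals and their transforms\<close>

text \<open>Integrals against complex measures on \<open>P\<close>, taken abstractly so that path
  integrals, finite combinations of point evaluations and sums of these are treated alike. Arguments
  are total functions, hence the restriction of each clause to functions continuous on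
  \<open>P\<close>; bounding by every \<open>M\<close> avoids a supremum norm.\<close>

definition bounded_functional ::
  "complex set \<Rightarrow> ((complex \<Rightarrow> complex) \<Rightarrow> complex) \<Rightarrow> bool" where
  "bounded_functional P I \<longleftrightarrow>
     (\<forall>f g. continuous_on P f \<longrightarrow> continuous_on P g \<longrightarrow> I (\<lambda>u. f u + g u) = I f + I g) \<and>
     (\<forall>c f. continuous_on P f \<longrightarrow> I (\<lambda>u. c * f u) = c * I f) \<and>
     (\<exists>\<Lambda>\<ge>0. \<forall>f M. continuous_on P f \<longrightarrow> M \<ge> 0 \<longrightarrow> (\<forall>u\<in>P. cmod (f u) \<le> M) \<longrightarrow>
        cmod (I f) \<le> \<Lambda> * M)"

lemma bounded_functional_add:
  "bounded_functional P I \<Longrightarrow> continuous_on P f \<Longrightarrow> continuous_on P g \<Longrightarrow>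
     I (\<lambda>u. f u + g u) = I f + I g"
  by (simp add: bounded_functional_def)

lemma bounded_functional_cmult:
  "bounded_functional P I \<Longrightarrow> continuous_on P f \<Longrightarrow> I (\<lambda>u. c * f u) = c * I f"
  by (simp add: bounded_functional_def)

lemma bounded_functional_diff:
  assumes "bounded_functional P I" "continuous_on P f" "continuous_on P g"
  shows "I (\<lambda>u. f u - g u) = I f - I g"
proof -
  have "I (\<lambda>u. f u + (-1) * g u) = I f + I (\<lambda>u. (-1) * g u)"
    using assms by (intro bounded_functional_add continuous_intros) auto
  also have "I (\<lambda>u. (-1) * g u) = -1 * I g"
    using assms by (intro bounded_functional_cmult)
  finally show ?thesis by simp
qed

lemma bounded_functional_zero:
  assumes "bounded_functional P I"
  shows "I (\<lambda>u. 0) = 0"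
  using bounded_functional_diff[OF assms, of "\<lambda>u. 0" "\<lambda>u. 0"] by simp

text \<open>The difference of the two functions is bounded on \<open>P\<close> by
  \<open>M = 0\<close>, so values off \<open>P\<close> cannot matter.\<close>

lemma bounded_functional_cong:
  assumes "bounded_functional P I" "continuous_on P f" "\<And>u. u \<in> P \<Longrightarrow> f u = g u"
  shows "I f = I g"
proof -
  have g: "continuous_on P g" using assms(2,3) continuous_on_cong by metis
  obtain \<Lambda> where "\<And>f M. continuous_on P f \<Longrightarrow> M \<ge> 0 \<Longrightarrow> \<forall>u\<in>P. cmod (f u) \<le> M \<Longrightarrow>
        cmod (I f) \<le> \<Lambda> * M"
    using assms(1) unfolding bounded_functional_def by blast
  from this[of "\<lambda>u. f u - g u" 0] assms g have "I (\<lambda>u. f u - g u) = 0"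
    by (auto intro: continuous_intros)
  with bounded_functional_diff[OF assms(1,2) g] show ?thesis by simp
qed

lemma bounded_functional_sum:
  assumes "bounded_functional P I" "\<And>n::nat. continuous_on P (t n)"
  shows "I (\<lambda>u. \<Sum>n<N. t n u) = (\<Sum>n<N. I (t n))"
proof (induction N)
  case 0
  then show ?case using bounded_functional_zero[OF assms(1)] by simp
next
  case (Suc N)
  have "I (\<lambda>u. (\<Sum>n<N. t n u) + t N u) = I (\<lambda>u. \<Sum>n<N. t n u) + I (t N)"
    using assms by (intro bounded_functional_add continuous_intros) auto
  with Suc show ?case by simp
qed

text \<open>The M-test gives uniform convergence on \<open>P\<close>, and boundedness carries it
  through \<open>I\<close>. The expansions of exponential and Cauchy kernels below are integrated
  termwise by this.\<close>

lemma bounded_functional_sums: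
  assumes "bounded_functional P I" "\<And>n. continuous_on P (t n)"
    and "\<And>n u. u \<in> P \<Longrightarrow> cmod (t n u) \<le> B n" "summable B"
  shows "(\<lambda>n. I (t n)) sums I (\<lambda>u. \<Sum>n. t n u)"
proof -
  let ?s = "\<lambda>u. \<Sum>n. t n u"
  obtain \<Lambda> where \<Lambda>: "\<Lambda> \<ge> 0" "\<And>f M. continuous_on P f \<Longrightarrow> M \<ge> 0 \<Longrightarrow>
      \<forall>u\<in>P. cmod (f u) \<le> M \<Longrightarrow> cmod (I f) \<le> \<Lambda> * M"
    using assms(1) unfolding bounded_functional_def by blast
  have ul: "uniform_limit P (\<lambda>N u. \<Sum>n<N. t n u) ?s sequentially"
    by (rule Weierstrass_m_test[OF assms(3,4)])
  have cs: "continuous_on P ?s"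
    by (rule uniform_limit_theorem[OF _ ul]) (auto intro!: always_eventually continuous_on_sum assms)
  have "(\<lambda>N. I (\<lambda>u. \<Sum>n<N. t n u)) \<longlonglongrightarrow> I ?s"
  proof (rule LIMSEQ_I)
    fix e :: real assume "e > 0"
    define d where "d = e / (\<Lambda> + 1)"
    have d: "d > 0" using \<open>e > 0\<close> \<Lambda> by (simp add: d_def)
    from uniform_limitD[OF ul d] obtain N0 where
      N0: "\<And>N u. N \<ge> N0 \<Longrightarrow> u \<in> P \<Longrightarrow> dist (\<Sum>n<N. t n u) (?s u) < d"
      unfolding eventually_sequentially by blast
    show "\<exists>N0. \<forall>N\<ge>N0. norm (I (\<lambda>u. \<Sum>n<N. t n u) - I ?s) < e"
    proof (intro exI allI impI)
      fix N assume N: "N \<ge> N0"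
      have "cmod (I (\<lambda>u. (\<Sum>n<N. t n u) - ?s u)) \<le> \<Lambda> * d"
        using N0[OF N] d cs assms by (intro \<Lambda>(2) continuous_intros) (auto simp: dist_norm less_imp_le)
      also have "\<dots> < e" using \<open>e > 0\<close> \<Lambda>(1) by (simp add: d_def field_simps)
      also have "I (\<lambda>u. (\<Sum>n<N. t n u) - ?s u) = I (\<lambda>u. \<Sum>n<N. t n u) - I ?s"
        using cs assms by (intro bounded_functional_diff continuous_intros) auto
      finally show "norm (I (\<lambda>u. \<Sum>n<N. t n u) - I ?s) < e" .
    qed
  qed
  then show ?thesis
    unfolding sums_def bounded_functional_sum[OF assms(1,2)] .
qed

text \<open>Weights are absorbed into the functional, so that iterating the operator stays within
  the same class: powers of the symbol become part of \<open>I\<close>.\<close>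

lemma bounded_functional_mult:
  assumes I: "bounded_functional P I" and P: "compact P" and w: "continuous_on P w"
  shows "bounded_functional P (\<lambda>f. I (\<lambda>u. w u * f u))"
proof -
  obtain \<Lambda> where \<Lambda>: "\<Lambda> \<ge> 0" "\<And>f M. continuous_on P f \<Longrightarrow> M \<ge> 0 \<Longrightarrow>
      \<forall>u\<in>P. cmod (f u) \<le> M \<Longrightarrow> cmod (I f) \<le> \<Lambda> * M"
    using I unfolding bounded_functional_def by blast
  have "bounded (w ` P)" by (intro compact_imp_bounded compact_continuous_image P w)
  then obtain W where W: "W > 0" "\<And>u. u \<in> P \<Longrightarrow> cmod (w u) \<le> W"
    unfolding bounded_pos by auto
  have *: "cmod (I (\<lambda>u. w u * f u)) \<le> (\<Lambda> * W) * M"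
    if "continuous_on P f" "M \<ge> 0" "\<forall>u\<in>P. cmod (f u) \<le> M" for f M
  proof -
    have "cmod (I (\<lambda>u. w u * f u)) \<le> \<Lambda> * (W * M)"
      using that W by (intro \<Lambda>(2) continuous_intros w) (auto simp: norm_mult intro!: mult_mono)
    then show ?thesis by (simp add: mult_ac)
  qed
  show ?thesis
    unfolding bounded_functional_def
  proof (intro conjI allI impI)
    show "I (\<lambda>u. w u * (f u + g u)) = I (\<lambda>u. w u * f u) + I (\<lambda>u. w u * g u)"
      if "continuous_on P f" "continuous_on P g" for f g
      unfolding distrib_left using that by (intro bounded_functional_add[OF I] continuous_intros w)
    show "I (\<lambda>u. w u * (c * f u)) = c * I (\<lambda>u. w u * f u)" if "continuous_on P f" for f c
      using bounded_functional_cmult[OF I, of "\<lambda>u. w u * f u" c] that w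
      by (simp add: mult.left_commute continuous_on_mult)
    show "\<exists>\<Lambda>\<ge>0. \<forall>f M. continuous_on P f \<longrightarrow> M \<ge> 0 \<longrightarrow> (\<forall>u\<in>P. cmod (f u) \<le> M) \<longrightarrow>
        cmod (I (\<lambda>u. w u * f u)) \<le> \<Lambda> * M"
      using * \<Lambda>(1) W(1) by (intro exI[of _ "\<Lambda> * W"]) auto
  qed
qed

section \<open>Exponential and Cauchy transforms of functionals\<close>

lemma norm_exp_mult_le:
  assumes "cmod a \<le> A"
  shows "cmod (exp (a * z)) \<le> exp (A * cmod z)"
proof -
  have "Re (a * z) \<le> cmod a * cmod z" using complex_Re_le_cmod[of "a * z"] by (simp only: norm_mult)
  also have "\<dots> \<le> A * cmod z" using assms by (intro mult_right_mono) auto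
  finally show ?thesis by simp
qed

lemma exp_sums_complex: "(\<lambda>n. x ^ n / fact n) sums exp (x::complex)"
  using exp_converges[of x] by (simp add: scaleR_conv_of_real field_simps)

lemma norm_continuous_bound:
  assumes "compact P" "continuous_on P (f :: complex \<Rightarrow> complex)"
  obtains B where "B > 0" "\<And>u. u \<in> P \<Longrightarrow> cmod (f u) \<le> B"
proof -
  have "bounded (f ` P)" by (intro compact_imp_bounded compact_continuous_image assms)
  then show ?thesis using that unfolding bounded_pos by auto
qed

text \<open>\<open>exp (\<psi> u * (z + h))\<close> is expanded in \<open>h\<close> and integrated
  termwise. The centre \<open>z\<close> is arbitrary, so the expansion yields both entirety and the
  derivatives at every point.\<close>

lemma exp_transform_powser:
  assumes I: "bounded_functional P I" and P: "compact P" and \<psi>: "continuous_on P \<psi>"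
  shows "(\<lambda>n. I (\<lambda>u. \<psi> u ^ n * exp (\<psi> u * z)) / fact n * h ^ n) sums I (\<lambda>u. exp (\<psi> u * (z + h)))"
proof -
  obtain A where A: "A > 0" "\<And>u. u \<in> P \<Longrightarrow> cmod (\<psi> u) \<le> A"
    using norm_continuous_bound[OF P \<psi>] by blast
  let ?t = "\<lambda>n u. h ^ n / fact n * (\<psi> u ^ n * exp (\<psi> u * z))"
  have "(\<lambda>n. I (?t n)) sums I (\<lambda>u. \<Sum>n. ?t n u)"
  proof (rule bounded_functional_sums[OF I])
    show "continuous_on P (?t n)" for n by (intro continuous_intros \<psi>)
    show "cmod (?t n u) \<le> (A * cmod h) ^ n / fact n * exp (A * cmod z)" if "u \<in> P" for n u
    proof -
      have "cmod (exp (\<psi> u * z)) \<le> exp (A * cmod z)" by (intro norm_exp_mult_le A that)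
      moreover have "cmod (\<psi> u) ^ n \<le> A ^ n" by (intro power_mono A that) auto
      ultimately have "cmod h ^ n / fact n * (cmod (\<psi> u) ^ n * cmod (exp (\<psi> u * z)))
         \<le> cmod h ^ n / fact n * (A ^ n * exp (A * cmod z))"
        by (intro mult_left_mono mult_mono) (use A in auto)
      then show ?thesis
        unfolding norm_mult norm_divide norm_power by (simp add: power_mult_distrib mult_ac norm_mult norm_power)
    qed
    show "summable (\<lambda>n. (A * cmod h) ^ n / fact n * exp (A * cmod z))"
      using summable_exp[of "A * cmod h"] by (intro summable_mult2) (simp add: field_simps)
  qed
  moreover have "(\<lambda>u. \<Sum>n. ?t n u) = (\<lambda>u. exp (\<psi> u * (z + h)))"
  proof
    fix u
    have "(\<lambda>n. (\<psi> u * h) ^ n / fact n * exp (\<psi> u * z)) sums (exp (\<psi> u * h) * exp (\<psi> u * z))"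
      by (intro sums_mult2 exp_sums_complex)
    then show "(\<Sum>n. ?t n u) = exp (\<psi> u * (z + h))"
      by (simp add: sums_iff power_mult_distrib mult_ac add_ac ring_distribs flip: exp_add)
  qed
  moreover have "I (?t n) = I (\<lambda>u. \<psi> u ^ n * exp (\<psi> u * z)) / fact n * h ^ n" for n
    by (subst bounded_functional_cmult[OF I]) (auto intro!: continuous_intros \<psi>)
  ultimately show ?thesis by simp
qed

lemma exp_transform_entire:
  assumes "bounded_functional P I" "compact P" "continuous_on P \<psi>"
  shows "(\<lambda>z. I (\<lambda>u. exp (\<psi> u * z))) holomorphic_on UNIV"
proof -
  have "(\<lambda>z. I (\<lambda>u. exp (\<psi> u * z))) holomorphic_on ball 0 r" for r
  proof (rule power_series_holomorphic)
    show "(\<lambda>n. I (\<lambda>u. \<psi> u ^ n * exp (\<psi> u * 0)) / fact n * (w - 0) ^ n) sums I (\<lambda>u. exp (\<psi> u * w))"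
      for w using exp_transform_powser[OF assms, of 0 w] by simp
  qed
  then show ?thesis
    by (meson UNIV_I centre_in_ball field_differentiable_at_within gt_ex holomorphic_onI
          holomorphic_on_imp_differentiable_at mem_ball open_ball)
qed

lemma exp_transform_higher_deriv:
  assumes "bounded_functional P I" "compact P" "continuous_on P \<psi>"
  shows "(deriv ^^ n) (\<lambda>z. I (\<lambda>u. exp (\<psi> u * z))) z = I (\<lambda>u. \<psi> u ^ n * exp (\<psi> u * z))"
  using powser_sums_higher_deriv[OF exp_transform_powser[OF assms], of n z] by simp

text \<open>\<open>\<lambda>z. exp (w * z)\<close> is an eigenfunction of
  \<open>diff_operator \<phi>\<close> with eigenvalue \<open>\<phi> w\<close>. The functional
  superposes such eigenfunctions, and \<open>I\<close> commutes with the Taylor series of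
  \<open>\<phi>\<close> at \<open>\<psi> u\<close>.\<close>

lemma diff_operator_exp_transform:
  assumes I: "bounded_functional P I" and P: "compact P" and \<psi>: "continuous_on P \<psi>"
    and \<phi>: "\<phi> holomorphic_on UNIV"
  shows "diff_operator \<phi> (\<lambda>z. I (\<lambda>u. exp (\<psi> u * z))) = (\<lambda>z. I (\<lambda>u. \<phi> (\<psi> u) * exp (\<psi> u * z)))"
proof
  fix z
  obtain A where A: "A > 0" "\<And>u. u \<in> P \<Longrightarrow> cmod (\<psi> u) \<le> A"
    using norm_continuous_bound[OF P \<psi>] by blast
  obtain B where B: "B > 0" "\<And>u. u \<in> P \<Longrightarrow> cmod (exp (\<psi> u * z)) \<le> B"
    using norm_continuous_bound[OF P continuous_on_exp[OF continuous_on_mult_right[OF \<psi>]]] by blast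
  let ?c = "\<lambda>n. (deriv ^^ n) \<phi> 0 / fact n"
  let ?t = "\<lambda>n u. ?c n * (\<psi> u ^ n * exp (\<psi> u * z))"
  have "(\<lambda>n. I (?t n)) sums I (\<lambda>u. \<Sum>n. ?t n u)"
  proof (rule bounded_functional_sums[OF I])
    show "continuous_on P (?t n)" for n by (intro continuous_intros \<psi>)
    show "cmod (?t n u) \<le> cmod (?c n) * A ^ n * B" if "u \<in> P" for n u
    proof -
      have "cmod (\<psi> u) ^ n * cmod (exp (\<psi> u * z)) \<le> A ^ n * B"
        by (intro mult_mono power_mono A B that) (use A in auto)
      then have "cmod (?c n) * (cmod (\<psi> u) ^ n * cmod (exp (\<psi> u * z))) \<le> cmod (?c n) * (A ^ n * B)"
        by (intro mult_left_mono) auto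
      then show ?thesis unfolding norm_mult norm_power by (simp only: mult.assoc)
    qed
    show "summable (\<lambda>n. cmod (?c n) * A ^ n * B)"
      using entire_powser_abs_summable[OF \<phi>, of A] A by (intro summable_mult2) auto
  qed
  moreover have "(\<lambda>u. \<Sum>n. ?t n u) = (\<lambda>u. \<phi> (\<psi> u) * exp (\<psi> u * z))"
  proof
    fix u
    show "(\<Sum>n. ?t n u) = \<phi> (\<psi> u) * exp (\<psi> u * z)"
      using sums_mult2[OF entire_powser[OF \<phi>, of 0 "\<psi> u"], of "exp (\<psi> u * z)"]
      by (simp add: sums_iff mult.assoc)
  qed
  moreover have "I (?t n) = ?c n * (deriv ^^ n) (\<lambda>z. I (\<lambda>u. exp (\<psi> u * z))) z" for n
    unfolding exp_transform_higher_deriv[OF I P \<psi>]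
    by (rule bounded_functional_cmult[OF I]) (auto intro!: continuous_intros \<psi>)
  ultimately show "diff_operator \<phi> (\<lambda>z. I (\<lambda>u. exp (\<psi> u * z))) z
      = I (\<lambda>u. \<phi> (\<psi> u) * exp (\<psi> u * z))"
    by (simp add: diff_operator_def sums_iff)
qed

text \<open>A geometric series in \<open>h / (z - \<psi> u)\<close>, uniform in \<open>u\<close>
  because \<open>cmod h\<close> stays below the distance \<open>d\<close>.\<close>

lemma cauchy_transform_powser:
  assumes I: "bounded_functional P I" and P: "compact P" and \<psi>: "continuous_on P \<psi>"
    and d: "\<And>u. u \<in> P \<Longrightarrow> d \<le> cmod (z - \<psi> u)" "cmod h < d"
  shows "(\<lambda>n. I (\<lambda>u. (-1) ^ n / (z - \<psi> u) ^ Suc n) * h ^ n) sums I (\<lambda>u. 1 / (z + h - \<psi> u))"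
proof -
  have d0: "d > 0" using d(2) norm_ge_zero[of h] by linarith
  have nz: "z - \<psi> u \<noteq> 0" if "u \<in> P" for u using d(1)[OF that] d0 by auto
  let ?t = "\<lambda>n u. h ^ n * ((-1) ^ n / (z - \<psi> u) ^ Suc n)"
  have ct: "continuous_on P (\<lambda>u. (-1) ^ n / (z - \<psi> u) ^ Suc n)" for n
    using nz by (intro continuous_intros \<psi>) auto
  have eq: "(\<Sum>n. ?t n u) = 1 / (z + h - \<psi> u)" if "u \<in> P" for u
  proof -
    let ?q = "- h / (z - \<psi> u)"
    have "cmod ?q < 1"
      using d(1)[OF that] d(2) nz[OF that] by (simp add: norm_divide)
    then have "(\<lambda>n. 1 / (z - \<psi> u) * ?q ^ n) sums (1 / (z - \<psi> u) * (1 / (1 - ?q)))"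
      by (intro sums_mult geometric_sums)
    moreover have "1 / (z - \<psi> u) * ?q ^ n = ?t n u" for n
      by (simp add: power_divide power_minus[of "h / (z - \<psi> u)"])
    moreover have "1 / (z - \<psi> u) * (1 / (1 - ?q)) = 1 / (z + h - \<psi> u)"
      using nz[OF that] by (simp add: field_simps)
    ultimately show ?thesis by (simp add: sums_iff)
  qed
  have "(\<lambda>n. I (?t n)) sums I (\<lambda>u. \<Sum>n. ?t n u)"
  proof (rule bounded_functional_sums[OF I])
    show "continuous_on P (?t n)" for n by (intro continuous_on_mult continuous_on_const ct)
    show "cmod (?t n u) \<le> (cmod h / d) ^ n * (1 / d)" if "u \<in> P" for n u
    proof -
      have "cmod h ^ n / (cmod (z - \<psi> u) ^ Suc n) \<le> cmod h ^ n / d ^ Suc n"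
        by (intro divide_left_mono power_mono mult_pos_pos zero_less_power d(1) that)
           (use d0 nz[OF that] in auto)
      then show ?thesis by (simp add: norm_mult norm_divide norm_power power_divide mult.commute)
    qed
    show "summable (\<lambda>n. (cmod h / d) ^ n * (1 / d))"
      using d d0 by (intro summable_mult2 summable_geometric) auto
  qed
  moreover have "I (\<lambda>u. 1 / (z + h - \<psi> u)) = I (\<lambda>u. \<Sum>n. ?t n u)"
  proof (rule bounded_functional_cong[OF I])
    show "continuous_on P (\<lambda>u. 1 / (z + h - \<psi> u))"
    proof (intro continuous_intros \<psi> ballI)
      fix u assume u: "u \<in> P"
      show "z + h - \<psi> u \<noteq> 0"
        using norm_diff_ineq[of "z - \<psi> u" h] d(1)[OF u] d(2)
        by (metis add_diff_eq add.commute diff_add_eq norm_zero not_le less_le_trans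
              diff_gt_0_iff_gt linorder_not_le order_less_le_trans)
    qed
  qed (use eq in simp)
  moreover have "I (?t n) = I (\<lambda>u. (-1) ^ n / (z - \<psi> u) ^ Suc n) * h ^ n" for n
    by (subst bounded_functional_cmult[OF I ct]) simp
  ultimately show ?thesis by simp
qed

lemma cauchy_transform_holomorphic:
  assumes I: "bounded_functional P I" and P: "compact P" and \<psi>: "continuous_on P \<psi>"
  shows "(\<lambda>z. I (\<lambda>u. 1 / (z - \<psi> u))) holomorphic_on - (\<psi> ` P)"
  unfolding holomorphic_on_def
proof
  fix z assume z: "z \<in> - (\<psi> ` P)"
  have "closed (\<psi> ` P)" using P \<psi> compact_continuous_image compact_imp_closed by blast
  with z obtain d where d: "d > 0" "ball z d \<subseteq> - (\<psi> ` P)"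
    by (meson open_Compl openE)
  have d': "d \<le> cmod (z - \<psi> u)" if "u \<in> P" for u
    using d(2) that by (force simp: dist_norm)
  have "(\<lambda>z. I (\<lambda>u. 1 / (z - \<psi> u))) holomorphic_on ball z d"
  proof (rule power_series_holomorphic)
    fix w assume "w \<in> ball z d"
    then have "cmod (w - z) < d" by (simp add: dist_norm norm_minus_commute)
    from cauchy_transform_powser[OF I P \<psi> d' this]
    show "(\<lambda>n. I (\<lambda>u. (-1) ^ n / (z - \<psi> u) ^ Suc n) * (w - z) ^ n) sums I (\<lambda>u. 1 / (w - \<psi> u))"
      by simp
  qed
  then show "(\<lambda>z. I (\<lambda>u. 1 / (z - \<psi> u))) field_differentiable (at z within - (\<psi> ` P))"
    using d(1) by (meson centre_in_ball field_differentiable_at_within holomorphic_on_imp_differentiable_at open_ball)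
qed

text \<open>By \<open>exp_transform_higher_deriv\<close> the coefficients
  \<open>I (\<lambda>u. \<psi> u ^ n)\<close> are the derivatives at 0 of the exponential transform
  of \<open>I\<close>, so this series is the Borel transform of that function.\<close>

lemma cauchy_transform_at_infinity:
  assumes I: "bounded_functional P I" and P: "compact P" and \<psi>: "continuous_on P \<psi>"
    and A: "A > 0" "\<And>u. u \<in> P \<Longrightarrow> cmod (\<psi> u) \<le> A" "cmod z > A"
  shows "(\<lambda>n. I (\<lambda>u. \<psi> u ^ n) / z ^ Suc n) sums I (\<lambda>u. 1 / (z - \<psi> u))"
proof -
  have z: "z \<noteq> 0" using A by auto
  let ?t = "\<lambda>n u. 1 / z ^ Suc n * \<psi> u ^ n"
  have ct: "continuous_on P (\<lambda>u. \<psi> u ^ n)" for n by (intro continuous_intros \<psi>)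
  have eq: "(\<Sum>n. ?t n u) = 1 / (z - \<psi> u)" if "u \<in> P" for u
  proof -
    have "cmod (\<psi> u) < cmod z" using A(2)[OF that] A(3) by linarith
    then have "cmod (\<psi> u / z) < 1" using z by (simp add: norm_divide)
    then have "(\<lambda>n. 1 / z * (\<psi> u / z) ^ n) sums (1 / z * (1 / (1 - \<psi> u / z)))"
      by (intro sums_mult geometric_sums)
    moreover have "1 / z * (\<psi> u / z) ^ n = ?t n u" for n by (simp add: power_divide)
    moreover have "1 / z * (1 / (1 - \<psi> u / z)) = 1 / (z - \<psi> u)"
      using z by (simp add: field_simps)
    ultimately show ?thesis by (simp add: sums_iff)
  qed
  have "(\<lambda>n. I (?t n)) sums I (\<lambda>u. \<Sum>n. ?t n u)"
  proof (rule bounded_functional_sums[OF I])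
    show "continuous_on P (?t n)" for n by (intro continuous_on_mult continuous_on_const ct)
    show "cmod (?t n u) \<le> (A / cmod z) ^ n * (1 / cmod z)" if "u \<in> P" for n u
    proof -
      have "cmod (\<psi> u) ^ n / cmod z ^ Suc n \<le> A ^ n / cmod z ^ Suc n"
        by (intro divide_right_mono power_mono A that) auto
      then show ?thesis by (simp add: norm_mult norm_divide norm_power power_divide mult.commute)
    qed
    have "A / cmod z < 1" using A(1,3) by (subst divide_less_eq_1_pos) linarith+
    then show "summable (\<lambda>n. (A / cmod z) ^ n * (1 / cmod z))"
      using A(1) by (intro summable_mult2 summable_geometric) auto
  qed
  moreover have "I (\<lambda>u. 1 / (z - \<psi> u)) = I (\<lambda>u. \<Sum>n. ?t n u)"
  proof (rule bounded_functional_cong[OF I])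
    show "continuous_on P (\<lambda>u. 1 / (z - \<psi> u))"
      by (intro continuous_intros \<psi>) (use A in force)
  qed (use eq in simp)
  moreover have "I (?t n) = I (\<lambda>u. \<psi> u ^ n) / z ^ Suc n" for n
    by (subst bounded_functional_cmult[OF I ct]) simp
  ultimately show ?thesis by simp
qed

section \<open>Continuity of the differential operator\<close>

lemma entire_higher_deriv_bound:
  assumes g: "g holomorphic_on UNIV" and "\<rho> > 0" "cmod z \<le> R"
    and M: "\<And>w. cmod w \<le> R + \<rho> \<Longrightarrow> cmod (g w) \<le> M"
  shows "cmod ((deriv ^^ n) g z) \<le> fact n * M / \<rho> ^ n"
proof (rule Cauchy_inequality)
  show "cmod (g x) \<le> M" if "cmod (z - x) = \<rho>" for x
  proof (rule M)
    show "cmod x \<le> R + \<rho>"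
      using norm_triangle_ineq4[of z "z - x"] that assms(3) by simp
  qed
qed (use assms in \<open>simp_all add: holomorphic_on_imp_continuous_on holomorphic_on_subset[OF g subset_UNIV]\<close>)

lemma entire_norm_bound:
  assumes "g holomorphic_on UNIV"
  obtains M where "M > 0" "\<And>w. cmod w \<le> R \<Longrightarrow> cmod (g w) \<le> M"
proof (rule norm_continuous_bound[of "cball 0 R" g])
  show "continuous_on (cball 0 R) g"
    by (intro holomorphic_on_imp_continuous_on holomorphic_on_subset[OF assms subset_UNIV])
qed (use that in auto)

text \<open>The derivatives of \<open>\<phi>\<close> cost \<open>\<tau> ^ n\<close>, while Cauchy's
  inequality with radius \<open>2 * \<tau>\<close> gains \<open>(2 * \<tau>) ^ n\<close>. This
  leaves the ratio \<open>1 / 2\<close>, at the price of widening the disc by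
  \<open>2 * \<tau>\<close>.\<close>

lemma diff_operator_term_bound:
  assumes C: "C > 0" "\<tau> > 0" "\<And>n. cmod ((deriv ^^ n) \<phi> 0) \<le> C * \<tau> ^ n"
    and g: "g holomorphic_on UNIV" "\<And>w. cmod w \<le> R + 2 * \<tau> \<Longrightarrow> cmod (g w) \<le> M" "cmod z \<le> R"
  shows "cmod ((deriv ^^ n) \<phi> 0 / fact n * (deriv ^^ n) g z) \<le> C * M * (1 / 2) ^ n"
proof -
  have "cmod ((deriv ^^ n) \<phi> 0 / fact n * (deriv ^^ n) g z)
     \<le> C * \<tau> ^ n / fact n * (fact n * M / (2 * \<tau>) ^ n)"
    unfolding norm_mult norm_divide norm_fact
    by (intro mult_mono divide_right_mono C(3) entire_higher_deriv_bound[OF g(1) _ g(3,2)])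
       (use C in auto)
  also have "\<dots> = C * M * (1 / 2) ^ n"
    using C by (simp add: power_mult_distrib power_divide field_simps)
  finally show ?thesis .
qed

lemma diff_operator_summable:
  assumes "exponential_type \<phi>" "g holomorphic_on UNIV"
  shows "summable (\<lambda>n. (deriv ^^ n) \<phi> 0 / fact n * (deriv ^^ n) g z)"
proof -
  obtain C \<tau> where C: "C > 0" "\<tau> > 0" "\<And>n. cmod ((deriv ^^ n) \<phi> 0) \<le> C * \<tau> ^ n"
    using exponential_type_deriv_bound[OF assms(1)] by blast
  obtain M where M: "M > 0" "\<And>w. cmod w \<le> cmod z + 2 * \<tau> \<Longrightarrow> cmod (g w) \<le> M"
    using entire_norm_bound[OF assms(2)] by blast
  have "summable (\<lambda>n. C * M * (1 / 2) ^ n)" by (intro summable_mult summable_geometric) simp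
  then show ?thesis
    by (rule summable_comparison_test'[where N = 0])
       (use diff_operator_term_bound[OF C assms(2) M(2)] in auto)
qed

text \<open>\<open>K\<close> and \<open>\<rho>\<close> depend on \<open>\<phi>\<close> alone, not on
  the disc, which makes the estimate iterable.\<close>

lemma diff_operator_bound:
  assumes "exponential_type \<phi>"
  obtains K \<rho> where "K > 0" "\<rho> > 0"
    "\<And>g R M z. g holomorphic_on UNIV \<Longrightarrow> (\<And>w. cmod w \<le> R + \<rho> \<Longrightarrow> cmod (g w) \<le> M) \<Longrightarrow> cmod z \<le> R \<Longrightarrow>
       cmod (diff_operator \<phi> g z) \<le> K * M"
proof -
  obtain C \<tau> where C: "C > 0" "\<tau> > 0" "\<And>n. cmod ((deriv ^^ n) \<phi> 0) \<le> C * \<tau> ^ n"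
    using exponential_type_deriv_bound[OF assms] by blast
  show ?thesis
  proof (rule that[of "C * 2" "2 * \<tau>"])
    fix g R M z
    assume g: "g holomorphic_on UNIV" "\<And>w. cmod w \<le> R + 2 * \<tau> \<Longrightarrow> cmod (g w) \<le> M" "cmod z \<le> R"
    have s: "(\<lambda>n. C * M * (1 / 2) ^ n) sums (C * M * (1 / (1 - 1 / 2)))"
      by (intro sums_mult geometric_sums) simp
    have "cmod (diff_operator \<phi> g z) \<le> (\<Sum>n. C * M * (1 / 2) ^ n)"
      unfolding diff_operator_def
      by (rule norm_suminf_le) (use diff_operator_term_bound[OF C g] s in \<open>auto simp: sums_iff\<close>)
    then show "cmod (diff_operator \<phi> g z) \<le> C * 2 * M"
      using s by (simp add: sums_iff)
  qed (use C in auto)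
qed

lemma diff_operator_entire:
  assumes "exponential_type \<phi>" "g holomorphic_on UNIV"
  shows "diff_operator \<phi> g holomorphic_on UNIV"
proof (rule holomorphic_uniform_sequence)
  obtain C \<tau> where C: "C > 0" "\<tau> > 0" "\<And>n. cmod ((deriv ^^ n) \<phi> 0) \<le> C * \<tau> ^ n"
    using exponential_type_deriv_bound[OF assms(1)] by blast
  let ?t = "\<lambda>n z. (deriv ^^ n) \<phi> 0 / fact n * (deriv ^^ n) g z"
  show "(\<lambda>z. \<Sum>n<N. ?t n z) holomorphic_on UNIV" for N
    by (intro holomorphic_intros holomorphic_higher_deriv assms) auto
  show "\<exists>d>0. cball x d \<subseteq> UNIV \<and>
      uniform_limit (cball x d) (\<lambda>N z. \<Sum>n<N. ?t n z) (diff_operator \<phi> g) sequentially" for x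
  proof (intro exI[of _ 1] conjI)
    obtain M where M: "M > 0" "\<And>w. cmod w \<le> (cmod x + 1) + 2 * \<tau> \<Longrightarrow> cmod (g w) \<le> M"
      using entire_norm_bound[OF assms(2)] by blast
    have "summable (\<lambda>n. C * M * (1 / 2) ^ n)" by (intro summable_mult summable_geometric) simp
    moreover have "norm (?t n z) \<le> C * M * (1 / 2) ^ n" if "z \<in> cball x 1" for n z
      using norm_triangle_ineq2[of z x] that
      by (intro diff_operator_term_bound[OF C assms(2) M(2)]) (auto simp: dist_norm norm_minus_commute)
    ultimately show "uniform_limit (cball x 1) (\<lambda>N z. \<Sum>n<N. ?t n z) (diff_operator \<phi> g) sequentially"
      unfolding diff_operator_def by (intro Weierstrass_m_test)
  qed auto
qed auto

lemma diff_operator_funpow_entire: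
  assumes "exponential_type \<phi>" "g holomorphic_on UNIV"
  shows "(diff_operator \<phi> ^^ n) g holomorphic_on UNIV"
  by (induction n) (use assms diff_operator_entire in auto)

lemma diff_operator_diff:
  assumes "exponential_type \<phi>" "f holomorphic_on UNIV" "g holomorphic_on UNIV"
  shows "diff_operator \<phi> (\<lambda>z. f z - g z) = (\<lambda>z. diff_operator \<phi> f z - diff_operator \<phi> g z)"
proof
  fix z
  have "(deriv ^^ n) (\<lambda>z. f z - g z) z = (deriv ^^ n) f z - (deriv ^^ n) g z" for n
    by (rule higher_deriv_diff[OF assms(2,3)]) auto
  then show "diff_operator \<phi> (\<lambda>z. f z - g z) z = diff_operator \<phi> f z - diff_operator \<phi> g z"
    unfolding diff_operator_def
    by (simp add: right_diff_distrib suminf_diff[OF diff_operator_summable diff_operator_summable] assms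
             del: times_divide_eq_left)
qed

lemma diff_operator_funpow_continuous:
  assumes "exponential_type \<phi>"
  obtains K S where "K > 0" "S \<ge> 0"
    "\<And>f g M z. f holomorphic_on UNIV \<Longrightarrow> g holomorphic_on UNIV \<Longrightarrow>
       (\<And>w. cmod w \<le> R + S \<Longrightarrow> cmod (f w - g w) \<le> M) \<Longrightarrow> cmod z \<le> R \<Longrightarrow>
       cmod ((diff_operator \<phi> ^^ n) f z - (diff_operator \<phi> ^^ n) g z) \<le> K * M"
proof -
  obtain K \<rho> where K: "K > 0" "\<rho> > 0"
    "\<And>g R M z. g holomorphic_on UNIV \<Longrightarrow> (\<And>w. cmod w \<le> R + \<rho> \<Longrightarrow> cmod (g w) \<le> M) \<Longrightarrow> cmod z \<le> R \<Longrightarrow>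
       cmod (diff_operator \<phi> g z) \<le> K * M"
    using diff_operator_bound[OF assms] by metis
  have *: "cmod ((diff_operator \<phi> ^^ n) f z - (diff_operator \<phi> ^^ n) g z) \<le> K ^ n * M"
    if "f holomorphic_on UNIV" "g holomorphic_on UNIV"
       "\<And>w. cmod w \<le> R + real n * \<rho> \<Longrightarrow> cmod (f w - g w) \<le> M" "cmod z \<le> R" for f g M z n R
    using that(3,4)
  proof (induction n arbitrary: R z)
    case 0
    then show ?case by simp
  next
    case (Suc n)
    let ?F = "(diff_operator \<phi> ^^ n) f" and ?G = "(diff_operator \<phi> ^^ n) g"
    have h: "?F holomorphic_on UNIV" "?G holomorphic_on UNIV"
      by (intro diff_operator_funpow_entire assms that)+
    have "cmod (diff_operator \<phi> (\<lambda>w. ?F w - ?G w) z) \<le> K * (K ^ n * M)"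
    proof (rule K(3)[OF _ _ Suc.prems(2)])
      show "(\<lambda>w. ?F w - ?G w) holomorphic_on UNIV" by (intro holomorphic_intros h)
      show "cmod (?F w - ?G w) \<le> K ^ n * M" if "cmod w \<le> R + \<rho>" for w
        by (rule Suc.IH[OF _ that]) (use Suc.prems in \<open>auto simp: algebra_simps\<close>)
    qed
    then show ?case by (simp add: diff_operator_diff[OF assms h] mult_ac)
  qed
  show ?thesis
  proof (rule that[of "K ^ n" "real n * \<rho>"])
    show "K ^ n > 0" "real n * \<rho> \<ge> 0" using K by simp_all
  qed (rule *)
qed

lemma diff_operator_uniform_limit:
  assumes "exponential_type \<phi>" "\<And>m. s m holomorphic_on UNIV" "f holomorphic_on UNIV"
    and "\<And>R. uniform_limit (cball 0 R) s f sequentially"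
  shows "uniform_limit (cball 0 R) (\<lambda>m. (diff_operator \<phi> ^^ n) (s m)) ((diff_operator \<phi> ^^ n) f) sequentially"
proof (rule uniform_limitI)
  fix e :: real assume e: "e > 0"
  obtain K S where K: "K > 0" "S \<ge> 0"
    "\<And>f g M z. f holomorphic_on UNIV \<Longrightarrow> g holomorphic_on UNIV \<Longrightarrow>
       (\<And>w. cmod w \<le> R + S \<Longrightarrow> cmod (f w - g w) \<le> M) \<Longrightarrow> cmod z \<le> R \<Longrightarrow>
       cmod ((diff_operator \<phi> ^^ n) f z - (diff_operator \<phi> ^^ n) g z) \<le> K * M"
    using diff_operator_funpow_continuous[OF assms(1)] by metis
  have "\<forall>\<^sub>F m in sequentially. \<forall>w\<in>cball 0 (R + S). dist (s m w) (f w) < e / (2 * K)"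
    by (rule uniform_limitD[OF assms(4)]) (use e K in auto)
  then show "\<forall>\<^sub>F m in sequentially. \<forall>x\<in>cball 0 R.
      dist ((diff_operator \<phi> ^^ n) (s m) x) ((diff_operator \<phi> ^^ n) f x) < e"
  proof eventually_elim
    case (elim m)
    show ?case
    proof
      fix x :: complex assume "x \<in> cball 0 R"
      then have "cmod ((diff_operator \<phi> ^^ n) (s m) x - (diff_operator \<phi> ^^ n) f x) \<le> K * (e / (2 * K))"
        using elim by (intro K(3) assms) (auto simp: dist_norm less_imp_le)
      also have "\<dots> < e" using e K by simp
      finally show "dist ((diff_operator \<phi> ^^ n) (s m) x) ((diff_operator \<phi> ^^ n) f x) < e"
        by (simp add: dist_norm)
    qed
  qed
qed

text \<open>Induction on \<open>n\<close>, with the factor accumulated so far moved into the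
  functional as a weight.\<close>

lemma diff_operator_funpow_exp_transform:
  assumes I: "bounded_functional P I" and P: "compact P" and \<psi>: "continuous_on P \<psi>"
    and \<phi>: "\<phi> holomorphic_on UNIV"
  shows "(diff_operator \<phi> ^^ n) (\<lambda>z. I (\<lambda>u. exp (\<psi> u * z))) =
     (\<lambda>z. I (\<lambda>u. \<phi> (\<psi> u) ^ n * exp (\<psi> u * z)))"
proof (induction n)
  case 0
  then show ?case by simp
next
  case (Suc n)
  have c: "continuous_on P (\<lambda>u. \<phi> (\<psi> u))"
    by (rule continuous_on_compose2[OF holomorphic_on_imp_continuous_on[OF \<phi>] \<psi>]) auto
  let ?J = "\<lambda>f. I (\<lambda>u. \<phi> (\<psi> u) ^ n * f u)"
  have J: "bounded_functional P ?J" by (intro bounded_functional_mult I P continuous_intros c)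
  show ?case using diff_operator_exp_transform[OF J P \<psi> \<phi>] Suc by (simp add: mult_ac)
qed

section \<open>The conjugate indicator diagram\<close>

definition borel_carrier :: "(complex \<Rightarrow> complex) \<Rightarrow> complex set \<Rightarrow> bool" where
  "borel_carrier f K \<longleftrightarrow> compact K \<and> convex K \<and>
     (\<exists>g. g holomorphic_on (- K) \<and> (\<forall>\<^sub>F z in at_infinity. g z = borel_transform f z))"

lemma eventually_notin_bounded:
  fixes S :: "'a::real_normed_vector set"
  assumes "bounded S"
  shows "\<forall>\<^sub>F z in at_infinity. z \<notin> S"
proof -
  obtain B where "\<And>x. x \<in> S \<Longrightarrow> norm x \<le> B" using assms bounded_iff by blast
  then show ?thesis unfolding eventually_at_infinity by (intro exI[of _ "B + 1"]) force
qed

text \<open>Janiszewski's theorem: neither set separates \<open>x\<close> from \<open>y\<close>, and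
  the intersection, being convex, is connected. This lets two continuations be compared everywhere
  off both carriers.\<close>

lemma connected_Compl_Un_convex:
  fixes K L :: "complex set"
  assumes "compact K" "convex K" "compact L" "convex L"
  shows "connected (- (K \<union> L))"
proof (rule connected_iff_connected_component[THEN iffD2], intro ballI)
  fix x y assume xy: "x \<in> - (K \<union> L)" "y \<in> - (K \<union> L)"
  have "connected (- K)" "connected (- L)"
    using assms by (auto intro!: connected_complement_bounded_convex compact_imp_bounded)
  then have "connected_component (- K) x y" "connected_component (- L) x y"
    using xy by (auto simp: connected_iff_connected_component)
  then show "connected_component (- (K \<union> L)) x y"
    using assms by (intro Janiszewski) (auto intro: compact_imp_closed convex_connected convex_Int)
qed

lemma borel_carrier_continuation_unique:
  assumes K: "compact K" "convex K" "g holomorphic_on - K" "\<forall>\<^sub>F z in at_infinity. g z = b z"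
    and L: "compact L" "convex L" "h holomorphic_on - L" "\<forall>\<^sub>F z in at_infinity. h z = b z"
    and z: "z \<notin> K \<union> L"
  shows "g z = h z"
proof -
  have "\<forall>\<^sub>F z in at_infinity. g z = h z \<and> z \<notin> K \<union> L"
  proof -
    have "bounded (K \<union> L)" using K L by (auto intro: compact_imp_bounded)
    then have "\<forall>\<^sub>F z in at_infinity. z \<notin> K \<union> L"
      by (rule eventually_notin_bounded)
    with K(4) L(4) show ?thesis by eventually_elim auto
  qed
  then obtain b where b: "\<And>z. cmod z \<ge> b \<Longrightarrow> g z = h z \<and> z \<notin> K \<union> L"
    unfolding eventually_at_infinity by blast
  \<comment> \<open>The unit disc around this real point lies beyond radius \<open>b\<close>, where
    \<open>g\<close> and \<open>h\<close> agree; the identity theorem starts from there.\<close>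
  define w where "w = complex_of_real (\<bar>b\<bar> + 2)"
  have big: "cmod x \<ge> b" if "x \<in> ball w 1" for x
  proof -
    have "\<bar>b\<bar> + 2 - cmod x \<le> cmod (w - x)"
      using norm_triangle_ineq2[of w x] by (simp add: w_def del: of_real_add)
    also have "\<dots> < 1" using that by (simp add: dist_norm)
    finally show ?thesis by linarith
  qed
  have "(\<lambda>z. g z - h z) z = 0"
  proof (rule analytic_continuation_open[of "ball w 1" "- (K \<union> L)" "\<lambda>z. g z - h z" "\<lambda>_. 0"])
    show "connected (- (K \<union> L))" by (rule connected_Compl_Un_convex) fact+
    show "open (- (K \<union> L))" using K L by (auto intro!: open_Compl compact_imp_closed)
    show "(\<lambda>z. g z - h z) holomorphic_on - (K \<union> L)"
      by (intro holomorphic_intros holomorphic_on_subset[OF K(3)] holomorphic_on_subset[OF L(3)]) auto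
  qed (use big b z in auto)
  then show ?thesis by simp
qed

text \<open>\<open>LEAST\<close> is meaningful only if the intersection of all carriers is again a
  carrier. A point outside it misses some carrier, whose continuation supplies the value there;
  uniqueness makes the choice immaterial and the glued function holomorphic.\<close>

lemma borel_carrier_Inter:
  assumes "borel_carrier f K0"
  shows "borel_carrier f (\<Inter>{K. borel_carrier f K})"
proof -
  let ?F = "{K. borel_carrier f K}" and ?b = "borel_transform f"
  have "\<forall>K. \<exists>g. borel_carrier f K \<longrightarrow> g holomorphic_on - K \<and> (\<forall>\<^sub>F z in at_infinity. g z = ?b z)"
    by (simp add: borel_carrier_def)
  then obtain G where "\<forall>K. borel_carrier f K \<longrightarrow>
      G K holomorphic_on - K \<and> (\<forall>\<^sub>F z in at_infinity. G K z = ?b z)"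
    by (rule choice[THEN exE])
  then have G: "\<And>K. borel_carrier f K \<Longrightarrow> G K holomorphic_on - K"
    "\<And>K. borel_carrier f K \<Longrightarrow> \<forall>\<^sub>F z in at_infinity. G K z = ?b z"
    by blast+
  define g where "g z = G (SOME K. borel_carrier f K \<and> z \<notin> K) z" for z
  have g: "g z = G K z" if "borel_carrier f K" "z \<notin> K" for K z
  proof -
    define L where "L = (SOME K. borel_carrier f K \<and> z \<notin> K)"
    have L: "borel_carrier f L \<and> z \<notin> L"
      unfolding L_def by (rule someI_ex) (use that in blast)
    have "G L z = G K z"
      by (rule borel_carrier_continuation_unique[where K = L and L = K and b = "borel_transform f"])
         (use that L G in \<open>auto simp: borel_carrier_def\<close>)
    then show ?thesis by (simp add: g_def L_def)
  qed
  show ?thesis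
    unfolding borel_carrier_def[of f "\<Inter>?F"]
  proof (intro conjI exI[of _ g])
    show "compact (\<Inter>?F)"
    proof -
      have "\<Inter>?F = K0 \<inter> \<Inter>?F" using assms by auto
      moreover have "compact K0" "closed (\<Inter>?F)"
        using assms by (auto simp: borel_carrier_def compact_imp_closed)
      ultimately show ?thesis by (metis compact_Int_closed)
    qed
    show "convex (\<Inter>?F)" by (rule convex_Inter) (auto simp: borel_carrier_def)
    show "g holomorphic_on - \<Inter>?F"
      unfolding holomorphic_on_def
    proof
      fix z assume "z \<in> - \<Inter>?F"
      then obtain K where K: "borel_carrier f K" "z \<notin> K" by auto
      then have o: "open (- K)" by (auto simp: borel_carrier_def compact_imp_closed)
      have "g holomorphic_on - K"
        by (rule holomorphic_transform[OF G(1)[OF K(1)]]) (use g K in auto)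
      then show "g field_differentiable at z within - \<Inter>?F"
        using o K by (meson ComplI field_differentiable_at_within holomorphic_on_imp_differentiable_at)
    qed
    have "bounded K0" using assms by (auto simp: borel_carrier_def compact_imp_bounded)
    then have "\<forall>\<^sub>F z in at_infinity. z \<notin> K0"
      by (rule eventually_notin_bounded)
    with G(2)[OF assms] show "\<forall>\<^sub>F z in at_infinity. g z = ?b z"
      by eventually_elim (use g assms in auto)
  qed
qed

lemma borel_carrier_conj_indicator_diagram:
  assumes "borel_carrier f K0"
  shows "borel_carrier f (conj_indicator_diagram f)" "conj_indicator_diagram f \<subseteq> K0"
proof -
  have "conj_indicator_diagram f = (LEAST K. borel_carrier f K)"
    by (simp add: conj_indicator_diagram_def borel_carrier_def)
  also have "\<dots> = \<Inter>{K. borel_carrier f K}"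
    by (rule Least_equality) (use borel_carrier_Inter[OF assms] in auto)
  finally have eq: "conj_indicator_diagram f = \<Inter>{K. borel_carrier f K}" .
  show "borel_carrier f (conj_indicator_diagram f)" "conj_indicator_diagram f \<subseteq> K0"
    unfolding eq using borel_carrier_Inter[OF assms] assms by auto
qed

section \<open>Zeros of entire functions of minimal type\<close>

lemma lower_density_of_nat:
  "lower_density (of_nat ` A) = Liminf at_top (\<lambda>r::real. ereal (card {n \<in> A. real n \<le> r} / r))"
proof -
  have "card {l \<in> of_nat ` A. cmod l \<le> r} = card {n \<in> A. real n \<le> r}" for r
  proof -
    have "{l \<in> of_nat ` A. cmod l \<le> r} = (of_nat :: nat \<Rightarrow> complex) ` {n \<in> A. real n \<le> r}" by auto
    then show ?thesis by (simp add: card_image inj_on_def)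
  qed
  then show ?thesis by (simp add: lower_density_def)
qed

lemma lower_density_posD:
  assumes "lower_density (of_nat ` A) > 0"
  obtains d r0 where "d > 0" "r0 > 0" "\<And>r. r \<ge> r0 \<Longrightarrow> d * r \<le> real (card {n \<in> A. real n \<le> r})"
proof -
  obtain d where d: "0 < ereal d" "ereal d < lower_density (of_nat ` A)"
    using assms ereal_dense2 by blast
  have "\<forall>\<^sub>F r in at_top. ereal d < ereal (card {n \<in> A. real n \<le> r} / r)"
    by (rule less_LiminfD) (use d in \<open>simp add: lower_density_of_nat\<close>)
  then obtain r1 where r1: "\<And>r. r \<ge> r1 \<Longrightarrow> d < card {n \<in> A. real n \<le> r} / r"
    unfolding eventually_at_top_linorder by auto
  show ?thesis
  proof (rule that[of d "max r1 1"])
    fix r assume "r \<ge> max r1 1"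
    then show "d * r \<le> real (card {n \<in> A. real n \<le> r})"
      using r1[of r] by (simp add: field_simps)
  qed (use d in auto)
qed

lemma entire_factor_zeros:
  assumes "finite Z" "Q holomorphic_on UNIV" "\<And>z. z \<in> Z \<Longrightarrow> Q z = 0"
  obtains F where "F holomorphic_on UNIV" "\<And>z. Q z = F z * (\<Prod>s\<in>Z. z - s)"
proof -
  have "\<exists>F. F holomorphic_on UNIV \<and> (\<forall>z. Q z = F z * (\<Prod>s\<in>Z. z - s))"
    using assms
  proof (induction Z rule: finite_induct)
    case empty
    then show ?case by auto
  next
    case (insert s Z)
    then obtain F where F: "F holomorphic_on UNIV" "\<And>z. Q z = F z * (\<Prod>s\<in>Z. z - s)" by auto
    have "Q s = 0" by (simp add: insert.prems)
    moreover have "(\<Prod>t\<in>Z. s - t) \<noteq> 0" using insert.hyps by auto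
    ultimately have Fs: "F s = 0" using F(2)[of s] by simp
    let ?G = "\<lambda>z. if z = s then deriv F s else (F z - F s) / (z - s)"
    have "?G holomorphic_on UNIV" by (rule pole_lemma[OF F(1)]) simp
    moreover have "Q z = ?G z * (\<Prod>s\<in>insert s Z. z - s)" for z
      using F(2)[of z] Fs insert.hyps by auto
    ultimately show ?case by blast
  qed
  then show ?thesis using that by blast
qed

text \<open>A substitute for Jensen's formula: divide by the zeros and apply the maximum principle.\<close>

lemma entire_zeros_bound:
  assumes Q: "Q holomorphic_on UNIV" and Z: "finite Z" "Z \<subseteq> cball x \<rho>" "\<And>z. z \<in> Z \<Longrightarrow> Q z = 0"
    and "\<rho> > 0" and M: "\<And>z. z \<in> sphere x (3 * \<rho>) \<Longrightarrow> cmod (Q z) \<le> M"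
  shows "cmod (Q x) * 2 ^ card Z \<le> M"
proof -
  obtain F where F: "F holomorphic_on UNIV" "\<And>z. Q z = F z * (\<Prod>s\<in>Z. z - s)"
    using entire_factor_zeros[OF Z(1) Q Z(3)] by blast
  have "cmod (F x) \<le> M / (2 * \<rho>) ^ card Z"
  proof (rule maximum_modulus_frontier[of F "cball x (3 * \<rho>)"])
    fix z assume "z \<in> frontier (cball x (3 * \<rho>))"
    then have z: "dist x z = 3 * \<rho>" by (simp add: frontier_cball)
    \<comment> \<open>On the circle of radius \<open>3 * \<rho>\<close> every zero is at distance at
      least \<open>2 * \<rho>\<close>, while the centre is within \<open>\<rho>\<close> of it, so
      each zero contributes a factor 2.\<close>
    have "(\<Prod>s\<in>Z. 2 * \<rho>) \<le> (\<Prod>s\<in>Z. cmod (z - s))"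
    proof (rule prod_mono)
      fix s assume "s \<in> Z"
      then have "dist x s \<le> \<rho>" using Z by auto
      then have "2 * \<rho> \<le> dist z s" using dist_triangle[of x z s] z by (simp add: dist_commute)
      then show "0 \<le> 2 * \<rho> \<and> 2 * \<rho> \<le> cmod (z - s)" using \<open>\<rho> > 0\<close> by (simp add: dist_norm)
    qed
    then have "cmod (F z) * (2 * \<rho>) ^ card Z \<le> cmod (F z) * (\<Prod>s\<in>Z. cmod (z - s))"
      by (intro mult_left_mono) auto
    also have "\<dots> = cmod (Q z)" by (simp add: F(2) norm_mult prod_norm)
    also have "\<dots> \<le> M" using z by (intro M) auto
    finally show "cmod (F z) \<le> M / (2 * \<rho>) ^ card Z" using \<open>\<rho> > 0\<close> by (simp add: field_simps)
  qed (use \<open>\<rho> > 0\<close> in \<open>auto intro!: holomorphic_on_imp_continuous_on holomorphic_on_subset[OF F(1)]\<close>)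
  moreover have "(\<Prod>s\<in>Z. cmod (x - s)) \<le> (\<Prod>s\<in>Z. \<rho>)"
    by (rule prod_mono) (use Z in \<open>auto simp: dist_norm\<close>)
  ultimately have "cmod (F x) * (\<Prod>s\<in>Z. cmod (x - s)) \<le> M / (2 * \<rho>) ^ card Z * \<rho> ^ card Z"
    by (intro mult_mono) (auto intro: prod_nonneg order_trans[OF norm_ge_zero])
  then have "cmod (Q x) \<le> M / (2 * \<rho>) ^ card Z * \<rho> ^ card Z"
    by (simp add: F(2) norm_mult prod_norm)
  also have "\<dots> = M / 2 ^ card Z" using \<open>\<rho> > 0\<close> by (simp add: power_mult_distrib)
  finally show ?thesis by (simp add: field_simps)
qed

text \<open>Positive density supplies at least \<open>d * r\<close> zeros below
  \<open>r + 1\<close>, distinct because they lie in disjoint open intervals. By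
  \<open>entire_zeros_bound\<close>, centred at \<open>x\<close>, so many zeros force growth of
  order \<open>2 powr (d * r)\<close> unless \<open>Q x = 0\<close>, and minimal type excludes such
  growth.\<close>

lemma entire_minimal_type_few_zeros:
  assumes Q: "Q holomorphic_on UNIV"
    and minimal: "\<And>\<eta>. \<eta> > 0 \<Longrightarrow> \<exists>C. \<forall>z. cmod (Q z) \<le> C * exp (\<eta> * cmod z)"
    and dens: "lower_density (of_nat ` A) > 0"
    and zeros: "\<And>n. n \<in> A \<Longrightarrow> \<exists>t::real. real n < t \<and> t < real (Suc n) \<and> Q t = 0"
  shows "Q x = 0"
proof (rule ccontr)
  assume x: "Q x \<noteq> 0"
  obtain d r0 where d: "d > 0" "r0 > 0" "\<And>r. r \<ge> r0 \<Longrightarrow> d * r \<le> real (card {n \<in> A. real n \<le> r})"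
    using lower_density_posD[OF dens] by blast
  \<comment> \<open>The test circle has radius about \<open>3 * r\<close>, so growth contributes
    about \<open>3 * \<eta> * r\<close>, half of the \<open>d * r * ln 2\<close> that the zeros
    demand.\<close>
  define \<eta> where "\<eta> = d * ln 2 / 6"
  have \<eta>: "\<eta> > 0" using d by (simp add: \<eta>_def)
  obtain C where C: "\<And>z. cmod (Q z) \<le> C * exp (\<eta> * cmod z)" using minimal[OF \<eta>] by blast
  have C0: "C > 0"
  proof (rule ccontr)
    assume "\<not> C > 0"
    then have "C * exp (\<eta> * cmod x) \<le> 0" by (simp add: mult_le_0_iff)
    moreover have "cmod (Q x) > 0" using x by simp
    ultimately show False using C[of x] by linarith
  qed
  obtain t where t: "\<And>n. n \<in> A \<Longrightarrow> real n < t n \<and> t n < real (Suc n) \<and> Q (complex_of_real (t n)) = 0"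
    using zeros by metis
  define b where "b = \<eta> * (3 + 4 * cmod x) + ln C - ln (cmod (Q x))"
  have main: "d * ln 2 / 2 * r \<le> b" if r: "r \<ge> r0" for r
  proof -
    define N where "N = {n \<in> A. real n \<le> r}"
    have finN: "finite N"
      by (rule finite_subset[of _ "{..nat \<lfloor>r\<rfloor>}"]) (auto simp: N_def le_nat_floor)
    define Z where "Z = (\<lambda>n. complex_of_real (t n)) ` N"
    define \<rho> where "\<rho> = r + 1 + cmod x"
    have inj: "inj_on (\<lambda>n. complex_of_real (t n)) N"
    proof (rule inj_onI)
      fix m n assume mn: "m \<in> N" "n \<in> N" "complex_of_real (t m) = complex_of_real (t n)"
      then have "real m < t n" "t n < real (Suc m)" "real n < t n" "t n < real (Suc n)"
        using t[of m] t[of n] by (auto simp: N_def)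
      then show "m = n" by linarith
    qed
    have "cmod (Q x) * 2 ^ card Z \<le> C * exp (\<eta> * (cmod x + 3 * \<rho>))"
    proof (rule entire_zeros_bound[OF Q])
      show "finite Z" using finN by (simp add: Z_def)
      show "\<rho> > 0" using r d by (simp add: \<rho>_def add_pos_nonneg)
      show "Z \<subseteq> cball x \<rho>"
      proof
        fix z assume "z \<in> Z"
        then obtain n where n: "n \<in> N" "z = complex_of_real (t n)" by (auto simp: Z_def)
        then have "\<bar>t n\<bar> \<le> r + 1" using t[of n] by (auto simp: N_def)
        then have "cmod z \<le> r + 1" by (simp add: n)
        then show "z \<in> cball x \<rho>"
          using norm_triangle_ineq4[of x z] by (simp add: \<rho>_def dist_norm)
      qed
      show "Q z = 0" if "z \<in> Z" for z using that t by (auto simp: Z_def N_def)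
      show "cmod (Q z) \<le> C * exp (\<eta> * (cmod x + 3 * \<rho>))" if "z \<in> sphere x (3 * \<rho>)" for z
      proof -
        have "cmod z \<le> cmod x + 3 * \<rho>"
          using norm_triangle_ineq4[of x "x - z"] that by (simp add: dist_norm)
        then have "C * exp (\<eta> * cmod z) \<le> C * exp (\<eta> * (cmod x + 3 * \<rho>))"
          using C0 \<eta> by simp
        with C[of z] show ?thesis by linarith
      qed
    qed
    then have "ln (cmod (Q x) * 2 ^ card Z) \<le> ln (C * exp (\<eta> * (cmod x + 3 * \<rho>)))"
      using x C0 by (subst ln_le_cancel_iff) auto
    then have "ln (cmod (Q x)) + card Z * ln 2 \<le> ln C + \<eta> * (cmod x + 3 * \<rho>)"
      using x C0 by (simp add: ln_mult ln_realpow)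
    moreover have "real (card Z) * ln 2 = real (card N) * ln 2" by (simp add: Z_def card_image inj)
    moreover have "d * r * ln 2 \<le> real (card N) * ln 2"
      unfolding N_def by (intro mult_right_mono d(3) r) auto
    moreover have "\<eta> * (cmod x + 3 * \<rho>) = \<eta> * (3 + 4 * cmod x) + d * ln 2 / 2 * r"
      by (simp add: \<rho>_def \<eta>_def algebra_simps)
    moreover have "d * r * ln 2 = d * ln 2 / 2 * r + d * ln 2 / 2 * r" by simp
    ultimately show ?thesis unfolding b_def by linarith
  qed
  define r where "r = max r0 ((\<bar>b\<bar> + 1) / (d * ln 2 / 2))"
  have c: "d * ln 2 / 2 > 0" using d by simp
  then have "\<bar>b\<bar> + 1 \<le> d * ln 2 / 2 * r"
    using max.cobounded2[of "(\<bar>b\<bar> + 1) / (d * ln 2 / 2)" r0]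
    unfolding r_def by (subst mult.commute) (simp only: pos_divide_le_eq)
  with main[of r] show False by (simp add: r_def)
qed

section \<open>Functions with a singleton diagram\<close>

lemma bounded_functional_circlepath:
  assumes "r > 0"
  shows "bounded_functional (sphere a r) (contour_integral (circlepath a r))"
proof -
  have ci: "f contour_integrable_on circlepath a r" if "continuous_on (sphere a r) f" for f
    using that assms by (intro contour_integrable_continuous_circlepath) (simp add: less_imp_le)
  have "cmod (contour_integral (circlepath a r) f) \<le> (2 * pi * r) * M"
    if "continuous_on (sphere a r) f" "M \<ge> 0" "\<forall>u\<in>sphere a r. cmod (f u) \<le> M" for f M
  proof -
    have "cmod (contour_integral (circlepath a r) f) \<le> M * (2 * pi * r)"
      by (rule has_contour_integral_bound_circlepath[OF has_contour_integral_integral[OF ci[OF that(1)]]])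
         (use that assms in \<open>auto simp: dist_norm norm_minus_commute\<close>)
    then show ?thesis by (simp add: mult.commute)
  qed
  moreover have "2 * pi * r \<ge> 0" using assms by simp
  ultimately show ?thesis
    unfolding bounded_functional_def
    by (intro conjI allI impI contour_integral_add contour_integral_lmul ci) blast+
qed

lemma borel_series_bound:
  assumes m: "\<And>n. cmod (m n) \<le> C * \<tau> ^ n" and \<tau>: "0 < \<tau>" "\<tau> < R" and z: "R \<le> cmod z"
  shows "cmod (m n / z ^ (n + 1)) \<le> C / R * (\<tau> / R) ^ n"
proof -
  have "C \<ge> 0" using m[of 0] by (simp add: order_trans[OF norm_ge_zero])
  have "cmod (m n / z ^ (n + 1)) \<le> C * \<tau> ^ n / R ^ (n + 1)"
    unfolding norm_divide norm_power
    by (intro frac_le m power_mono z zero_less_power mult_nonneg_nonneg) (use \<tau> \<open>C \<ge> 0\<close> in auto)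
  then show ?thesis by (simp add: power_divide mult_ac)
qed

lemma borel_series_summable:
  assumes "\<And>n. cmod (m n) \<le> C * \<tau> ^ n" "0 < \<tau>" "\<tau> < cmod z"
  shows "summable (\<lambda>n. m n / z ^ (n + 1))"
proof -
  have "\<tau> / cmod z < 1" using assms(2,3) by (subst divide_less_eq_1_pos) linarith+
  then have "summable (\<lambda>n. C / cmod z * (\<tau> / cmod z) ^ n)"
    by (intro summable_mult summable_geometric) (use assms(2) in auto)
  then show ?thesis
    by (rule summable_comparison_test'[where N = 0]) (use borel_series_bound[OF assms order_refl] in auto)
qed

text \<open>In the variable \<open>1 / z\<close> the Borel series is a power series, convergent for
  \<open>cmod z > \<tau>\<close>, so the disc of radius \<open>\<tau>\<close> is a carrier. Some
  carrier must exist before anything can be said about \<open>LEAST\<close>.\<close>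

lemma exponential_type_borel_carrier:
  assumes "exponential_type f"
  shows "\<exists>K. borel_carrier f K"
proof -
  obtain C \<tau> where C: "C > 0" "\<tau> > 0" "\<And>n. cmod ((deriv ^^ n) f 0) \<le> C * \<tau> ^ n"
    using exponential_type_deriv_bound[OF assms] by blast
  let ?m = "\<lambda>n. (deriv ^^ n) f 0"
  define h where "h w = (\<Sum>n. ?m n * w ^ n)" for w
  have h: "h holomorphic_on ball 0 (1 / \<tau>)"
  proof (rule power_series_holomorphic)
    fix w :: complex assume w: "w \<in> ball 0 (1 / \<tau>)"
    have "summable (\<lambda>n. ?m n * w ^ n)"
    proof (cases "w = 0")
      case True
      then show ?thesis using summable_finite[of "{0}" "\<lambda>n. ?m n * w ^ n"] by auto
    next
      case False
      then have "\<tau> < cmod (1 / w)" using w C(2) by (simp add: norm_divide field_simps)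
      from summable_mult[OF borel_series_summable[OF C(3,2) this], of "1 / w"] False
      show ?thesis by (simp add: power_divide field_simps)
    qed
    then show "(\<lambda>n. ?m n * (w - 0) ^ n) sums h w" by (simp add: h_def summable_sums)
  qed
  have inv: "1 / z \<in> ball 0 (1 / \<tau>)" if "z \<notin> cball 0 \<tau>" for z :: complex
    using that C(2) by (simp add: norm_divide dist_0_norm frac_less2)
  have "borel_carrier f (cball 0 \<tau>)"
    unfolding borel_carrier_def
  proof (intro conjI exI[of _ "\<lambda>z. h (1 / z) * (1 / z)"])
    have "(\<lambda>z. h (1 / z)) holomorphic_on - cball 0 \<tau>"
    proof (rule holomorphic_on_compose_gen[OF _ h, unfolded o_def])
      show "(\<lambda>z. 1 / z) holomorphic_on - cball 0 \<tau>"
        by (intro holomorphic_intros) (use C(2) in auto)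
      show "(\<lambda>z::complex. 1 / z) ` (- cball 0 \<tau>) \<subseteq> ball 0 (1 / \<tau>)"
      proof (rule image_subsetI)
        fix x :: complex
        assume "x \<in> - cball 0 \<tau>"
        then have "x \<notin> cball 0 \<tau>" by simp
        from inv[OF this] show "1 / x \<in> ball 0 (1 / \<tau>)" .
      qed
    qed
    then show "(\<lambda>z. h (1 / z) * (1 / z)) holomorphic_on - cball 0 \<tau>"
      by (intro holomorphic_intros) (use C(2) in auto)
    show "\<forall>\<^sub>F z in at_infinity. h (1 / z) * (1 / z) = borel_transform f z"
    proof -
      have "\<forall>\<^sub>F z in at_infinity. z \<notin> cball (0::complex) \<tau>"
        by (rule eventually_notin_bounded) simp
      then show ?thesis
      proof eventually_elim
        case (elim z)
        then have z: "z \<noteq> 0" "1 / z \<in> ball 0 (1 / \<tau>)"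
          using C(2) inv[OF elim] by auto
        have s: "summable (\<lambda>n. ?m n / z ^ (n + 1))"
          by (rule borel_series_summable[OF C(3,2)]) (use elim in auto)
        have "summable (\<lambda>n. ?m n * (1 / z) ^ n)"
          using summable_mult[OF s, of z] z by (simp add: field_simps power_divide)
        then have "h (1 / z) * (1 / z) = (\<Sum>n. ?m n * (1 / z) ^ n * (1 / z))"
          unfolding h_def by (rule suminf_mult2)
        also have "\<dots> = borel_transform f z"
          by (simp add: borel_transform_def power_divide mult.commute)
        finally show ?case .
      qed
    qed
  qed auto
  then show ?thesis by blast
qed

text \<open>Integrated termwise over a large circle, the Borel series times \<open>w ^ k\<close>
  keeps only its term \<open>n = k\<close>. The continuation is holomorphic off \<open>a\<close>, so
  the same integral gives the residue at \<open>a\<close>, whatever the nature of that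
  singularity.\<close>

lemma residue_borel_continuation:
  assumes f: "exponential_type f" and g: "g holomorphic_on - {a}"
    and gB: "\<forall>\<^sub>F z in at_infinity. g z = borel_transform f z"
  shows "residue (\<lambda>w. g w * w ^ k) a = (deriv ^^ k) f 0"
proof -
  obtain C \<tau> where C: "C > 0" "\<tau> > 0" "\<And>n. cmod ((deriv ^^ n) f 0) \<le> C * \<tau> ^ n"
    using exponential_type_deriv_bound[OF f] by blast
  obtain b where b: "\<And>z. cmod z \<ge> b \<Longrightarrow> g z = borel_transform f z"
    using gB unfolding eventually_at_infinity by blast
  let ?m = "\<lambda>n. (deriv ^^ n) f 0"
  define R where "R = max b (max (\<tau> + 1) (cmod a + 1))"
  have R: "R \<ge> b" "R > \<tau>" "R > cmod a" "R > 0" using C(2) by (auto simp: R_def)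
  let ?I = "contour_integral (circlepath 0 R)"
  have I: "bounded_functional (sphere 0 R) ?I" by (rule bounded_functional_circlepath) fact
  let ?t = "\<lambda>n w. ?m n * (w ^ k / w ^ (n + 1))"
  have nz: "w \<noteq> 0" if "w \<in> sphere 0 R" for w :: complex using that R by auto
  have ct: "continuous_on (sphere 0 R) (\<lambda>w::complex. w ^ k / w ^ (n + 1))" for n
    by (intro continuous_intros) (use nz in auto)
  have "(\<lambda>n. ?I (?t n)) sums ?I (\<lambda>w. \<Sum>n. ?t n w)"
  proof (rule bounded_functional_sums[OF I])
    show "continuous_on (sphere 0 R) (?t n)" for n by (intro continuous_on_mult continuous_on_const ct)
    show "cmod (?t n w) \<le> R ^ k * (C / R * (\<tau> / R) ^ n)" if "w \<in> sphere 0 R" for n w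
    proof -
      have "cmod (w ^ k) * cmod (?m n / w ^ (n + 1)) \<le> R ^ k * (C / R * (\<tau> / R) ^ n)"
        using that R by (intro mult_mono borel_series_bound C(3,2)) (auto simp: norm_power)
      then show ?thesis by (simp add: norm_mult norm_divide mult_ac)
    qed
    show "summable (\<lambda>n. R ^ k * (C / R * (\<tau> / R) ^ n))"
      using R C by (intro summable_mult summable_geometric) auto
  qed
  moreover have "?I (?t n) = (if n = k then 2 * pi * \<i> * ?m k else 0)" for n
  proof -
    have "((\<lambda>u. u ^ k / (u - 0) ^ (Suc n)) has_contour_integral
        ((2 * pi * \<i>) / (fact n) * (deriv ^^ n) (\<lambda>u. u ^ k) 0)) (circlepath 0 R)"
      by (rule Cauchy_has_contour_integral_higher_derivative_circlepath)
         (use R in \<open>auto intro!: continuous_intros holomorphic_intros\<close>)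
    moreover have "(deriv ^^ n) (\<lambda>u::complex. u ^ k) 0 = fact n * (if n = k then 1 else 0)"
      by (rule powser_sums_higher_deriv) (use sums_single[of k] in \<open>auto simp: if_distrib[of "\<lambda>x. x * _"] cong: if_cong\<close>)
    ultimately have "?I (\<lambda>w. w ^ k / w ^ (n + 1)) = (if n = k then 2 * pi * \<i> else 0)"
      by (simp add: contour_integral_unique)
    then show ?thesis using bounded_functional_cmult[OF I ct, of "?m n" n] by simp
  qed
  ultimately have "(\<lambda>n. if n = k then 2 * pi * \<i> * ?m n else 0) sums ?I (\<lambda>w. \<Sum>n. ?t n w)"
    by (simp cong: if_cong)
  then have "?I (\<lambda>w. \<Sum>n. ?t n w) = 2 * pi * \<i> * ?m k"
    using sums_single[of k "\<lambda>n. 2 * pi * \<i> * ?m n"] sums_unique2 by blast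
  moreover have "?I (\<lambda>w. g w * w ^ k) = ?I (\<lambda>w. \<Sum>n. ?t n w)"
  proof (rule bounded_functional_cong[OF I])
    show "continuous_on (sphere 0 R) (\<lambda>w. g w * w ^ k)"
      by (intro continuous_intros holomorphic_on_imp_continuous_on holomorphic_on_subset[OF g])
         (use R in auto)
    fix w :: complex assume w: "w \<in> sphere 0 R"
    have s: "summable (\<lambda>n. ?m n / w ^ (n + 1))"
      by (rule borel_series_summable[OF C(3,2)]) (use w R in auto)
    have "g w * w ^ k = (\<Sum>n. ?m n / w ^ (n + 1)) * w ^ k"
      using w R by (simp add: b borel_transform_def)
    also have "\<dots> = (\<Sum>n. ?m n / w ^ (n + 1) * w ^ k)" by (rule suminf_mult2[OF s])
    finally show "g w * w ^ k = (\<Sum>n. ?t n w)" by (simp add: mult_ac)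
  qed
  moreover have "?I (\<lambda>w. g w * w ^ k) = 2 * pi * \<i> * (\<Sum>p\<in>{a}. winding_number (circlepath 0 R) p * residue (\<lambda>w. g w * w ^ k) p)"
    by (rule Residue_theorem[of UNIV])
       (use R in \<open>auto intro!: holomorphic_intros holomorphic_on_subset[OF g]\<close>)
  moreover have "winding_number (circlepath 0 R) a = 1"
    using R by (intro winding_number_circlepath) auto
  ultimately show ?thesis by simp
qed

text \<open>Polya's representation: \<open>f z\<close> is the integral of
  \<open>g w * exp (w * z) / (2 * pi * \<i>)\<close> over a circle around \<open>a\<close>, since
  both sides have the same Taylor coefficients. Thus \<open>f\<close> is an exponential transform,
  and each application of the operator multiplies the integrand by \<open>\<phi> w\<close>.\<close>

lemma exponential_type_residue_transform:
  assumes f: "exponential_type f" and g: "g holomorphic_on - {a}"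
    and gB: "\<forall>\<^sub>F z in at_infinity. g z = borel_transform f z"
    and \<phi>: "\<phi> holomorphic_on UNIV"
  shows "(diff_operator \<phi> ^^ n) f 0 = residue (\<lambda>w. g w * \<phi> w ^ n) a"
proof -
  define I where "I h = contour_integral (circlepath a 1) (\<lambda>w. (g w / (2 * pi * \<i>)) * h w)" for h
  have gs: "continuous_on (sphere a 1) g"
    by (rule continuous_on_subset[OF holomorphic_on_imp_continuous_on[OF g]]) auto
  have I: "bounded_functional (sphere a 1) I"
    unfolding I_def
    by (intro bounded_functional_mult bounded_functional_circlepath continuous_intros gs) auto
  have res: "I h = residue (\<lambda>w. g w * h w) a" if "h holomorphic_on UNIV" for h
  proof -
    have "((\<lambda>w. g w * h w) has_contour_integral 2 * pi * \<i> * residue (\<lambda>w. g w * h w) a) (circlepath a 1)"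
      by (rule base_residue[of UNIV])
         (auto intro!: holomorphic_intros holomorphic_on_subset[OF g] holomorphic_on_subset[OF that])
    from has_contour_integral_div[OF this, of "2 * pi * \<i>"] show ?thesis
      by (simp add: I_def contour_integral_unique)
  qed
  have fI: "f = (\<lambda>z. I (\<lambda>w. exp (w * z)))"
  proof
    fix z
    have "(\<lambda>n. (deriv ^^ n) f 0 / fact n * z ^ n) sums I (\<lambda>w. exp (w * (0 + z)))"
      using exp_transform_powser[OF I compact_sphere continuous_on_id, of 0 z]
        res[of "\<lambda>w. w ^ _"] residue_borel_continuation[OF f g gB]
      by (simp add: holomorphic_intros)
    moreover have "(\<lambda>n. (deriv ^^ n) f 0 / fact n * (z - 0) ^ n) sums f z"
      using f by (intro entire_powser) (simp add: exponential_type_def)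
    ultimately show "f z = I (\<lambda>w. exp (w * z))" by (simp add: sums_unique2)
  qed
  have "(diff_operator \<phi> ^^ n) f = (\<lambda>z. I (\<lambda>w. \<phi> w ^ n * exp (w * z)))"
    unfolding fI using diff_operator_funpow_exp_transform[OF I compact_sphere continuous_on_id \<phi>] by simp
  then show ?thesis by (simp add: res holomorphic_intros \<phi>)
qed

text \<open>The residue can be computed on arbitrarily small circles. As \<open>L a = 0\<close>, a
  small one has \<open>cmod (L w) \<le> \<eta>\<close> on it, which bounds the exponential by
  \<open>exp (\<eta> * cmod z)\<close>; the constant in front depends on the circle but not on
  \<open>z\<close>.\<close>

lemma residue_exp_entire_minimal_type:
  assumes r: "r > 0" and g: "g holomorphic_on ball a r - {a}" and L: "L holomorphic_on ball a r" "L a = 0"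
  defines "p \<equiv> \<lambda>z. residue (\<lambda>w. g w * exp (L w * z)) a"
  shows "p holomorphic_on UNIV" "\<And>\<eta>. \<eta> > 0 \<Longrightarrow> \<exists>C\<ge>0. \<forall>z. cmod (p z) \<le> C * exp (\<eta> * cmod z)"
proof -
  define I where "I \<epsilon> h = contour_integral (circlepath a \<epsilon>) (\<lambda>w. (g w / (2 * pi * \<i>)) * h w)" for \<epsilon> h
  have I: "bounded_functional (sphere a \<epsilon>) (I \<epsilon>)" and Ls: "continuous_on (sphere a \<epsilon>) L"
    and pI: "p = (\<lambda>z. I \<epsilon> (\<lambda>w. exp (L w * z)))" if \<epsilon>: "0 < \<epsilon>" "\<epsilon> < r" for \<epsilon>
  proof -
    have gs: "continuous_on (sphere a \<epsilon>) g"
      by (rule continuous_on_subset[OF holomorphic_on_imp_continuous_on[OF g]]) (use \<epsilon> in auto)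
    show "continuous_on (sphere a \<epsilon>) L"
      by (rule continuous_on_subset[OF holomorphic_on_imp_continuous_on[OF L(1)]]) (use \<epsilon> in auto)
    show "bounded_functional (sphere a \<epsilon>) (I \<epsilon>)"
      unfolding I_def
      by (intro bounded_functional_mult bounded_functional_circlepath continuous_intros gs \<epsilon>) auto
    show "p = (\<lambda>z. I \<epsilon> (\<lambda>w. exp (L w * z)))"
    proof
      fix z
      have "((\<lambda>w. g w * exp (L w * z)) has_contour_integral 2 * pi * \<i> * p z) (circlepath a \<epsilon>)"
        unfolding p_def
        by (rule base_residue[of "ball a r"])
           (use \<epsilon> r in \<open>auto intro!: holomorphic_intros g holomorphic_on_subset[OF L(1)]\<close>)
      from has_contour_integral_div[OF this, of "2 * pi * \<i>"] show "p z = I \<epsilon> (\<lambda>w. exp (L w * z))"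
        by (simp add: I_def contour_integral_unique)
    qed
  qed
  show "p holomorphic_on UNIV"
    using exp_transform_entire[OF I compact_sphere Ls, of "r / 2"] pI[of "r / 2"] r by simp
  fix \<eta> :: real assume \<eta>: "\<eta> > 0"
  have "isCont L a"
    using holomorphic_on_imp_continuous_on[OF L(1)] r by (simp add: continuous_on_eq_continuous_at)
  then obtain \<delta> where \<delta>: "\<delta> > 0" "\<And>w. dist w a < \<delta> \<Longrightarrow> dist (L w) (L a) < \<eta>"
    using \<eta> unfolding continuous_at_eps_delta by blast
  define \<epsilon> where "\<epsilon> = min (\<delta> / 2) (r / 2)"
  have \<epsilon>: "0 < \<epsilon>" "\<epsilon> < r" "\<epsilon> < \<delta>" using r \<delta> by (auto simp: \<epsilon>_def)
  obtain \<Lambda> where \<Lambda>: "\<Lambda> \<ge> 0" "\<And>f M. continuous_on (sphere a \<epsilon>) f \<Longrightarrow> M \<ge> 0 \<Longrightarrow>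
      \<forall>u\<in>sphere a \<epsilon>. cmod (f u) \<le> M \<Longrightarrow> cmod (I \<epsilon> f) \<le> \<Lambda> * M"
    using I[OF \<epsilon>(1,2)] unfolding bounded_functional_def by blast
  have "cmod (p z) \<le> \<Lambda> * exp (\<eta> * cmod z)" for z
    unfolding pI[OF \<epsilon>(1,2)]
  proof (intro \<Lambda> ballI)
    show "continuous_on (sphere a \<epsilon>) (\<lambda>w. exp (L w * z))" by (intro continuous_intros Ls \<epsilon>)
    fix u assume "u \<in> sphere a \<epsilon>"
    then have "cmod (L u) \<le> \<eta>" using \<delta>(2)[of u] \<epsilon> L(2) by (simp add: dist_commute)
    then show "cmod (exp (L u * z)) \<le> exp (\<eta> * cmod z)" by (rule norm_exp_mult_le)
  qed auto
  then show "\<exists>C\<ge>0. \<forall>z. cmod (p z) \<le> C * exp (\<eta> * cmod z)" using \<Lambda>(1) by blast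
qed

text \<open>Visits of an orbit to this set force sign changes of \<open>\<bar>T\<^sup>n\<^sup>+\<^sup>1 f(0)\<bar>\<^sup>2 - \<bar>T\<^sup>n f(0)\<bar>\<^sup>2\<close> as a function of \<open>n\<close>.\<close>

lemma peak_set:
  assumes \<phi>: "exponential_type \<phi>" and nc: "\<not> \<phi> constant_on UNIV"
  defines "T \<equiv> diff_operator \<phi>"
  defines "U \<equiv> {g. g holomorphic_on UNIV \<and> cmod (g 0) < 1 \<and> cmod (T g 0) > 1 \<and> cmod ((T ^^ 2) g 0) < 1}"
  shows "openin entire_space U" "U \<noteq> {}"
proof -
  have hol: "\<phi> holomorphic_on UNIV" using \<phi> by (simp add: exponential_type_def)
  show "openin entire_space U"
    unfolding openin_entire_space
  proof (intro conjI ballI)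
    fix f assume f: "f \<in> U"
    then have fh: "f holomorphic_on UNIV" by (simp add: U_def)
    have cont: "\<exists>K S. K > 0 \<and> S \<ge> 0 \<and> (\<forall>g M. g holomorphic_on UNIV \<longrightarrow>
        (\<forall>w. cmod w \<le> S \<longrightarrow> cmod (f w - g w) \<le> M) \<longrightarrow> cmod ((T ^^ n) f 0 - (T ^^ n) g 0) \<le> K * M)" for n
    proof -
      obtain K S where K: "K > 0" "S \<ge> 0"
        "\<And>f g M z. f holomorphic_on UNIV \<Longrightarrow> g holomorphic_on UNIV \<Longrightarrow>
         (\<And>w. cmod w \<le> 0 + S \<Longrightarrow> cmod (f w - g w) \<le> M) \<Longrightarrow> cmod z \<le> 0 \<Longrightarrow>
         cmod ((T ^^ n) f z - (T ^^ n) g z) \<le> K * M"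
        using diff_operator_funpow_continuous[OF \<phi>, of 0 n] unfolding T_def by metis
      have "cmod ((T ^^ n) f 0 - (T ^^ n) g 0) \<le> K * M"
        if "g holomorphic_on UNIV" "\<forall>w. cmod w \<le> S \<longrightarrow> cmod (f w - g w) \<le> M" for g M
        by (rule K(3)[OF fh that(1)]) (use that in auto)
      with K(1,2) show ?thesis by blast
    qed
    obtain K1 S1 where K1: "K1 > 0" "S1 \<ge> 0" "\<And>g M. g holomorphic_on UNIV \<Longrightarrow>
        (\<forall>w. cmod w \<le> S1 \<longrightarrow> cmod (f w - g w) \<le> M) \<Longrightarrow> cmod ((T ^^ 1) f 0 - (T ^^ 1) g 0) \<le> K1 * M"
      using cont[of 1] by blast
    obtain K2 S2 where K2: "K2 > 0" "S2 \<ge> 0" "\<And>g M. g holomorphic_on UNIV \<Longrightarrow>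
        (\<forall>w. cmod w \<le> S2 \<longrightarrow> cmod (f w - g w) \<le> M) \<Longrightarrow> cmod ((T ^^ 2) f 0 - (T ^^ 2) g 0) \<le> K2 * M"
      using cont[of 2] by blast
    define e0 where "e0 = min (1 - cmod (f 0)) (min (cmod (T f 0) - 1) (1 - cmod ((T ^^ 2) f 0)))"
    have e0: "e0 > 0" "e0 \<le> 1 - cmod (f 0)" "e0 \<le> cmod (T f 0) - 1" "e0 \<le> 1 - cmod ((T ^^ 2) f 0)"
      using f by (auto simp: e0_def U_def)
    define e where "e = e0 / (1 + K1 + K2) / 2"
    have pos: "1 + K1 + K2 > 0" using K1 K2 by simp
    have e: "e > 0" using e0 pos by (simp add: e_def)
    have "e * (1 + K1 + K2) = e0 / 2" using pos by (simp add: e_def field_simps)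
    then have "e * (1 + K1 + K2) < e0" using e0 by simp
    then have "e + K1 * e + K2 * e < e0" by (simp add: algebra_simps)
    moreover have "K1 * e > 0" "K2 * e > 0" using e K1 K2 by simp_all
    ultimately have small: "e < e0" "K1 * e < e0" "K2 * e < e0" using e by linarith+
    show "\<exists>L e. compact L \<and> e > 0 \<and> {g. g holomorphic_on UNIV \<and> (\<forall>z\<in>L. dist (g z) (f z) < e)} \<subseteq> U"
    proof (intro exI[of _ "cball 0 (max S1 S2)"] exI[of _ e] conjI subsetI)
      fix g assume "g \<in> {g. g holomorphic_on UNIV \<and> (\<forall>z\<in>cball 0 (max S1 S2). dist (g z) (f z) < e)}"
      then have g: "g holomorphic_on UNIV" "\<And>z. cmod z \<le> max S1 S2 \<Longrightarrow> cmod (f z - g z) < e"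
        by (auto simp: dist_norm norm_minus_commute)
      have "cmod (f 0 - g 0) < e" using K1 by (intro g) auto
      moreover have "cmod ((T ^^ 1) f 0 - (T ^^ 1) g 0) \<le> K1 * e"
        by (intro K1 g(1) allI impI less_imp_le[OF g(2)]) auto
      moreover have "cmod ((T ^^ 2) f 0 - (T ^^ 2) g 0) \<le> K2 * e"
        by (intro K2 g(1) allI impI less_imp_le[OF g(2)]) auto
      ultimately show "g \<in> U"
        using small e0 norm_triangle_ineq2[of "g 0" "f 0"] norm_triangle_ineq2[of "T f 0" "T g 0"]
          norm_triangle_ineq2[of "(T ^^ 2) g 0" "(T ^^ 2) f 0"] g(1)
        by (auto simp: U_def norm_minus_commute)
    qed (use e in auto)
  qed (auto simp: U_def)
  show "U \<noteq> {}"
  proof -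
    \<comment> \<open>By little Picard at most one value is omitted, so at least two of
      \<open>0\<close>, \<open>1 / 8\<close>, \<open>1 / 16\<close> are attained; any two of these
      are distinct with sum below \<open>1 / 2\<close>.\<close>
    have miss: "a \<in> range \<phi> \<or> b \<in> range \<phi>" if ab: "a \<noteq> b" for a b
    proof (rule ccontr)
      assume "\<not> ?thesis"
      then have "range \<phi> \<inter> {a, b} = {}" by auto
      then obtain c where "\<phi> = (\<lambda>x. c)" using little_Picard[OF hol ab] by blast
      with nc show False by (auto simp: constant_on_def)
    qed
    have "\<exists>x y. x \<in> range \<phi> \<and> y \<in> range \<phi> \<and> x \<noteq> y \<and> cmod (x + y) < 1 / 2"
    proof -
      have "(0::complex) \<in> range \<phi> \<and> 1/8 \<in> range \<phi> \<or> (0::complex) \<in> range \<phi> \<and> 1/16 \<in> range \<phi> \<or>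
          (1/8::complex) \<in> range \<phi> \<and> 1/16 \<in> range \<phi>"
        using miss[of 0 "1/8"] miss[of 0 "1/16"] miss[of "1/8" "1/16"] by auto
      then show ?thesis
      proof (elim disjE conjE)
        assume "(1/8::complex) \<in> range \<phi>" "(1/16::complex) \<in> range \<phi>"
        then show ?thesis by (intro exI[of _ "1/8"] exI[of _ "1/16"]) auto
      qed (rule exI[of _ 0], (rule exI[of _ "1/8"] exI[of _ "1/16"]), simp)+
    qed
    then obtain l m where lm: "\<phi> l \<noteq> \<phi> m" "cmod (\<phi> l + \<phi> m) < 1 / 2" by auto
    \<comment> \<open>The member of \<open>U\<close> is
      \<open>\<alpha> * (exp (l * z) - exp (m * z))\<close>: it vanishes at 0, this
      \<open>\<alpha>\<close> gives its image the value 2 there, and its second image has the value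
      \<open>2 * (\<phi> l + \<phi> m)\<close>, of modulus below 1.\<close>
    define \<alpha> where "\<alpha> = 2 / (\<phi> l - \<phi> m)"
    define I where "I h = \<alpha> * h l - \<alpha> * h m" for h :: "complex \<Rightarrow> complex"
    have I: "bounded_functional {l, m} I"
    proof -
      have "cmod (I f) \<le> 2 * cmod \<alpha> * M" if "cmod (f l) \<le> M" "cmod (f m) \<le> M" for f M
      proof -
        have "cmod (I f) \<le> cmod \<alpha> * cmod (f l) + cmod \<alpha> * cmod (f m)"
          unfolding I_def using norm_triangle_ineq4[of "\<alpha> * f l" "\<alpha> * f m"] by (simp add: norm_mult)
        also have "\<dots> \<le> cmod \<alpha> * M + cmod \<alpha> * M" by (intro add_mono mult_left_mono that) auto
        finally show ?thesis by (simp add: algebra_simps)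
      qed
      then show ?thesis unfolding bounded_functional_def
        by (intro conjI allI impI exI[of _ "2 * cmod \<alpha>"]) (auto simp: I_def algebra_simps)
    qed
    define g where "g z = I (\<lambda>u. exp (u * z))" for z
    have "(T ^^ n) g 0 = I (\<lambda>u. \<phi> u ^ n)" for n
      using diff_operator_funpow_exp_transform[OF I _ continuous_on_id hol, of n]
      by (simp add: T_def g_def[abs_def])
    then have n: "(T ^^ n) g 0 = \<alpha> * (\<phi> l ^ n - \<phi> m ^ n)" for n
      by (simp add: I_def right_diff_distrib)
    have "\<alpha> * (\<phi> l - \<phi> m) = 2" using lm unfolding \<alpha>_def by (metis nonzero_eq_divide_eq right_minus_eq)
    moreover from this have "\<alpha> * (\<phi> l ^ 2 - \<phi> m ^ 2) = 2 * (\<phi> l + \<phi> m)"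
      by (metis (no_types) mult.assoc mult.commute power2_eq_square square_diff_square_factored)
    ultimately have "g 0 = 0" "T g 0 = 2" "(T ^^ 2) g 0 = 2 * (\<phi> l + \<phi> m)"
      using n[of 0] n[of 1] n[of 2] by simp_all
    moreover have "g holomorphic_on UNIV"
      unfolding g_def[abs_def] by (rule exp_transform_entire[OF I]) (auto intro: continuous_on_id)
    moreover have "cmod (2 * (\<phi> l + \<phi> m)) < 1"
      using lm(2) unfolding norm_mult by simp
    ultimately have "g \<in> U" by (simp add: U_def)
    then show ?thesis by blast
  qed
qed


lemma not_freq_hypercyclic_singleton:
  assumes \<phi>: "exponential_type \<phi>" and nc: "\<not> \<phi> constant_on UNIV"
    and f: "f \<in> freq_hypercyclic (diff_operator \<phi>) entire_space" "exponential_type f"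
    and single: "is_singleton (conj_indicator_diagram f)"
  shows False
proof -
  have hol: "\<phi> holomorphic_on UNIV" using \<phi> by (simp add: exponential_type_def)
  obtain a where a: "conj_indicator_diagram f = {a}" using single by (auto simp: is_singleton_def)
  have "borel_carrier f {a}"
    using exponential_type_borel_carrier[OF f(2)] borel_carrier_conj_indicator_diagram(1) a by metis
  then obtain g where g: "g holomorphic_on - {a}" "\<forall>\<^sub>F z in at_infinity. g z = borel_transform f z"
    by (auto simp: borel_carrier_def)
  define T where "T = diff_operator \<phi>"
  have orbit: "(T ^^ n) f 0 = residue (\<lambda>w. g w * \<phi> w ^ n) a" for n
    unfolding T_def by (rule exponential_type_residue_transform[OF f(2) g hol])
  define U where "U = {g. g holomorphic_on UNIV \<and> cmod (g 0) < 1 \<and> cmod (T g 0) > 1 \<and> cmod ((T ^^ 2) g 0) < 1}"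
  define A where "A = {n. (T ^^ n) f \<in> U}"
  have dens: "lower_density (of_nat ` A) > 0"
    using f(1) peak_set[OF \<phi> nc] unfolding freq_hypercyclic_def A_def U_def T_def by blast
  have A: "cmod ((T ^^ n) f 0) < 1" "cmod ((T ^^ Suc n) f 0) > 1" "cmod ((T ^^ Suc (Suc n)) f 0) < 1"
    if "n \<in> A" for n
    using that by (auto simp: A_def U_def numeral_2_eq_2)
  show False
  proof (cases "\<phi> a = 0")
    \<comment> \<open>On a small circle around \<open>a\<close> the symbol has modulus at most
      \<open>1 / 2\<close>, so the orbit at 0 decays geometrically. Every visit to \<open>U\<close>
      is followed by a value of modulus above 1, so there are only finitely many visits.\<close>
    case True
    have "isCont \<phi> a"
      using holomorphic_on_imp_continuous_on[OF hol] by (simp add: continuous_on_eq_continuous_at)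
    then obtain \<delta> where \<delta>: "\<delta> > 0" "\<And>w. dist w a < \<delta> \<Longrightarrow> dist (\<phi> w) (\<phi> a) < 1 / 2"
      unfolding continuous_at_eps_delta by (metis half_gt_zero zero_less_one)
    define \<epsilon> where "\<epsilon> = \<delta> / 2"
    have \<epsilon>: "\<epsilon> > 0" "\<epsilon> < \<delta>" using \<delta> by (auto simp: \<epsilon>_def)
    have "continuous_on (sphere a \<epsilon>) g"
      by (rule continuous_on_subset[OF holomorphic_on_imp_continuous_on[OF g(1)]]) (use \<epsilon> in auto)
    then obtain B where B: "B > 0" "\<And>u. u \<in> sphere a \<epsilon> \<Longrightarrow> cmod (g u) \<le> B"
      using norm_continuous_bound[OF compact_sphere] by blast
    have small: "cmod ((T ^^ n) f 0) \<le> B * \<epsilon> * (1 / 2) ^ n" for n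
    proof -
      have "((\<lambda>w. g w * \<phi> w ^ n) has_contour_integral 2 * pi * \<i> * (T ^^ n) f 0) (circlepath a \<epsilon>)"
        unfolding orbit
        by (rule base_residue[of UNIV])
           (auto intro!: holomorphic_intros holomorphic_on_subset[OF g(1)] holomorphic_on_subset[OF hol] \<epsilon>)
      then have "cmod (2 * pi * \<i> * (T ^^ n) f 0) \<le> B * (1 / 2) ^ n * (2 * pi * \<epsilon>)"
      proof (rule has_contour_integral_bound_circlepath)
        fix x assume x: "cmod (x - a) = \<epsilon>"
        then have "cmod (\<phi> x) \<le> 1 / 2" using \<delta>(2)[of x] \<epsilon> True by (simp add: dist_norm)
        then have "cmod (\<phi> x) ^ n \<le> (1 / 2) ^ n" by (intro power_mono) auto
        moreover have "cmod (g x) \<le> B" using x by (intro B(2)) (simp add: dist_norm norm_minus_commute)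
        ultimately show "cmod (g x * \<phi> x ^ n) \<le> B * (1 / 2) ^ n"
          unfolding norm_mult norm_power using B(1) by (intro mult_mono) auto
      qed (use B \<epsilon> in auto)
      then have "2 * pi * cmod ((T ^^ n) f 0) \<le> 2 * pi * (B * \<epsilon> * (1 / 2) ^ n)"
        by (simp add: norm_mult mult_ac)
      then show ?thesis by (rule mult_left_le_imp_le) simp
    qed
    obtain d r0 where d: "d > 0" "r0 > 0" "\<And>r. r \<ge> r0 \<Longrightarrow> d * r \<le> real (card {n \<in> A. real n \<le> r})"
      using lower_density_posD[OF dens] by blast
    have "(\<lambda>n. B * \<epsilon> * (1 / 2) ^ n) \<longlonglongrightarrow> B * \<epsilon> * 0"
      by (intro tendsto_mult tendsto_const LIMSEQ_realpow_zero) auto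
    then have "\<forall>\<^sub>F n in sequentially. B * \<epsilon> * (1 / 2) ^ n < 1"
      by (rule order_tendstoD) simp
    then obtain n0 where n0: "\<And>n. n \<ge> n0 \<Longrightarrow> B * \<epsilon> * (1 / 2) ^ n < 1"
      unfolding eventually_sequentially by blast
    have sub: "A \<subseteq> {..n0}"
    proof
      fix n assume "n \<in> A"
      then have "1 < B * \<epsilon> * (1 / 2) ^ Suc n" using A(2) small[of "Suc n"] by fastforce
      then show "n \<in> {..n0}" using n0[of "Suc n"] by (cases "n0 \<le> Suc n") auto
    qed
    define r where "r = max r0 ((real n0 + 2) / d)"
    have "d * r \<le> real (card {n \<in> A. real n \<le> r})" by (rule d) (simp add: r_def)
    also have "\<dots> \<le> real (card {..n0})" using sub by (intro of_nat_mono card_mono) auto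
    also have "\<dots> < real n0 + 2" by simp
    also have "\<dots> \<le> d * r"
      using max.cobounded2[of "(real n0 + 2) / d" r0] d(1) unfolding r_def
      by (simp only: pos_divide_le_eq mult.commute)
    finally show False by simp
  next
    case False
    define c where "c = \<phi> a"
    have c: "c \<noteq> 0" using False by (simp add: c_def)
    have "\<forall>\<^sub>F w in nhds a. \<phi> w \<noteq> 0"
    proof -
      have "isCont \<phi> a"
        using holomorphic_on_imp_continuous_on[OF hol] by (simp add: continuous_on_eq_continuous_at)
      then have "(\<phi> \<longlongrightarrow> \<phi> a) (nhds a)" by (simp add: isCont_def tendsto_at_iff_tendsto_nhds)
      then show ?thesis using False by (rule tendsto_imp_eventually_ne)
    qed
    then obtain r where r: "r > 0" "\<And>w. w \<in> ball a r \<Longrightarrow> \<phi> w \<noteq> 0"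
      unfolding eventually_nhds_metric by (auto simp: dist_commute)
    obtain l where l: "l holomorphic_on ball a r" "\<And>w. w \<in> ball a r \<Longrightarrow> exp (l w) = \<phi> w"
      using holomorphic_logarithm_exists[of "ball a r" \<phi> a] holomorphic_on_subset[OF hol subset_UNIV] r
      by (metis centre_in_ball convex_ball open_ball)
    \<comment> \<open>Subtracting \<open>l a\<close> splits off the constant factor \<open>c\<close>
      and leaves an exponent vanishing at \<open>a\<close>, from which minimal type follows.\<close>
    define L where "L w = l w - l a" for w
    have L: "L holomorphic_on ball a r" "L a = 0"
      unfolding L_def by (auto intro!: holomorphic_intros l)
    have \<phi>L: "\<phi> w = c * exp (L w)" if "w \<in> ball a r" for w
      using l(2)[OF that] l(2)[of a] r(1) c by (simp add: L_def exp_diff c_def)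
    have gr: "g holomorphic_on ball a r - {a}" by (rule holomorphic_on_subset[OF g(1)]) auto
    define p where "p z = residue (\<lambda>w. g w * exp (L w * z)) a" for z
    have p: "p holomorphic_on UNIV" "\<And>\<eta>. \<eta> > 0 \<Longrightarrow> \<exists>C\<ge>0. \<forall>z. cmod (p z) \<le> C * exp (\<eta> * cmod z)"
      unfolding p_def using residue_exp_entire_minimal_type[OF r(1) gr L] by blast+
    have orbit_p: "(T ^^ n) f 0 = c ^ n * p (of_nat n)" for n
    proof -
      have "residue (\<lambda>w. g w * \<phi> w ^ n) a = residue (\<lambda>w. c ^ n * (g w * exp (L w * of_nat n))) a"
      proof (rule residue_cong)
        have "\<forall>\<^sub>F w in at a. w \<in> ball a r" using r by (intro eventually_at_in_open') auto
        then show "\<forall>\<^sub>F w in at a. g w * \<phi> w ^ n = c ^ n * (g w * exp (L w * of_nat n))"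
          by eventually_elim (simp add: \<phi>L power_mult_distrib mult.commute[of "L _"] flip: exp_of_nat_mult)
      qed simp
      also have "\<dots> = c ^ n * residue (\<lambda>w. g w * exp (L w * of_nat n)) a"
        by (rule residue_lmul[of "ball a r"]) (use r in \<open>auto intro!: holomorphic_intros gr holomorphic_on_subset[OF L(1)]\<close>)
      finally show ?thesis by (simp add: orbit p_def)
    qed
    \<comment> \<open>The entire function that equals \<open>(cmod (p t))\<^sup>2\<close> at real
      \<open>t\<close>.\<close>
    define q where "q z = p z * cnj (p (cnj z))" for z
    define Q where "Q z = of_real ((cmod c)\<^sup>2) * q (z + 1) - q z" for z
    have qhol: "q holomorphic_on S" for S
    proof -
      have "(cnj \<circ> p \<circ> cnj) holomorphic_on UNIV"
        by (rule holomorphic_on_compose_cnj_cnj) (use p in auto)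
      then have "q holomorphic_on UNIV" unfolding q_def by (intro holomorphic_intros p) (simp add: o_def)
      then show ?thesis by (rule holomorphic_on_subset) simp
    qed
    have Qhol: "Q holomorphic_on UNIV"
    proof -
      have "(q \<circ> (\<lambda>z. z + 1)) holomorphic_on UNIV"
        by (intro holomorphic_on_compose holomorphic_intros qhol)
      then show ?thesis unfolding Q_def by (intro holomorphic_intros qhol) (simp add: o_def)
    qed
    have Qt: "Q (of_real t) = of_real ((cmod c)\<^sup>2 * (cmod (p (of_real (t + 1))))\<^sup>2 - (cmod (p (of_real t)))\<^sup>2)"
      for t :: real
    proof -
      have q: "q (of_real s) = of_real ((cmod (p (of_real s)))\<^sup>2)" for s :: real
        unfolding q_def complex_norm_square complex_cnj_complex_of_real ..
      have "complex_of_real t + 1 = of_real (t + 1)" by simp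
      then show ?thesis unfolding Q_def by (simp only: q of_real_diff of_real_mult)
    qed
    define u where "u t = (cmod c)\<^sup>2 * (cmod (p (of_real (t + 1))))\<^sup>2 - (cmod (p (of_real t)))\<^sup>2" for t :: real
    have u_cont: "continuous_on S u" for S
      unfolding u_def
      by (intro continuous_intros continuous_on_compose2[OF holomorphic_on_imp_continuous_on[OF p(1)]]) auto
    \<comment> \<open>The positive factor turns \<open>u n\<close> into the difference of
      consecutive squared moduli of the orbit, so the signs of \<open>u\<close> at integers can be
      read off from visits to \<open>U\<close>, whatever the size of \<open>c\<close>.\<close>
    have u_nat: "u (real n) * (cmod c ^ n)\<^sup>2 = (cmod ((T ^^ Suc n) f 0))\<^sup>2 - (cmod ((T ^^ n) f 0))\<^sup>2" for n
      unfolding orbit_p u_def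
      by (simp add: norm_mult norm_power power_mult_distrib algebra_simps)
    have zeros: "\<exists>t. real n < t \<and> t < real (Suc n) \<and> Q (of_real t) = 0" if "n \<in> A" for n
    proof -
      have sq: "x\<^sup>2 < y\<^sup>2" if "x < 1" "1 < y" "x \<ge> 0" for x y :: real
        using that by (intro power_strict_mono) auto
      have "u (real n) * (cmod c ^ n)\<^sup>2 > 0"
        unfolding u_nat using sq[OF A(1,2)[OF that]] by simp
      then have pos: "u (real n) > 0" by (simp add: zero_less_mult_iff)
      have "u (real (Suc n)) * (cmod c ^ Suc n)\<^sup>2 < 0"
        unfolding u_nat using sq[OF A(3,2)[OF that]] by simp
      then have neg: "u (real (Suc n)) < 0" by (simp add: mult_less_0_iff)
      have "\<exists>t\<ge>real n. t \<le> real (Suc n) \<and> u t = 0"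
        using pos neg by (intro IVT2' u_cont) auto
      then obtain t where t: "real n \<le> t" "t \<le> real (Suc n)" "u t = 0" by blast
      \<comment> \<open>The zero must be interior, so that different visits yield different
        zeros.\<close>
      moreover have "t \<noteq> real n" "t \<noteq> real (Suc n)" using t(3) pos neg by auto
      ultimately show ?thesis using Qt[of t] by (intro exI[of _ t]) (auto simp: u_def)
    qed
    have "Q x = 0" for x
    proof (rule entire_minimal_type_few_zeros[OF Qhol _ dens zeros])
      fix \<eta> :: real assume \<eta>: "\<eta> > 0"
      obtain C where C: "C \<ge> 0" "\<And>z. cmod (p z) \<le> C * exp (\<eta> / 2 * cmod z)"
        using p(2)[of "\<eta> / 2"] \<eta> by auto
      have q: "cmod (q z) \<le> C\<^sup>2 * exp (\<eta> * cmod z)" for z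
      proof -
        have "cmod (q z) \<le> (C * exp (\<eta> / 2 * cmod z)) * (C * exp (\<eta> / 2 * cmod (cnj z)))"
          unfolding q_def norm_mult complex_mod_cnj by (intro mult_mono C C(2)[of "cnj z", unfolded complex_mod_cnj]) (use C(1) in auto)
        also have "\<dots> = C\<^sup>2 * exp (\<eta> * cmod z)"
          by (simp add: power2_eq_square mult_ac flip: exp_add)
        finally show ?thesis .
      qed
      have "cmod (Q z) \<le> ((cmod c)\<^sup>2 * C\<^sup>2 * exp \<eta> + C\<^sup>2) * exp (\<eta> * cmod z)" for z
      proof -
        have "cmod (q (z + 1)) \<le> C\<^sup>2 * exp (\<eta> * cmod (z + 1))" by (rule q)
        also have "\<dots> \<le> C\<^sup>2 * exp (\<eta> * (cmod z + 1))"
          using norm_triangle_ineq[of z 1] \<eta> by (intro mult_left_mono) auto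
        finally have "cmod (q (z + 1)) \<le> C\<^sup>2 * exp \<eta> * exp (\<eta> * cmod z)"
          by (simp add: distrib_left exp_add mult_ac)
        then have "(cmod c)\<^sup>2 * cmod (q (z + 1)) \<le> (cmod c)\<^sup>2 * (C\<^sup>2 * exp \<eta> * exp (\<eta> * cmod z))"
          by (intro mult_left_mono) auto
        moreover have "cmod (Q z) \<le> (cmod c)\<^sup>2 * cmod (q (z + 1)) + cmod (q z)"
          unfolding Q_def using norm_triangle_ineq4[of "of_real ((cmod c)\<^sup>2) * q (z + 1)" "q z"]
          by (simp add: norm_mult norm_power)
        ultimately show ?thesis using q[of z] by (simp add: algebra_simps)
      qed
      then show "\<exists>C. \<forall>z. cmod (Q z) \<le> C * exp (\<eta> * cmod z)" by blast
    qed
    \<comment> \<open>One visit now suffices for the contradiction: \<open>u\<close> is positive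
      there, whereas \<open>Q\<close> vanishes identically.\<close>
    moreover have "A \<noteq> {}"
    proof
      assume "A = {}"
      with dens lower_density_posD[of A] show False
        by (metis (no_types, lifting) empty_iff card.empty Collect_empty_eq linorder_not_le mult_pos_pos
              of_nat_0 order_refl)
    qed
    then obtain n where "n \<in> A" by blast
    then have "u (real n) * (cmod c ^ n)\<^sup>2 > 0"
      unfolding u_nat using A(1,2)[of n] by (simp add: power_strict_mono)
    then have "u (real n) \<noteq> 0" by auto
    ultimately show False using Qt[of "real n"] unfolding u_def by (metis of_real_eq_0_iff)
  qed
qed

section \<open>Arcs on which the symbol is unimodular\<close>

text \<open>A connected set with more than one point accumulates at each of its points; if
  \<open>deriv \<phi>\<close> vanished on it, the identity theorem would make \<open>\<phi>\<close>
  constant.\<close>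

lemma unimodular_continuum_noncritical:
  assumes \<phi>: "\<phi> holomorphic_on UNIV" "\<not> \<phi> constant_on UNIV" and S: "continuum S"
  obtains z where "z \<in> S" "deriv \<phi> z \<noteq> 0"
proof (rule ccontr)
  assume "\<not> thesis"
  then have zero: "\<And>z. z \<in> S \<Longrightarrow> deriv \<phi> z = 0" using that by blast
  obtain x y where xy: "x \<in> S" "y \<in> S" "x \<noteq> y" using S by (auto simp: continuum_def)
  have lim: "x islimpt S"
    by (rule connected_imp_perfect) (use S xy in \<open>auto simp: continuum_def\<close>)
  have "deriv \<phi> w = 0" for w
    by (rule analytic_continuation[OF holomorphic_deriv[OF \<phi>(1) open_UNIV] _ _ _ _ lim])
       (use zero in auto)
  then have "(\<phi> has_field_derivative 0) (at w)" for w
    using holomorphic_derivI[OF \<phi>(1) open_UNIV, of w] by simp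
  then have "\<exists>c. \<forall>w\<in>UNIV. \<phi> w = c"
    by (intro has_field_derivative_zero_constant) (auto intro: has_field_derivative_at_within)
  with \<phi>(2) show False by (auto simp: constant_on_def)
qed

text \<open>Near \<open>z0\<close> the set \<open>cmod (\<phi> z) = 1\<close> is the image of an
  imaginary segment under \<open>\<psi>\<close>, a local inverse of \<open>\<phi>\<close> composed
  with \<open>exp\<close>. If no subsegment landed in \<open>S\<close>, this curve could be cut on
  both sides of \<open>z0\<close> at points outside \<open>S\<close>. The piece of \<open>S\<close>
  in between would be open and closed in \<open>S\<close>, contain \<open>z0\<close> and miss
  \<open>y\<close>.\<close>

lemma unimodular_arc:
  assumes \<phi>: "\<phi> holomorphic_on UNIV" "\<not> \<phi> constant_on UNIV"
    and S: "continuum S" "S \<subseteq> {z. cmod (\<phi> z) = 1}"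
  obtains \<psi> N \<alpha> \<beta> where "open N" "\<psi> holomorphic_on N" "\<alpha> < \<beta>" "\<beta> - \<alpha> < 2 * pi"
    "\<And>u. u \<in> N \<Longrightarrow> \<phi> (\<psi> u) = exp u"
    "\<And>t. t \<in> {\<alpha>..\<beta>} \<Longrightarrow> \<i> * complex_of_real t \<in> N \<and> \<psi> (\<i> * complex_of_real t) \<in> S"
proof -
  obtain z0 where z0: "z0 \<in> S" "deriv \<phi> z0 \<noteq> 0"
    using unimodular_continuum_noncritical[OF \<phi> S(1)] by blast
  obtain y where y: "y \<in> S" "y \<noteq> z0" using S(1) z0 by (auto simp: continuum_def)
  obtain r where r: "r > 0" "inj_on \<phi> (ball z0 r)"
    using has_complex_derivative_locally_injective[OF \<phi>(1) _ open_UNIV z0(2)] by blast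
  have hol: "\<phi> holomorphic_on ball z0 r" using \<phi>(1) by (rule holomorphic_on_subset) simp
  obtain g where g: "g holomorphic_on \<phi> ` ball z0 r" "\<And>z. z \<in> ball z0 r \<Longrightarrow> g (\<phi> z) = z"
    using holomorphic_has_inverse[OF hol open_ball r(2)] by metis
  have W: "open (\<phi> ` ball z0 r)" by (rule open_mapping_thm3[OF hol open_ball r(2)])
  obtain \<theta> where \<theta>: "\<phi> z0 = exp (\<i> * complex_of_real \<theta>)"
    using z0(1) S(2) complex_norm_eq_1_exp[of "\<phi> z0"] by (metis (mono_tags, lifting) mem_Collect_eq subsetD)
  define u0 where "u0 = \<i> * complex_of_real \<theta>"
  define \<psi> where "\<psi> = (\<lambda>u. g (exp u))"
  define N0 where "N0 = exp -` (\<phi> ` ball z0 r)"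
  have N0: "open N0" unfolding N0_def by (rule open_vimage[OF W]) (intro continuous_intros)
  have \<psi>: "\<psi> holomorphic_on N0"
    unfolding \<psi>_def
    by (rule holomorphic_on_compose_gen[OF holomorphic_on_exp g(1), unfolded o_def]) (auto simp: N0_def)
  have \<phi>\<psi>: "\<phi> (\<psi> u) = exp u" if "u \<in> N0" for u
    using that g(2) by (auto simp: N0_def \<psi>_def)
  have u0: "u0 \<in> N0" "\<psi> u0 = z0"
    using g(2)[of z0] r(1) \<theta>[symmetric] by (auto simp: N0_def \<psi>_def u0_def)
  have "isCont \<psi> u0"
    using holomorphic_on_imp_continuous_on[OF \<psi>] N0 u0 by (simp add: continuous_on_eq_continuous_at)
  then obtain d1 where d1: "d1 > 0" "\<And>u. dist u u0 < d1 \<Longrightarrow> dist (\<psi> u) (\<psi> u0) < dist y z0"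
    using y(2) unfolding continuous_at_eps_delta by (metis zero_less_dist_iff)
  obtain d2 where d2: "d2 > 0" "ball u0 d2 \<subseteq> N0" using N0 u0 openE by blast
  \<comment> \<open>\<open>d1\<close> keeps \<open>y\<close> out of the image of the ball,
    \<open>d2\<close> keeps the ball inside \<open>N0\<close>, and \<open>pi\<close> makes
    \<open>exp\<close>, hence \<open>\<psi>\<close>, injective on it; it also keeps the final
    interval shorter than a period.\<close>
  define d where "d = min pi (min d1 d2)"
  have d: "d > 0" "d \<le> pi" "ball u0 d \<subseteq> N0" "\<And>u. u \<in> ball u0 d \<Longrightarrow> dist (\<psi> u) z0 < dist y z0"
    using d1 d2 u0 by (auto simp: d_def dist_commute)
  have inj: "inj_on \<psi> (ball u0 d)"
  proof (rule inj_onI)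
    fix u v assume uv: "u \<in> ball u0 d" "v \<in> ball u0 d" "\<psi> u = \<psi> v"
    then have "exp u = exp v" using \<phi>\<psi> d(3) by (metis subsetD)
    moreover have "u \<in> ball u0 pi" "v \<in> ball u0 pi" using uv d(2) by auto
    ultimately show "u = v" using inj_on_exp_pi[of u0] by (auto dest: inj_onD)
  qed
  have in_ball: "\<i> * complex_of_real t \<in> ball u0 d \<longleftrightarrow> \<bar>t - \<theta>\<bar> < d" for t
  proof -
    have "dist u0 (\<i> * complex_of_real t) = cmod (\<i> * complex_of_real (\<theta> - t))"
      unfolding u0_def dist_norm by (simp add: right_diff_distrib)
    also have "\<dots> = \<bar>t - \<theta>\<bar>" by (simp only: norm_mult norm_of_real) simp
    finally show ?thesis by simp
  qed
  have "\<exists>\<alpha> \<beta>. \<alpha> < \<beta> \<and> {\<alpha>..\<beta>} \<subseteq> {\<theta> - d / 2..\<theta> + d / 2} \<and> (\<forall>t\<in>{\<alpha>..\<beta>}. \<psi> (\<i> * complex_of_real t) \<in> S)"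
  proof (rule ccontr)
    assume contra: "\<not> ?thesis"
    have "\<not> (\<forall>t\<in>{\<theta> - d / 2..\<theta> - d / 4}. \<psi> (\<i> * complex_of_real t) \<in> S)"
      using contra d(1) by (auto dest!: spec[of _ "\<theta> - d / 2"] spec[of _ "\<theta> - d / 4"])
    then obtain t1 where t1: "\<theta> - d / 2 \<le> t1" "t1 \<le> \<theta> - d / 4" "\<psi> (\<i> * complex_of_real t1) \<notin> S" by auto
    have "\<not> (\<forall>t\<in>{\<theta> + d / 4..\<theta> + d / 2}. \<psi> (\<i> * complex_of_real t) \<in> S)"
      using contra d(1) by (auto dest!: spec[of _ "\<theta> + d / 4"] spec[of _ "\<theta> + d / 2"])
    then obtain t2 where t2: "\<theta> + d / 4 \<le> t2" "t2 \<le> \<theta> + d / 2" "\<psi> (\<i> * complex_of_real t2) \<notin> S" by auto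
    define D where "D = ball u0 d \<inter> {u. t1 < Im u} \<inter> {u. Im u < t2}"
    have D: "open D" unfolding D_def
      by (intro open_Int open_ball open_halfspace_Im_gt open_halfspace_Im_lt)
    have V: "open (\<psi> ` D)"
      by (rule open_mapping_thm3[OF holomorphic_on_subset[OF \<psi>] D inj_on_subset[OF inj]])
         (use d(3) in \<open>auto simp: D_def\<close>)
    define C where "C = (\<lambda>t. \<psi> (\<i> * complex_of_real t)) ` {t1..t2}"
    have "compact C"
      unfolding C_def
    proof (intro compact_continuous_image continuous_on_compose2[OF holomorphic_on_imp_continuous_on[OF \<psi>]])
      show "(\<lambda>t. \<i> * complex_of_real t) ` {t1..t2} \<subseteq> N0"
        using in_ball t1 t2 d(1,3) by (auto intro!: subsetD[OF d(3)] simp del: mem_ball)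
    qed (intro continuous_intros compact_Icc)+
    then have "closed C" by (rule compact_imp_closed)
    \<comment> \<open>The left side is open in \<open>S\<close> by the open mapping theorem, the
      right side closed by compactness of \<open>C\<close>. They agree because \<open>\<phi>\<close>
      is unimodular on \<open>S\<close>, which makes the parameter \<open>u\<close> purely
      imaginary, and because the two cut points are not in \<open>S\<close>.\<close>
    have eq: "S \<inter> \<psi> ` D = S \<inter> C"
    proof (intro equalityI subsetI IntI)
      fix z assume "z \<in> S \<inter> \<psi> ` D"
      then obtain u where u: "u \<in> D" "z = \<psi> u" "z \<in> S" by auto
      then have "\<phi> z = exp u" using d(3) by (auto simp: D_def intro!: \<phi>\<psi>)
      then have "exp (Re u) = 1" using u(3) S(2) by (metis (mono_tags, lifting) mem_Collect_eq norm_exp_eq_Re subsetD)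
      then have "u = \<i> * complex_of_real (Im u)" by (simp add: complex_eq_iff)
      then show "z \<in> C" unfolding C_def u(2) using u(1)
        by (intro image_eqI[of _ _ "Im u"]) (auto simp: D_def)
    next
      fix z assume "z \<in> S \<inter> C"
      then obtain t where t: "z = \<psi> (\<i> * complex_of_real t)" "t1 \<le> t" "t \<le> t2" "z \<in> S" by (auto simp: C_def)
      then have "t \<noteq> t1" "t \<noteq> t2" using t1 t2 by auto
      then have "\<i> * complex_of_real t \<in> D"
        using in_ball[of t] t t1 t2 d(1) by (auto simp: D_def simp del: mem_ball)
      then show "z \<in> \<psi> ` D" using t by blast
    qed auto
    have "openin (top_of_set S) (S \<inter> \<psi> ` D)" using V by (rule openin_open_Int)
    moreover have "closedin (top_of_set S) (S \<inter> \<psi> ` D)"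
      unfolding eq using \<open>closed C\<close> by (rule closedin_closed_Int)
    moreover have "connected S" using S(1) by (simp add: continuum_def)
    ultimately have "S \<inter> \<psi> ` D = {} \<or> S \<inter> \<psi> ` D = S" unfolding connected_clopen by blast
    moreover have "z0 \<in> S \<inter> \<psi> ` D"
    proof -
      have "u0 \<in> D" using t1 t2 d(1) by (auto simp: D_def u0_def)
      then show ?thesis using u0 z0 by force
    qed
    ultimately have "y \<in> \<psi> ` D" using y by blast
    then obtain u where "u \<in> ball u0 d" "y = \<psi> u" by (auto simp: D_def)
    with d(4) show False by fastforce
  qed
  then obtain \<alpha> \<beta> where ab: "\<alpha> < \<beta>" "{\<alpha>..\<beta>} \<subseteq> {\<theta> - d / 2..\<theta> + d / 2}"
    "\<And>t. t \<in> {\<alpha>..\<beta>} \<Longrightarrow> \<psi> (\<i> * complex_of_real t) \<in> S" by blast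
  have bounds: "\<alpha> \<ge> \<theta> - d / 2" "\<beta> \<le> \<theta> + d / 2" using ab(1,2) by auto
  show ?thesis
  proof (rule that[OF N0 \<psi> ab(1) _ \<phi>\<psi>])
    show "\<beta> - \<alpha> < 2 * pi" using bounds d(2) pi_gt_zero by linarith
    show "\<i> * complex_of_real t \<in> N0 \<and> \<psi> (\<i> * complex_of_real t) \<in> S" if "t \<in> {\<alpha>..\<beta>}" for t
      using in_ball[of t] that bounds d(1) ab(3)[OF that] by (auto intro!: subsetD[OF d(3)] simp del: mem_ball)
  qed
qed

section \<open>Functionals with quadratically decaying translates\<close>

lemma exp_second_order_bound: "cmod (exp c - 1 - c) \<le> exp (cmod c) * (cmod c)\<^sup>2"
proof -
  have "cmod (exp c - (\<Sum>i\<le>1. c ^ i / fact i)) \<le> exp \<bar>Re c\<bar> * cmod c ^ Suc 1 / fact 1"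
    by (rule Taylor_exp)
  then have "cmod (exp c - 1 - c) \<le> exp \<bar>Re c\<bar> * (cmod c)\<^sup>2"
    by (simp add: power2_eq_square diff_diff_eq)
  also have "\<dots> \<le> exp (cmod c) * (cmod c)\<^sup>2"
    by (intro mult_right_mono) (auto simp: abs_Re_le_cmod)
  finally show ?thesis .
qed

definition imag_seg :: "real \<Rightarrow> real \<Rightarrow> complex set" where
  "imag_seg a b = (\<lambda>t. \<i> * complex_of_real t) ` {a..b}"

lemma compact_imag_seg: "compact (imag_seg a b)"
  unfolding imag_seg_def by (intro compact_continuous_image continuous_intros compact_Icc)

lemma imag_seg_mono: "a \<le> a' \<Longrightarrow> b' \<le> b \<Longrightarrow> imag_seg a' b' \<subseteq> imag_seg a b"
  unfolding imag_seg_def by (intro image_mono) auto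

lemma closed_segment_imag:
  assumes "a \<le> b"
  shows "closed_segment (\<i> * complex_of_real a) (\<i> * complex_of_real b) = imag_seg a b"
proof -
  have "closed_segment (\<i> * complex_of_real a) (\<i> * complex_of_real b) =
      (\<lambda>t. \<i> * t) ` closed_segment (complex_of_real a) (complex_of_real b)"
    by (rule closed_segment_linear_image) (intro bounded_linear.linear bounded_linear_mult_right)
  also have "closed_segment (complex_of_real a) (complex_of_real b) = complex_of_real ` closed_segment a b"
    by (rule closed_segment_of_real)
  finally show ?thesis using assms by (simp add: imag_seg_def image_image closed_segment_eq_real_ivl)
qed

text \<open>Under \<open>u = \<i> t\<close> the factor \<open>exp (n u)\<close> is the \<open>n\<close>-th power of the eigenvalue along the arc, so \<open>n\<close> counts
  applications of the operator, negative \<open>n\<close> giving preimages.\<close>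

definition seg_functional :: "real \<Rightarrow> real \<Rightarrow> int \<Rightarrow> (complex \<Rightarrow> complex) \<Rightarrow> complex" where
  "seg_functional a b n h = contour_integral (linepath (\<i> * complex_of_real a) (\<i> * complex_of_real b))
     (\<lambda>u. ((u - \<i> * complex_of_real a) * (u - \<i> * complex_of_real b) * exp (of_int n * u)) * h u)"

text \<open>The linear span of the segment functionals. A member is a whole family in the time
  \<open>n\<close>, so that the shift rule and the decay pass to linear combinations.\<close>

inductive_set wave_functionals :: "real \<Rightarrow> real \<Rightarrow> (int \<Rightarrow> (complex \<Rightarrow> complex) \<Rightarrow> complex) set"
  for \<alpha> \<beta> where
  seg: "\<alpha> \<le> a \<Longrightarrow> a < b \<Longrightarrow> b \<le> \<beta> \<Longrightarrow> seg_functional a b \<in> wave_functionals \<alpha> \<beta>"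
| add: "Y \<in> wave_functionals \<alpha> \<beta> \<Longrightarrow> Z \<in> wave_functionals \<alpha> \<beta> \<Longrightarrow>
    (\<lambda>n h. Y n h + Z n h) \<in> wave_functionals \<alpha> \<beta>"
| scale: "Y \<in> wave_functionals \<alpha> \<beta> \<Longrightarrow> (\<lambda>n h. c * Y n h) \<in> wave_functionals \<alpha> \<beta>"

section \<open>Closure properties of functionals, and integrals over segments\<close>

lemma bounded_functional_plus:
  assumes "bounded_functional P I" "bounded_functional P J"
  shows "bounded_functional P (\<lambda>h. I h + J h)"
proof -
  obtain \<Lambda> where \<Lambda>: "\<Lambda> \<ge> 0" "\<And>f M. continuous_on P f \<Longrightarrow> M \<ge> 0 \<Longrightarrow>
      \<forall>u\<in>P. cmod (f u) \<le> M \<Longrightarrow> cmod (I f) \<le> \<Lambda> * M"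
    using assms(1) unfolding bounded_functional_def by blast
  obtain \<Lambda>' where \<Lambda>': "\<Lambda>' \<ge> 0" "\<And>f M. continuous_on P f \<Longrightarrow> M \<ge> 0 \<Longrightarrow>
      \<forall>u\<in>P. cmod (f u) \<le> M \<Longrightarrow> cmod (J f) \<le> \<Lambda>' * M"
    using assms(2) unfolding bounded_functional_def by blast
  have "cmod (I f + J f) \<le> (\<Lambda> + \<Lambda>') * M"
    if "continuous_on P f" "M \<ge> 0" "\<forall>u\<in>P. cmod (f u) \<le> M" for f M
    using norm_triangle_ineq[of "I f" "J f"] \<Lambda>(2)[OF that] \<Lambda>'(2)[OF that] by (simp add: distrib_right)
  moreover have "\<Lambda> + \<Lambda>' \<ge> 0" using \<Lambda>(1) \<Lambda>'(1) by simp
  ultimately show ?thesis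
    using assms unfolding bounded_functional_def
    by (intro conjI allI impI exI[of _ "\<Lambda> + \<Lambda>'"]) (auto simp: algebra_simps)
qed

lemma bounded_functional_scale:
  assumes "bounded_functional P I"
  shows "bounded_functional P (\<lambda>h. c * I h)"
proof -
  obtain \<Lambda> where \<Lambda>: "\<Lambda> \<ge> 0" "\<And>f M. continuous_on P f \<Longrightarrow> M \<ge> 0 \<Longrightarrow>
      \<forall>u\<in>P. cmod (f u) \<le> M \<Longrightarrow> cmod (I f) \<le> \<Lambda> * M"
    using assms(1) unfolding bounded_functional_def by blast
  have "cmod (c * I f) \<le> (cmod c * \<Lambda>) * M"
    if "continuous_on P f" "M \<ge> 0" "\<forall>u\<in>P. cmod (f u) \<le> M" for f M
    using mult_left_mono[OF \<Lambda>(2)[OF that], of "cmod c"] by (simp add: norm_mult mult.assoc)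
  moreover have "cmod c * \<Lambda> \<ge> 0" using \<Lambda>(1) by simp
  ultimately show ?thesis
    using assms unfolding bounded_functional_def
    by (intro conjI allI impI exI[of _ "cmod c * \<Lambda>"]) (auto simp: algebra_simps)
qed

lemma bounded_functional_zero_functional: "bounded_functional P (\<lambda>h. 0)"
  unfolding bounded_functional_def by (auto intro!: exI[of _ 0])

lemma bounded_functional_sum_functional:
  assumes "\<And>i::nat. bounded_functional P (F i)"
  shows "bounded_functional P (\<lambda>h. \<Sum>i<m. F i h)"
  by (induction m) (use assms in \<open>auto intro: bounded_functional_plus bounded_functional_zero_functional\<close>)

lemma bounded_functional_linepath:
  "bounded_functional (closed_segment p q) (contour_integral (linepath p q))"
proof -
  have ci: "f contour_integrable_on linepath p q" if "continuous_on (closed_segment p q) f" for f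
    using that by (rule contour_integrable_continuous_linepath)
  have "cmod (contour_integral (linepath p q) f) \<le> cmod (q - p) * M"
    if "continuous_on (closed_segment p q) f" "M \<ge> 0" "\<forall>u\<in>closed_segment p q. cmod (f u) \<le> M" for f M
    using contour_integral_bound_linepath[OF ci[OF that(1)] that(2)] that(3) by (simp add: mult.commute)
  then show ?thesis
    unfolding bounded_functional_def
    by (intro conjI allI impI contour_integral_add contour_integral_lmul ci)
       (blast intro: norm_ge_zero)+
qed

lemma bounded_functional_subset:
  assumes I: "bounded_functional P I" and "P \<subseteq> Q"
  shows "bounded_functional Q I"
proof -
  have c: "continuous_on P f" if "continuous_on Q f" for f
    using that assms(2) by (rule continuous_on_subset)
  obtain \<Lambda> where \<Lambda>: "\<Lambda> \<ge> 0" "\<And>f M. continuous_on P f \<Longrightarrow> M \<ge> 0 \<Longrightarrow>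
      \<forall>u\<in>P. cmod (f u) \<le> M \<Longrightarrow> cmod (I f) \<le> \<Lambda> * M"
    using I unfolding bounded_functional_def by blast
  have "cmod (I f) \<le> \<Lambda> * M" if "continuous_on Q f" "M \<ge> 0" "\<forall>u\<in>Q. cmod (f u) \<le> M" for f M
    by (rule \<Lambda>(2)) (use that c assms(2) in auto)
  then show ?thesis
    unfolding bounded_functional_def
    using bounded_functional_add[OF I] bounded_functional_cmult[OF I] c \<Lambda>(1) by blast
qed

lemma seg_functional_bounded:
  assumes "a \<le> b"
  shows "bounded_functional (imag_seg a b) (seg_functional a b n)"
  unfolding seg_functional_def closed_segment_imag[OF assms, symmetric]
  by (intro bounded_functional_mult bounded_functional_linepath compact_segment continuous_intros)

lemma wave_functionals_bounded:
  assumes "Y \<in> wave_functionals \<alpha> \<beta>"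
  shows "bounded_functional (imag_seg \<alpha> \<beta>) (Y n)"
  using assms
proof induction
  case (seg a b)
  then show ?case
    by (intro bounded_functional_subset[OF seg_functional_bounded] imag_seg_mono) auto
qed (auto intro: bounded_functional_plus bounded_functional_scale)

lemma wave_functionals_shift:
  assumes "Y \<in> wave_functionals \<alpha> \<beta>"
  shows "Y n (\<lambda>u. exp u ^ k * h u) = Y (n + int k) h"
  using assms
proof induction
  case (seg a b)
  have "exp (of_int n * u) * exp u ^ k = exp (of_int (n + int k) * u)" for u :: complex
    by (simp add: exp_add distrib_right exp_of_nat_mult)
  then have "((u - \<i> * a) * (u - \<i> * b) * exp (of_int n * u)) * (exp u ^ k * h u) =
      ((u - \<i> * a) * (u - \<i> * b) * exp (of_int (n + int k) * u)) * h u" for u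
    by (metis (no_types, lifting) mult.assoc)
  then show ?case by (simp only: seg_functional_def)
qed auto

text \<open>Two integrations by parts. The weight of \<^const>\<open>seg_functional\<close> vanishes at both end points, so
  that no boundary term of order \<open>1 / N\<close> remains.\<close>

lemma contour_integral_exp_decay:
  assumes "open \<Omega>" "closed_segment p q \<subseteq> \<Omega>" "G holomorphic_on \<Omega>" "G p = 0" "G q = 0" "N \<noteq> 0"
  shows "contour_integral (linepath p q) (\<lambda>u. exp (N * u) * G u) =
     (deriv G p * exp (N * p) - deriv G q * exp (N * q)) / N\<^sup>2 +
     contour_integral (linepath p q) (\<lambda>u. exp (N * u) * (deriv ^^ 2) G u) / N\<^sup>2"
proof -
  let ?G' = "deriv G" and ?G'' = "(deriv ^^ 2) G"
  have G': "?G' holomorphic_on \<Omega>" using assms by (intro holomorphic_deriv)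
  have G'': "?G'' holomorphic_on \<Omega>" using assms by (intro holomorphic_higher_deriv)
  have d: "(G has_field_derivative ?G' u) (at u)" "(?G' has_field_derivative ?G'' u) (at u)" if "u \<in> \<Omega>" for u
    using that assms G' by (auto intro: holomorphic_derivI simp: numeral_2_eq_2)
  \<comment> \<open>Both integrations by parts in a single primitive: on differentiation the terms
    in \<open>deriv G / N\<close> cancel.\<close>
  let ?\<Phi> = "\<lambda>u. (G u / N - ?G' u / N\<^sup>2) * exp (N * u)"
  let ?f = "\<lambda>u. exp (N * u) * G u - exp (N * u) * ?G'' u / N\<^sup>2"
  have "(?f has_contour_integral (?\<Phi> (pathfinish (linepath p q)) - ?\<Phi> (pathstart (linepath p q)))) (linepath p q)"
  proof (rule contour_integral_primitive[where S = \<Omega>])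
    fix u assume u: "u \<in> \<Omega>"
    have e: "((\<lambda>x. exp (N * x)) has_field_derivative N * exp (N * u)) (at u)"
      by (auto intro!: derivative_eq_intros)
    have a: "((\<lambda>u. G u / N - ?G' u / N\<^sup>2) has_field_derivative ?G' u / N - ?G'' u / N\<^sup>2) (at u)"
      by (intro DERIV_diff DERIV_cdivide d[OF u])
    have "(?G' u / N - ?G'' u / N\<^sup>2) * exp (N * u) + N * exp (N * u) * (G u / N - ?G' u / N\<^sup>2) = ?f u"
      using \<open>N \<noteq> 0\<close> by (simp add: field_simps power2_eq_square)
    with DERIV_mult[OF a e] have "(?\<Phi> has_field_derivative ?f u) (at u)" by simp
    then show "(?\<Phi> has_field_derivative ?f u) (at u within \<Omega>)" by (rule has_field_derivative_at_within)
  qed (use assms in auto)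
  then have "contour_integral (linepath p q) ?f = ?\<Phi> q - ?\<Phi> p" by (simp add: contour_integral_unique)
  moreover have i1: "(\<lambda>u. exp (N * u) * G u) contour_integrable_on linepath p q"
    and i2: "(\<lambda>u. exp (N * u) * ?G'' u) contour_integrable_on linepath p q"
    by (intro contour_integrable_continuous_linepath continuous_intros
          continuous_on_subset[OF holomorphic_on_imp_continuous_on assms(2)] assms(3) G'')+
  ultimately have "contour_integral (linepath p q) (\<lambda>u. exp (N * u) * G u)
     - contour_integral (linepath p q) (\<lambda>u. exp (N * u) * ?G'' u) / N\<^sup>2 = ?\<Phi> q - ?\<Phi> p"
    by (simp add: contour_integral_diff contour_integrable_div contour_integral_div)
  then show ?thesis using assms(4,5) by (simp add: field_simps diff_divide_distrib)
qed

text \<open>On the imaginary segment \<open>exp (n * u)\<close> has modulus 1, so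
  \<open>contour_integral_exp_decay\<close> leaves only the first two derivatives of weight times
  \<open>h\<close>. Cauchy's inequality on circles of radius \<open>r / 2\<close> bounds these by
  the supremum of \<open>h\<close> near the segment, with a constant depending on the segment
  alone.\<close>

lemma seg_functional_decay:
  assumes ab: "a < b" and r: "0 < r" "r \<le> 1" and n: "n \<noteq> 0"
    and h: "\<And>u. u \<in> imag_seg a b \<Longrightarrow> h holomorphic_on ball u r"
    and B: "\<And>u v. u \<in> imag_seg a b \<Longrightarrow> v \<in> ball u r \<Longrightarrow> cmod (h v) \<le> B"
  shows "cmod (seg_functional a b n h) \<le> (b - a + 1)\<^sup>2 * (4 + 8 * (b - a)) * B / (r\<^sup>2 * (of_int n)\<^sup>2)"
proof -
  let ?J = "imag_seg a b"
  define p where "p = \<i> * complex_of_real a"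
  define q where "q = \<i> * complex_of_real b"
  define \<Omega> where "\<Omega> = (\<Union>u\<in>?J. ball u r)"
  define G where "G v = (v - p) * (v - q) * h v" for v
  have J: "closed_segment p q = ?J" using ab by (simp add: p_def q_def closed_segment_imag)
  have pq: "p \<in> ?J" "q \<in> ?J" by (metis J ends_in_segment)+
  have len: "cmod (u - v) \<le> b - a" if uv: "u \<in> ?J" "v \<in> ?J" for u v
  proof -
    obtain s t where st: "u = \<i> * complex_of_real s" "v = \<i> * complex_of_real t" "a \<le> s" "s \<le> b" "a \<le> t" "t \<le> b"
      using uv by (auto simp: imag_seg_def)
    have "u - v = \<i> * complex_of_real (s - t)" unfolding st(1,2) by (simp add: right_diff_distrib)
    then have "cmod (u - v) = \<bar>s - t\<bar>" by (simp only: norm_mult norm_of_real norm_ii mult_1_left)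
    then show ?thesis using st by linarith
  qed
  have B0: "B \<ge> 0" using B[OF pq(1), of p] r by (meson centre_in_ball norm_ge_zero order_trans)
  have o: "open \<Omega>" unfolding \<Omega>_def by auto
  have sub: "closed_segment p q \<subseteq> \<Omega>" unfolding J \<Omega>_def using r by auto
  have "h holomorphic_on \<Omega>"
    unfolding \<Omega>_def by (rule holomorphic_on_UN_open) (use h in auto)
  then have G: "G holomorphic_on \<Omega>" unfolding G_def by (intro holomorphic_intros)
  have Gb: "cmod (G v) \<le> (b - a + 1)\<^sup>2 * B" if "u \<in> ?J" "v \<in> ball u r" for u v
  proof -
    have vu: "cmod (v - u) \<le> 1" using that r by (simp add: dist_norm norm_minus_commute)
    have "cmod (v - w) \<le> b - a + 1" if "w \<in> ?J" for w
      using norm_triangle_ineq[of "v - u" "u - w"] vu len[OF \<open>u \<in> ?J\<close> that] by simp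
    then have "cmod (v - p) * cmod (v - q) * cmod (h v) \<le> (b - a + 1) * (b - a + 1) * B"
      using pq B[OF that] B0 ab by (intro mult_mono) auto
    then show ?thesis by (simp add: G_def norm_mult power2_eq_square)
  qed
  define W where "W = (b - a + 1)\<^sup>2 * B"
  have W0: "W \<ge> 0" using B0 by (simp add: W_def)
  have dG: "cmod ((deriv ^^ k) G u) \<le> fact k * W / (r / 2) ^ k" if "u \<in> ?J" for u k
  proof (rule Cauchy_inequality)
    have s: "ball u r \<subseteq> \<Omega>" using that by (auto simp: \<Omega>_def)
    show "G holomorphic_on ball u (r / 2)"
      by (rule holomorphic_on_subset[OF G]) (use s r in \<open>auto simp: subset_eq\<close>)
    show "continuous_on (cball u (r / 2)) G"
      by (rule continuous_on_subset[OF holomorphic_on_imp_continuous_on[OF G]])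
         (use s r in \<open>auto simp: subset_eq\<close>)
    show "cmod (G x) \<le> W" if "cmod (u - x) = r / 2" for x
      unfolding W_def by (rule Gb[OF \<open>u \<in> ?J\<close>]) (use that r in \<open>auto simp: dist_norm\<close>)
  qed (use r in auto)
  have e1: "cmod (exp (of_int n * u)) = 1" if "u \<in> ?J" for u
    using that by (auto simp: imag_seg_def)
  let ?N = "of_int n :: complex"
  let ?I = "contour_integral (linepath p q) (\<lambda>u. exp (?N * u) * (deriv ^^ 2) G u)"
  have "cmod ?I \<le> (2 * W / (r / 2)\<^sup>2) * cmod (q - p)"
  proof (rule contour_integral_bound_linepath)
    show "(\<lambda>u. exp (?N * u) * (deriv ^^ 2) G u) contour_integrable_on linepath p q"
      by (intro contour_integrable_continuous_linepath continuous_intros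
          continuous_on_subset[OF holomorphic_on_imp_continuous_on sub] holomorphic_higher_deriv G o)
    show "0 \<le> 2 * W / (r / 2)\<^sup>2" using W0 by simp
    show "cmod (exp (?N * u) * (deriv ^^ 2) G u) \<le> 2 * W / (r / 2)\<^sup>2" if "u \<in> closed_segment p q" for u
      using dG[of u 2] that unfolding norm_mult e1[OF that[unfolded J]] by (simp add: J fact_numeral)
  qed
  also have "\<dots> \<le> (2 * W / (r / 2)\<^sup>2) * (b - a)"
    using len[OF pq(2,1)] W0 by (intro mult_left_mono) auto
  finally have I: "cmod ?I \<le> 8 * W * (b - a) / r\<^sup>2" by (simp add: power_divide)
  have "cmod (deriv G u * exp (?N * u)) \<le> 2 * W / r\<^sup>2" if "u \<in> ?J" for u
  proof -
    have "cmod (deriv G u) \<le> 2 * W / r" using dG[OF that, of 1] by (simp add: mult.commute)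
    \<comment> \<open>\<open>r \<le> 1\<close> gives the boundary terms the same power of
      \<open>r\<close> as the remaining integral.\<close>
    also have "\<dots> \<le> 2 * W / r\<^sup>2"
      using r W0 by (intro divide_left_mono) (auto simp: power2_eq_square mult_left_le)
    finally show ?thesis unfolding norm_mult e1[OF that] by simp
  qed
  from this[OF pq(1)] this[OF pq(2)]
  have E: "cmod (deriv G p * exp (?N * p) - deriv G q * exp (?N * q)) \<le> 4 * W / r\<^sup>2"
    using norm_triangle_ineq4[of "deriv G p * exp (?N * p)" "deriv G q * exp (?N * q)"] by simp
  have "seg_functional a b n h = contour_integral (linepath p q) (\<lambda>u. exp (?N * u) * G u)"
    by (simp add: seg_functional_def p_def q_def G_def mult_ac)
  also have "\<dots> = ((deriv G p * exp (?N * p) - deriv G q * exp (?N * q)) + ?I) / ?N\<^sup>2"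
    unfolding add_divide_distrib by (rule contour_integral_exp_decay[OF o sub G]) (use n in \<open>auto simp: G_def\<close>)
  finally have "cmod (seg_functional a b n h) =
      cmod ((deriv G p * exp (?N * p) - deriv G q * exp (?N * q)) + ?I) / (of_int n)\<^sup>2"
    by (simp add: norm_divide norm_power)
  also have "\<dots> \<le> (4 * W / r\<^sup>2 + 8 * W * (b - a) / r\<^sup>2) / (of_int n)\<^sup>2"
    by (intro divide_right_mono order_trans[OF norm_triangle_ineq] add_mono E I) auto
  also have "\<dots> = (b - a + 1)\<^sup>2 * (4 + 8 * (b - a)) * B / (r\<^sup>2 * (of_int n)\<^sup>2)"
    unfolding add_divide_distrib[symmetric] divide_divide_eq_left
    by (rule arg_cong[where f = "\<lambda>x. x / _"]) (simp add: W_def algebra_simps)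
  finally show ?thesis .
qed

text \<open>One constant for all kernels \<open>h\<close>: those met later are exponentials with
  \<open>z\<close> in growing discs, powers of \<open>\<psi>\<close>, and Cauchy kernels with
  \<open>z\<close> off the arc. The factor \<open>1 / r\<^sup>2\<close> is the price of two
  derivatives.\<close>

definition functional_decay ::
  "complex set \<Rightarrow> (int \<Rightarrow> (complex \<Rightarrow> complex) \<Rightarrow> complex) \<Rightarrow> real \<Rightarrow> bool" where
  "functional_decay P Y C \<longleftrightarrow> (\<forall>r h B n. 0 < r \<longrightarrow> r \<le> 1 \<longrightarrow> n \<noteq> 0 \<longrightarrow>
     (\<forall>u\<in>P. h holomorphic_on ball u r) \<longrightarrow> (\<forall>u\<in>P. \<forall>v\<in>ball u r. cmod (h v) \<le> B) \<longrightarrow>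
     cmod (Y n h) \<le> C * B / (r\<^sup>2 * (of_int n)\<^sup>2))"

lemma functional_decayI:
  assumes "\<And>r h B n. 0 < r \<Longrightarrow> r \<le> 1 \<Longrightarrow> n \<noteq> 0 \<Longrightarrow> (\<And>u. u \<in> P \<Longrightarrow> h holomorphic_on ball u r) \<Longrightarrow>
     (\<And>u v. u \<in> P \<Longrightarrow> v \<in> ball u r \<Longrightarrow> cmod (h v) \<le> B) \<Longrightarrow> cmod (Y n h) \<le> C * B / (r\<^sup>2 * (of_int n)\<^sup>2)"
  shows "functional_decay P Y C"
  unfolding functional_decay_def by (intro allI impI assms) auto

lemma functional_decayD:
  assumes "functional_decay P Y C" "0 < r" "r \<le> 1" "n \<noteq> 0"
    "\<And>u. u \<in> P \<Longrightarrow> h holomorphic_on ball u r"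
    "\<And>u v. u \<in> P \<Longrightarrow> v \<in> ball u r \<Longrightarrow> cmod (h v) \<le> B"
  shows "cmod (Y n h) \<le> C * B / (r\<^sup>2 * (of_int n)\<^sup>2)"
  using assms(1)[unfolded functional_decay_def, rule_format, OF assms(2-6)] by simp

lemma wave_functionals_decay:
  assumes "Y \<in> wave_functionals \<alpha> \<beta>"
  shows "\<exists>C\<ge>0. functional_decay (imag_seg \<alpha> \<beta>) Y C"
  using assms
proof induction
  case (seg a b)
  have sub: "imag_seg a b \<subseteq> imag_seg \<alpha> \<beta>" using seg by (intro imag_seg_mono)
  have "functional_decay (imag_seg \<alpha> \<beta>) (seg_functional a b) ((b - a + 1)\<^sup>2 * (4 + 8 * (b - a)))"
    by (intro functional_decayI seg_functional_decay seg(2)) (use sub in blast)+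
  moreover have "0 \<le> (b - a + 1)\<^sup>2 * (4 + 8 * (b - a))" using seg by simp
  ultimately show ?case by blast
next
  case (add Y Z)
  obtain C D where "C \<ge> 0" "D \<ge> 0" and
    C: "functional_decay (imag_seg \<alpha> \<beta>) Y C" and D: "functional_decay (imag_seg \<alpha> \<beta>) Z D"
    using add.IH by blast
  have "functional_decay (imag_seg \<alpha> \<beta>) (\<lambda>n h. Y n h + Z n h) (C + D)"
  proof (rule functional_decayI)
    fix r h B and n :: int
    assume *: "0 < r" "r \<le> 1" "n \<noteq> 0" "\<And>u. u \<in> imag_seg \<alpha> \<beta> \<Longrightarrow> h holomorphic_on ball u r"
      "\<And>u v. u \<in> imag_seg \<alpha> \<beta> \<Longrightarrow> v \<in> ball u r \<Longrightarrow> cmod (h v) \<le> B"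
    have "cmod (Y n h) \<le> C * B / (r\<^sup>2 * (of_int n)\<^sup>2)" "cmod (Z n h) \<le> D * B / (r\<^sup>2 * (of_int n)\<^sup>2)"
      by (rule functional_decayD[OF C], fact+) (rule functional_decayD[OF D], fact+)
    then show "cmod (Y n h + Z n h) \<le> (C + D) * B / (r\<^sup>2 * (of_int n)\<^sup>2)"
      using norm_triangle_ineq[of "Y n h" "Z n h"]
      by (simp add: distrib_right add_divide_distrib)
  qed
  then show ?case using \<open>C \<ge> 0\<close> \<open>D \<ge> 0\<close> by (intro exI[of _ "C + D"]) simp
next
  case (scale Y c)
  obtain C where "C \<ge> 0" and C: "functional_decay (imag_seg \<alpha> \<beta>) Y C"
    using scale.IH by blast
  have "functional_decay (imag_seg \<alpha> \<beta>) (\<lambda>n h. c * Y n h) (cmod c * C)"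
  proof (rule functional_decayI)
    fix r h B and n :: int
    assume *: "0 < r" "r \<le> 1" "n \<noteq> 0" "\<And>u. u \<in> imag_seg \<alpha> \<beta> \<Longrightarrow> h holomorphic_on ball u r"
      "\<And>u v. u \<in> imag_seg \<alpha> \<beta> \<Longrightarrow> v \<in> ball u r \<Longrightarrow> cmod (h v) \<le> B"
    have "cmod (Y n h) \<le> C * B / (r\<^sup>2 * (of_int n)\<^sup>2)"
      by (rule functional_decayD[OF C]) fact+
    from mult_left_mono[OF this, of "cmod c"]
    show "cmod (c * Y n h) \<le> cmod c * C * B / (r\<^sup>2 * (of_int n)\<^sup>2)"
      by (simp add: norm_mult mult.assoc)
  qed
  then show ?case using \<open>C \<ge> 0\<close> by (intro exI[of _ "cmod c * C"]) simp
qed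

section \<open>Density of the exponential transforms\<close>

text \<open>The locally uniform closure of the transforms at time 0; density is reached through
  closure under sums, multiples and limits.\<close>

definition wave_approximable ::
  "real \<Rightarrow> real \<Rightarrow> (complex \<Rightarrow> complex) \<Rightarrow> (complex \<Rightarrow> complex) \<Rightarrow> bool" where
  "wave_approximable \<alpha> \<beta> \<psi> h \<longleftrightarrow> (\<forall>R. \<forall>\<epsilon>>0. \<exists>Y\<in>wave_functionals \<alpha> \<beta>.
     \<forall>z. cmod z \<le> R \<longrightarrow> cmod (Y 0 (\<lambda>u. exp (\<psi> u * z)) - h z) < \<epsilon>)"

lemma wave_approximable_add:
  assumes "wave_approximable \<alpha> \<beta> \<psi> f" "wave_approximable \<alpha> \<beta> \<psi> g"
  shows "wave_approximable \<alpha> \<beta> \<psi> (\<lambda>z. f z + g z)"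
  unfolding wave_approximable_def
proof (intro allI impI)
  fix R \<epsilon> :: real assume "\<epsilon> > 0"
  then have e: "\<epsilon> / 2 > 0" by simp
  obtain Y where Y: "Y \<in> wave_functionals \<alpha> \<beta>"
    "\<And>z. cmod z \<le> R \<Longrightarrow> cmod (Y 0 (\<lambda>u. exp (\<psi> u * z)) - f z) < \<epsilon> / 2"
    using assms(1) e unfolding wave_approximable_def by metis
  obtain Z where Z: "Z \<in> wave_functionals \<alpha> \<beta>"
    "\<And>z. cmod z \<le> R \<Longrightarrow> cmod (Z 0 (\<lambda>u. exp (\<psi> u * z)) - g z) < \<epsilon> / 2"
    using assms(2) e unfolding wave_approximable_def by metis
  show "\<exists>Y\<in>wave_functionals \<alpha> \<beta>. \<forall>z. cmod z \<le> R \<longrightarrow>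
      cmod (Y 0 (\<lambda>u. exp (\<psi> u * z)) - (f z + g z)) < \<epsilon>"
  proof (intro bexI[of _ "\<lambda>n h. Y n h + Z n h"] allI impI)
    fix z assume "cmod z \<le> R"
    from norm_add_less[OF Y(2)[OF this] Z(2)[OF this]]
    show "cmod (Y 0 (\<lambda>u. exp (\<psi> u * z)) + Z 0 (\<lambda>u. exp (\<psi> u * z)) - (f z + g z)) < \<epsilon>"
      by (simp add: algebra_simps)
  qed (intro wave_functionals.add Y Z)
qed

lemma wave_approximable_scale:
  assumes "wave_approximable \<alpha> \<beta> \<psi> f"
  shows "wave_approximable \<alpha> \<beta> \<psi> (\<lambda>z. c * f z)"
  unfolding wave_approximable_def
proof (intro allI impI)
  fix R \<epsilon> :: real assume "\<epsilon> > 0"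
  then have e: "\<epsilon> / (cmod c + 1) > 0" by (simp add: add_nonneg_pos)
  obtain Y where Y: "Y \<in> wave_functionals \<alpha> \<beta>"
    "\<And>z. cmod z \<le> R \<Longrightarrow> cmod (Y 0 (\<lambda>u. exp (\<psi> u * z)) - f z) < \<epsilon> / (cmod c + 1)"
    using assms(1) e unfolding wave_approximable_def by metis
  show "\<exists>Y\<in>wave_functionals \<alpha> \<beta>. \<forall>z. cmod z \<le> R \<longrightarrow>
      cmod (Y 0 (\<lambda>u. exp (\<psi> u * z)) - c * f z) < \<epsilon>"
  proof (intro bexI[of _ "\<lambda>n h. c * Y n h"] allI impI)
    fix z assume "cmod z \<le> R"
    have "cmod (c * Y 0 (\<lambda>u. exp (\<psi> u * z)) - c * f z) \<le> cmod c * (\<epsilon> / (cmod c + 1))"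
      unfolding right_diff_distrib[symmetric] norm_mult
      by (intro mult_left_mono less_imp_le[OF Y(2)] \<open>cmod z \<le> R\<close>) auto
    also have "\<dots> < (cmod c + 1) * (\<epsilon> / (cmod c + 1))" using e by (intro mult_strict_right_mono) auto
    also have "\<dots> = \<epsilon>" using norm_ge_zero[of c] by (simp add: add_nonneg_eq_0_iff)
    finally show "cmod (c * Y 0 (\<lambda>u. exp (\<psi> u * z)) - c * f z) < \<epsilon>" .
  qed (intro wave_functionals.scale Y)
qed

lemma wave_approximable_limit:
  assumes "\<And>R \<epsilon>. \<epsilon> > 0 \<Longrightarrow> \<exists>g. wave_approximable \<alpha> \<beta> \<psi> g \<and> (\<forall>z. cmod z \<le> R \<longrightarrow> cmod (g z - f z) < \<epsilon>)"
  shows "wave_approximable \<alpha> \<beta> \<psi> f"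
  unfolding wave_approximable_def
proof (intro allI impI)
  fix R \<epsilon> :: real assume "\<epsilon> > 0"
  then have e: "\<epsilon> / 2 > 0" by simp
  obtain g where g: "wave_approximable \<alpha> \<beta> \<psi> g" "\<And>z. cmod z \<le> R \<Longrightarrow> cmod (g z - f z) < \<epsilon> / 2"
    using assms[OF e] by blast
  obtain Y where Y: "Y \<in> wave_functionals \<alpha> \<beta>"
    "\<And>z. cmod z \<le> R \<Longrightarrow> cmod (Y 0 (\<lambda>u. exp (\<psi> u * z)) - g z) < \<epsilon> / 2"
    using g(1) e unfolding wave_approximable_def by metis
  show "\<exists>Y\<in>wave_functionals \<alpha> \<beta>. \<forall>z. cmod z \<le> R \<longrightarrow> cmod (Y 0 (\<lambda>u. exp (\<psi> u * z)) - f z) < \<epsilon>"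
  proof (intro bexI[OF _ Y(1)] allI impI)
    fix z assume "cmod z \<le> R"
    from norm_diff_triangle_less[OF Y(2)[OF this] g(2)[OF this]]
    show "cmod (Y 0 (\<lambda>u. exp (\<psi> u * z)) - f z) < \<epsilon>" by simp
  qed
qed

text \<open>The weight \<open>(u - p) * (u - q)\<close> has integral
  \<open>- ((q - p) ^ 3 / 6)\<close> and modulus at most \<open>(cmod (q - p))\<^sup>2\<close>.
  Normalising it costs the factor 6 whatever the length of the segment, so short segments
  approximate point evaluations.\<close>

lemma seg_functional_average:
  assumes ab: "a < b" and \<delta>: "\<delta> \<ge> 0"
  obtains k where "\<And>h c. (\<And>u. u \<in> imag_seg a b \<Longrightarrow> cmod (h u - c) \<le> \<delta>) \<Longrightarrow> continuous_on (imag_seg a b) h \<Longrightarrow>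
       cmod (k * seg_functional a b 0 h - c) \<le> 6 * \<delta>"
proof -
  define p where "p = \<i> * complex_of_real a"
  define q where "q = \<i> * complex_of_real b"
  have J: "closed_segment p q = imag_seg a b" using ab by (simp add: p_def q_def closed_segment_imag)
  have "q - p \<noteq> 0" using ab by (simp add: p_def q_def)
  let ?w = "\<lambda>u. (u - p) * (u - q)"
  let ?F = "\<lambda>u. (u - p) ^ 3 / 3 - (q - p) * (u - p)\<^sup>2 / 2"
  have "(?w has_contour_integral (?F (pathfinish (linepath p q)) - ?F (pathstart (linepath p q)))) (linepath p q)"
  proof (rule contour_integral_primitive[where S = UNIV])
    fix u :: complex
    have "(?F has_field_derivative (u - p)\<^sup>2 - (q - p) * (u - p)) (at u)"
      by (rule derivative_eq_intros refl | simp)+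
    also have "(u - p)\<^sup>2 - (q - p) * (u - p) = ?w u" by (simp add: power2_eq_square algebra_simps)
    finally show "(?F has_field_derivative ?w u) (at u within UNIV)" by simp
  qed auto
  moreover have "?F q - ?F p = - ((q - p) ^ 3 / 6)" by (simp add: power2_eq_square power3_eq_cube)
  ultimately have w: "contour_integral (linepath p q) ?w = - ((q - p) ^ 3 / 6)"
    by (simp add: contour_integral_unique)
  define k where "k = - (6 / (q - p) ^ 3)"
  have kw: "k * contour_integral (linepath p q) ?w = 1"
    unfolding w k_def using \<open>q - p \<noteq> 0\<close> by simp
  have main: "cmod (k * seg_functional a b 0 h - c) \<le> 6 * \<delta>"
    if close: "\<And>u. u \<in> imag_seg a b \<Longrightarrow> cmod (h u - c) \<le> \<delta>" and h: "continuous_on (imag_seg a b) h" for h c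
  proof -
    have ih: "(\<lambda>u. ?w u * h u) contour_integrable_on linepath p q"
      and iw: "(\<lambda>u. ?w u * c) contour_integrable_on linepath p q"
      and id: "(\<lambda>u. ?w u * (h u - c)) contour_integrable_on linepath p q"
      by (intro contour_integrable_continuous_linepath continuous_intros h[folded J])+
    have "contour_integral (linepath p q) (\<lambda>u. ?w u * (h u - c)) =
        seg_functional a b 0 h - contour_integral (linepath p q) ?w * c"
      using contour_integral_diff[OF ih iw] contour_integral_rmul[of ?w "linepath p q" c]
      by (simp add: seg_functional_def p_def q_def right_diff_distrib
            contour_integrable_continuous_linepath continuous_intros)
    then have "k * contour_integral (linepath p q) (\<lambda>u. ?w u * (h u - c)) =
        k * seg_functional a b 0 h - (k * contour_integral (linepath p q) ?w) * c"
      by (simp only: right_diff_distrib mult.assoc)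
    then have "k * seg_functional a b 0 h - c = k * contour_integral (linepath p q) (\<lambda>u. ?w u * (h u - c))"
      by (simp only: kw mult_1_left)
    also have "cmod \<dots> \<le> cmod k * (cmod (q - p) * cmod (q - p) * \<delta> * cmod (q - p))"
      unfolding norm_mult
    proof (intro mult_left_mono contour_integral_bound_linepath id)
      show "0 \<le> cmod (q - p) * cmod (q - p) * \<delta>" using \<delta> by simp
      fix u assume u: "u \<in> closed_segment p q"
      then have "cmod (u - p) \<le> cmod (q - p)" "cmod (u - q) \<le> cmod (q - p)"
        using segment_bound[OF u] by (auto simp: norm_minus_commute)
      then show "cmod (?w u * (h u - c)) \<le> cmod (q - p) * cmod (q - p) * \<delta>"
        unfolding norm_mult using close[of u] u J by (intro mult_mono) auto
    qed auto
    also have "\<dots> = 6 * \<delta>"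
      using \<open>q - p \<noteq> 0\<close> by (simp add: k_def norm_divide norm_mult power3_eq_cube)
    finally show ?thesis .
  qed
  show ?thesis by (rule that[OF main])
qed

text \<open>Normalised functionals on short segments around \<open>t\<close> approach evaluation at
  \<open>\<i> * t\<close>. Joint uniform continuity makes the error uniform in \<open>z\<close>;
  \<open>\<epsilon> / 7\<close> beats the factor 6 of \<open>seg_functional_average\<close>.\<close>

lemma wave_approximable_exp:
  assumes \<psi>: "continuous_on (imag_seg \<alpha> \<beta>) \<psi>" and t: "\<alpha> < t" "t < \<beta>"
  shows "wave_approximable \<alpha> \<beta> \<psi> (\<lambda>z. exp (\<psi> (\<i> * complex_of_real t) * z))"
  unfolding wave_approximable_def
proof (intro allI impI)
  fix R \<epsilon> :: real assume e: "\<epsilon> > 0"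
  let ?u = "\<i> * complex_of_real t"
  define E where "E x = exp (\<psi> (fst x) * snd x)" for x :: "complex \<times> complex"
  have "continuous_on (imag_seg \<alpha> \<beta> \<times> cball 0 R) E"
    unfolding E_def by (intro continuous_intros continuous_on_compose2[OF \<psi>]) auto
  then have "uniformly_continuous_on (imag_seg \<alpha> \<beta> \<times> cball 0 R) E"
    by (intro compact_uniformly_continuous compact_Times compact_imag_seg compact_cball)
  then obtain d where d: "d > 0" "\<And>x y. x \<in> imag_seg \<alpha> \<beta> \<times> cball 0 R \<Longrightarrow> y \<in> imag_seg \<alpha> \<beta> \<times> cball 0 R \<Longrightarrow>
      dist y x < d \<Longrightarrow> dist (E y) (E x) < \<epsilon> / 7"
    unfolding uniformly_continuous_on_def using e by (metis divide_pos_pos zero_less_numeral)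
  define \<eta> where "\<eta> = Min {d / 2, t - \<alpha>, \<beta> - t}"
  have \<eta>: "\<eta> > 0" "\<eta> < d" "\<eta> \<le> t - \<alpha>" "\<eta> \<le> \<beta> - t" using d t by (auto simp: \<eta>_def)
  have sub: "imag_seg (t - \<eta>) (t + \<eta>) \<subseteq> imag_seg \<alpha> \<beta>" using \<eta> by (intro imag_seg_mono) auto
  have close: "cmod (exp (\<psi> u * z) - exp (\<psi> ?u * z)) \<le> \<epsilon> / 7"
    if "u \<in> imag_seg (t - \<eta>) (t + \<eta>)" "cmod z \<le> R" for u z
  proof -
    obtain s where s: "u = \<i> * complex_of_real s" "t - \<eta> \<le> s" "s \<le> t + \<eta>"
      using \<open>u \<in> imag_seg (t - \<eta>) (t + \<eta>)\<close> by (auto simp: imag_seg_def)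
    have "u - ?u = \<i> * complex_of_real (s - t)" unfolding s by (simp add: right_diff_distrib)
    then have "dist u ?u = \<bar>s - t\<bar>" by (simp only: dist_norm norm_mult norm_of_real norm_ii mult_1_left)
    then have "dist (u, z) (?u, z) < d" using s \<eta> by (simp add: dist_Pair_Pair)
    moreover have "?u \<in> imag_seg \<alpha> \<beta>" using t by (auto simp: imag_seg_def)
    ultimately have "dist (E (u, z)) (E (?u, z)) < \<epsilon> / 7" using sub that by (intro d(2)) auto
    then show ?thesis by (simp add: E_def dist_norm)
  qed
  have c: "continuous_on (imag_seg (t - \<eta>) (t + \<eta>)) (\<lambda>u. exp (\<psi> u * z))" for z
    by (intro continuous_intros continuous_on_subset[OF \<psi> sub])
  have "t - \<eta> < t + \<eta>" using \<eta> by simp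
  then obtain k where k: "\<And>h c. (\<And>u. u \<in> imag_seg (t - \<eta>) (t + \<eta>) \<Longrightarrow> cmod (h u - c) \<le> \<epsilon> / 7) \<Longrightarrow>
      continuous_on (imag_seg (t - \<eta>) (t + \<eta>)) h \<Longrightarrow>
      cmod (k * seg_functional (t - \<eta>) (t + \<eta>) 0 h - c) \<le> 6 * (\<epsilon> / 7)"
    using seg_functional_average[of "t - \<eta>" "t + \<eta>" "\<epsilon> / 7"] e by (metis divide_nonneg_nonneg less_imp_le zero_le_numeral)
  show "\<exists>Y\<in>wave_functionals \<alpha> \<beta>. \<forall>z. cmod z \<le> R \<longrightarrow>
      cmod (Y 0 (\<lambda>u. exp (\<psi> u * z)) - exp (\<psi> ?u * z)) < \<epsilon>"
  proof (intro bexI[of _ "\<lambda>n h. k * seg_functional (t - \<eta>) (t + \<eta>) n h"] allI impI)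
    fix z assume "cmod z \<le> R"
    then have "cmod (k * seg_functional (t - \<eta>) (t + \<eta>) 0 (\<lambda>u. exp (\<psi> u * z)) - exp (\<psi> ?u * z)) \<le> 6 * (\<epsilon> / 7)"
      by (intro k close c)
    also have "\<dots> < \<epsilon>" using e by simp
    finally show "cmod (k * seg_functional (t - \<eta>) (t + \<eta>) 0 (\<lambda>u. exp (\<psi> u * z)) - exp (\<psi> ?u * z)) < \<epsilon>" .
  qed (intro wave_functionals.scale wave_functionals.seg; use \<eta> in simp)
qed

text \<open>Taking out \<open>exp (y * z)\<close> leaves the second-order remainder of
  \<open>exp\<close> at \<open>(x - y) * z\<close>.\<close>

lemma exp_difference_quotient_bound:
  assumes "cmod x \<le> A" "cmod y \<le> A" "cmod z \<le> R" "x \<noteq> y"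
  shows "cmod ((exp (x * z) - exp (y * z)) / (x - y) - z * exp (y * z)) \<le> exp (3 * A * R) * R\<^sup>2 * cmod (x - y)"
proof -
  have A0: "0 \<le> A" and R0: "0 \<le> R" using assms order_trans[OF norm_ge_zero] by blast+
  let ?c = "(x - y) * z"
  have e: "exp (x * z) = exp (y * z) * exp ?c" by (simp add: left_diff_distrib flip: exp_add)
  have "(exp (x * z) - exp (y * z)) / (x - y) - z * exp (y * z) = exp (y * z) * (exp ?c - 1 - ?c) / (x - y)"
    unfolding e using assms(4) by (simp add: field_simps)
  also have "cmod \<dots> \<le> exp (A * R) * (exp (2 * A * R) * (cmod (x - y) * R)\<^sup>2) / cmod (x - y)"
    unfolding norm_mult norm_divide
  proof (intro divide_right_mono mult_mono)
    have "cmod (y * z) \<le> A * R" unfolding norm_mult using assms A0 by (intro mult_mono) auto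
    with complex_Re_le_cmod[of "y * z"] show "cmod (exp (y * z)) \<le> exp (A * R)" by simp
    have c: "cmod ?c \<le> cmod (x - y) * R" unfolding norm_mult using assms by (intro mult_left_mono) auto
    also have "\<dots> \<le> (2 * A) * R"
      using norm_triangle_ineq4[of x y] assms R0 by (intro mult_right_mono) auto
    finally have c': "cmod ?c \<le> 2 * A * R" .
    have "cmod (exp ?c - 1 - ?c) \<le> exp (cmod ?c) * (cmod ?c)\<^sup>2" by (rule exp_second_order_bound)
    also have "\<dots> \<le> exp (2 * A * R) * (cmod (x - y) * R)\<^sup>2"
      using c c' by (intro mult_mono power_mono) auto
    finally show "cmod (exp ?c - 1 - ?c) \<le> exp (2 * A * R) * (cmod (x - y) * R)\<^sup>2" .
  qed auto
  also have "\<dots> = exp (A * R + 2 * A * R) * R\<^sup>2 * cmod (x - y)"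
    unfolding exp_add using assms(4) by (simp add: power2_eq_square)
  finally show ?thesis by (simp add: mult.assoc)
qed

text \<open>A further factor \<open>z\<close> is a derivative with respect to the exponent, hence a
  limit of difference quotients taken at nearby parameters \<open>s\<close> and \<open>t\<close>.
  Injectivity of \<open>\<psi>\<close> keeps the denominators non-zero.\<close>

lemma wave_approximable_power_exp:
  assumes \<psi>: "continuous_on (imag_seg \<alpha> \<beta>) \<psi>" "inj_on \<psi> (imag_seg \<alpha> \<beta>)" and t: "\<alpha> < t" "t < \<beta>"
  shows "wave_approximable \<alpha> \<beta> \<psi> (\<lambda>z. z ^ k * exp (\<psi> (\<i> * complex_of_real t) * z))"
  using t
proof (induction k arbitrary: t)
  case 0
  then show ?case using wave_approximable_exp[OF \<psi>(1)] by simp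
next
  case (Suc k)
  let ?u = "\<lambda>s. \<i> * complex_of_real s"
  have mem: "?u s \<in> imag_seg \<alpha> \<beta>" if "\<alpha> \<le> s" "s \<le> \<beta>" for s using that by (auto simp: imag_seg_def)
  obtain A where A: "A > 0" "\<And>u. u \<in> imag_seg \<alpha> \<beta> \<Longrightarrow> cmod (\<psi> u) \<le> A"
    using norm_continuous_bound[OF compact_imag_seg \<psi>(1)] by blast
  show ?case
  proof (rule wave_approximable_limit)
    fix R' \<epsilon> :: real assume e: "\<epsilon> > 0"
    define R where "R = max 1 R'"
    define K where "K = R ^ k * (exp (3 * A * R) * R\<^sup>2)"
    have R: "R \<ge> 1" "R' \<le> R" by (auto simp: R_def)
    have K: "K > 0" using R by (simp add: K_def)
    have "continuous_on {\<alpha>..\<beta>} (\<lambda>s. \<psi> (?u s))"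
      by (intro continuous_on_compose2[OF \<psi>(1)] continuous_intros) (auto simp: imag_seg_def)
    then obtain d where d: "d > 0" "\<And>s. s \<in> {\<alpha>..\<beta>} \<Longrightarrow> dist s t < d \<Longrightarrow> dist (\<psi> (?u s)) (\<psi> (?u t)) < \<epsilon> / K"
      unfolding continuous_on_iff using Suc.prems e K
      by (metis atLeastAtMost_iff divide_pos_pos less_imp_le)
    define m where "m = min (d / 2) ((\<beta> - t) / 2)"
    have "m > 0" using d(1) Suc.prems by (simp add: m_def)
    moreover have "m \<le> d / 2" "m \<le> (\<beta> - t) / 2"
      unfolding m_def by (rule min.cobounded1, rule min.cobounded2)
    moreover define s where "s = t + m"
    ultimately have s: "t < s" "s < \<beta>" "dist s t < d"
      using d(1) Suc.prems by (simp_all add: dist_real_def)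
    have ne: "\<psi> (?u s) \<noteq> \<psi> (?u t)"
    proof
      assume "\<psi> (?u s) = \<psi> (?u t)"
      moreover have "?u s \<in> imag_seg \<alpha> \<beta>" "?u t \<in> imag_seg \<alpha> \<beta>" using s Suc.prems by (intro mem; simp)+
      ultimately have "?u s = ?u t" by (rule inj_onD[OF \<psi>(2)])
      then show False using s by simp
    qed
    let ?x = "\<psi> (?u s)" and ?y = "\<psi> (?u t)"
    let ?g = "\<lambda>z. 1 / (?x - ?y) * (z ^ k * exp (?x * z)) + (-1 / (?x - ?y)) * (z ^ k * exp (?y * z))"
    have "wave_approximable \<alpha> \<beta> \<psi> ?g"
      using Suc.prems s by (intro wave_approximable_add wave_approximable_scale Suc.IH) auto
    moreover have "cmod (?g z - z ^ Suc k * exp (?y * z)) < \<epsilon>" if z: "cmod z \<le> R'" for z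
    proof -
      have "?g z - z ^ Suc k * exp (?y * z) =
          z ^ k * ((exp (?x * z) - exp (?y * z)) / (?x - ?y) - z * exp (?y * z))"
        by (simp add: algebra_simps diff_divide_distrib)
      also have "cmod \<dots> \<le> R ^ k * (exp (3 * A * R) * R\<^sup>2 * cmod (?x - ?y))"
        unfolding norm_mult norm_power
        using z R s Suc.prems
        by (intro mult_mono power_mono exp_difference_quotient_bound A mem ne) auto
      also have "\<dots> = K * dist ?x ?y" by (simp add: K_def dist_norm)
      also have "\<dots> < K * (\<epsilon> / K)"
        using s Suc.prems K by (intro mult_strict_left_mono d) auto
      also have "\<dots> = \<epsilon>" using K by simp
      finally show ?thesis .
    qed
    ultimately show "\<exists>g. wave_approximable \<alpha> \<beta> \<psi> g \<and>
        (\<forall>z. cmod z \<le> R' \<longrightarrow> cmod (g z - z ^ Suc k * exp (?y * z)) < \<epsilon>)" by blast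
  qed
qed

text \<open>A single parameter suffices: \<open>h\<close> is an entire function times
  \<open>exp (?y * z)\<close>, and Taylor polynomials of the first factor lead back to
  \<open>wave_approximable_power_exp\<close>.\<close>

lemma wave_approximable_entire:
  assumes \<psi>: "continuous_on (imag_seg \<alpha> \<beta>) \<psi>" "inj_on \<psi> (imag_seg \<alpha> \<beta>)" and "\<alpha> < \<beta>"
    and h: "h holomorphic_on UNIV"
  shows "wave_approximable \<alpha> \<beta> \<psi> h"
proof -
  define t where "t = (\<alpha> + \<beta>) / 2"
  have t: "\<alpha> < t" "t < \<beta>" using \<open>\<alpha> < \<beta>\<close> by (auto simp: t_def)
  let ?y = "\<psi> (\<i> * complex_of_real t)"
  define k where "k z = h z * exp (- ?y * z)" for z
  have k: "k holomorphic_on UNIV" unfolding k_def by (intro holomorphic_intros h)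
  let ?c = "\<lambda>n. (deriv ^^ n) k 0 / fact n"
  have poly: "wave_approximable \<alpha> \<beta> \<psi> (\<lambda>z. (\<Sum>n<m. ?c n * z ^ n) * exp (?y * z))" for m
  proof (induction m)
    case 0
    show ?case using wave_approximable_scale[OF wave_approximable_exp[OF \<psi>(1) t], of 0] by simp
  next
    case (Suc m)
    have "wave_approximable \<alpha> \<beta> \<psi> (\<lambda>z. (\<Sum>n<m. ?c n * z ^ n) * exp (?y * z) + ?c m * (z ^ m * exp (?y * z)))"
      by (intro wave_approximable_add Suc wave_approximable_scale wave_approximable_power_exp[OF \<psi> t])
    then show ?case by (simp only: lessThan_Suc sum.insert finite_lessThan lessThan_iff less_irrefl
          not_False_eq_True distrib_right add.commute mult.assoc)
  qed
  show ?thesis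
  proof (rule wave_approximable_limit)
    fix R' \<epsilon> :: real assume e: "\<epsilon> > 0"
    define R where "R = max 0 R'"
    have ul: "uniform_limit (cball 0 R) (\<lambda>m z. \<Sum>n<m. ?c n * z ^ n) k sequentially"
      by (rule entire_taylor_uniform_limit[OF k]) (simp add: R_def)
    define B where "B = exp (cmod ?y * R)"
    have "\<forall>\<^sub>F m in sequentially. \<forall>z\<in>cball 0 R. dist (\<Sum>n<m. ?c n * z ^ n) (k z) < \<epsilon> / B"
      by (rule uniform_limitD[OF ul]) (use e in \<open>simp add: B_def\<close>)
    then obtain m where m: "\<And>z. z \<in> cball 0 R \<Longrightarrow> dist (\<Sum>n<m. ?c n * z ^ n) (k z) < \<epsilon> / B"
      unfolding eventually_sequentially by blast
    show "\<exists>g. wave_approximable \<alpha> \<beta> \<psi> g \<and> (\<forall>z. cmod z \<le> R' \<longrightarrow> cmod (g z - h z) < \<epsilon>)"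
    proof (intro exI conjI allI impI)
      show "wave_approximable \<alpha> \<beta> \<psi> (\<lambda>z. (\<Sum>n<m. ?c n * z ^ n) * exp (?y * z))" by (rule poly)
      fix z assume z: "cmod z \<le> R'"
      have "h z = k z * exp (?y * z)" by (simp add: k_def mult.assoc flip: exp_add)
      then have "cmod ((\<Sum>n<m. ?c n * z ^ n) * exp (?y * z) - h z)
          = cmod ((\<Sum>n<m. ?c n * z ^ n) - k z) * cmod (exp (?y * z))"
        by (simp only: left_diff_distrib[symmetric] norm_mult)
      also have "\<dots> \<le> cmod ((\<Sum>n<m. ?c n * z ^ n) - k z) * B"
      proof (rule mult_left_mono)
        have "cmod (?y * z) \<le> cmod ?y * R" unfolding norm_mult using z by (intro mult_left_mono) (auto simp: R_def)
        with complex_Re_le_cmod[of "?y * z"] show "cmod (exp (?y * z)) \<le> B" by (simp add: B_def)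
      qed auto
      also have "\<dots> < \<epsilon> / B * B"
        using m[of z] z by (intro mult_strict_right_mono) (auto simp: B_def R_def dist_norm)
      also have "\<dots> = \<epsilon>" by (simp add: B_def)
      finally show "cmod ((\<Sum>n<m. ?c n * z ^ n) * exp (?y * z) - h z) < \<epsilon>" .
    qed
  qed
qed

section \<open>Separated sets of positive lower density\<close>

text \<open>\<open>ruler n\<close> is the exponent of \<open>2\<close> in \<open>n + 1\<close>.\<close>

function ruler :: "nat \<Rightarrow> nat" where
  "ruler n = (if even n then 0 else Suc (ruler (n div 2)))"
  by pat_completeness auto
termination
  by (relation "Wellfounded.measure (\<lambda>n. n)") (auto dest: odd_pos)

declare ruler.simps [simp del]

lemma ruler_double: "ruler (2 * n) = 0" "ruler (Suc (2 * n)) = Suc (ruler n)"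
  by (simp_all add: ruler.simps[of "2 * n"] ruler.simps[of "Suc (2 * n)"])

text \<open>The argument is one less than \<open>2 ^ s * (2 * j + 1)\<close>.\<close>

lemma ruler_progression: "ruler (2 ^ Suc s * j + (2 ^ s - 1)) = s"
proof (induction s)
  case 0
  then show ?case by (simp add: ruler_double)
next
  case (Suc s)
  have "2 ^ Suc (Suc s) * j + (2 ^ Suc s - 1) = Suc (2 * (2 ^ Suc s * j + (2 ^ s - 1)))"
  proof -
    obtain p where "(2::nat) ^ s = Suc p" by (metis not0_implies_Suc power_not_zero zero_neq_numeral)
    then show ?thesis by simp
  qed
  then show ?case using Suc ruler_double(2) by metis
qed

text \<open>The sum is the exponent of 2 in the factorial of \<open>m\<close>. Although
  \<open>ruler\<close> is unbounded, its averages are not, so positions reserving room in proportion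
  to \<open>ruler\<close> still grow linearly.\<close>

lemma sum_ruler_le: "(\<Sum>i<m. ruler i) \<le> m"
proof (induction m rule: less_induct)
  case (less m)
  have double: "(\<Sum>i<2 * k. ruler i) = k + (\<Sum>i<k. ruler i)" for k
    by (induction k) (simp_all add: ruler_double)
  show ?case
  proof (cases "even m")
    case True
    then obtain k where k: "m = 2 * k" by auto
    then show ?thesis using less.IH[of k] double[of k] by (cases "k = 0") auto
  next
    case False
    then obtain k where k: "m = Suc (2 * k)" using oddE by fastforce
    then show ?thesis using less.IH[of k] double[of k] by (simp add: ruler_double)
  qed
qed

text \<open>The midpoint of the \<open>i\<close>-th of consecutive blocks of length
  \<open>2 * Suc (ruler i)\<close>; two midpoints are separated by both half-lengths
  together.\<close>

definition ruler_pos :: "nat \<Rightarrow> nat" where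
  "ruler_pos i = (\<Sum>j<i. 2 * Suc (ruler j)) + Suc (ruler i)"

lemma ruler_pos_Suc: "ruler_pos (Suc k) = ruler_pos k + Suc (ruler k) + Suc (ruler (Suc k))"
  by (simp add: ruler_pos_def)

lemma ruler_pos_gap:
  assumes "i < k"
  shows "ruler_pos i + Suc (ruler i) + Suc (ruler k) + (k - Suc i) \<le> ruler_pos k"
  using assms
proof (induction k)
  case (Suc k)
  then show ?case
    by (cases "i = k") (auto simp: ruler_pos_Suc)
qed simp

lemma ruler_pos_dist:
  assumes "i \<noteq> k"
  shows "real (Suc (ruler i)) \<le> \<bar>real (ruler_pos k) - real (ruler_pos i)\<bar>"
    "real (Suc (ruler k)) \<le> \<bar>real (ruler_pos k) - real (ruler_pos i)\<bar>"
    "\<bar>real k - real i\<bar> \<le> \<bar>real (ruler_pos k) - real (ruler_pos i)\<bar>"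
  using ruler_pos_gap[of i k] ruler_pos_gap[of k i] assms by (auto simp: nat_neq_iff)

lemma ruler_pos_ge: "Suc i \<le> ruler_pos i" "Suc (ruler i) \<le> ruler_pos i"
proof -
  have "i \<le> (\<Sum>j<i. 2 * Suc (ruler j))" by (induction i) auto
  then show "Suc i \<le> ruler_pos i" by (simp add: ruler_pos_def)
qed (simp add: ruler_pos_def)

lemma ruler_pos_le: "ruler_pos i \<le> 4 * Suc i"
proof -
  have "ruler_pos i \<le> (\<Sum>j<Suc i. 2 * Suc (ruler j))" by (simp add: ruler_pos_def)
  also have "(\<Sum>j<n. 2 * Suc (ruler j)) = 2 * (\<Sum>j<n. ruler j) + 2 * n" for n
    by (induction n) simp_all
  also have "2 * (\<Sum>j<Suc i. ruler j) + 2 * Suc i \<le> 4 * Suc i" using sum_ruler_le[of "Suc i"] by simp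
  finally show ?thesis .
qed

text \<open>At least \<open>r / a - 1\<close> of the values \<open>g j\<close> are at most
  \<open>r\<close>, and for \<open>r \<ge> 2 * a\<close> this is at least half of
  \<open>r / a\<close>.\<close>

lemma lower_density_pos_if_linear:
  fixes g :: "nat \<Rightarrow> nat"
  assumes g: "inj g" "range g \<subseteq> A" and a: "a > 0" "\<And>j. real (g j) \<le> a * (real j + 1)"
  shows "lower_density (of_nat ` A) > 0"
proof -
  have "1 / (2 * a) \<le> card {n \<in> A. real n \<le> r} / r" if r: "r \<ge> 2 * a" for r
  proof -
    define m where "m = nat \<lfloor>r / a\<rfloor>"
    have "r / a \<ge> 0" using r a by simp
    then have m: "real m \<le> r / a" "r / a < real m + 1"
      by (simp_all add: m_def of_nat_nat)
    have "g ` {..<m} \<subseteq> {n \<in> A. real n \<le> r}"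
    proof
      fix n assume "n \<in> g ` {..<m}"
      then obtain j where j: "j < m" "n = g j" by auto
      have "real n \<le> a * (real j + 1)" using a(2) j by simp
      also have "\<dots> \<le> a * real m" using j a(1) by (intro mult_left_mono) auto
      also have "\<dots> \<le> r" using m(1) a(1) by (simp add: field_simps)
      finally show "n \<in> {n \<in> A. real n \<le> r}" using g(2) j by auto
    qed
    moreover have "finite {n \<in> A. real n \<le> r}"
      by (rule finite_subset[of _ "{..nat \<lfloor>r\<rfloor>}"]) (auto simp: le_nat_floor)
    ultimately have "card (g ` {..<m}) \<le> card {n \<in> A. real n \<le> r}" by (intro card_mono)
    then have "m \<le> card {n \<in> A. real n \<le> r}"
      using g(1) by (simp add: card_image inj_on_subset[OF g(1)])
    then have "r / a - 1 \<le> card {n \<in> A. real n \<le> r}" using m(2) by linarith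
    moreover have "r / (2 * a) \<le> r / a - 1" using r a by (simp add: field_simps)
    ultimately have "r / (2 * a) \<le> card {n \<in> A. real n \<le> r}" by linarith
    then show ?thesis using r a by (simp add: field_simps)
  qed
  then have "ereal (1 / (2 * a)) \<le> lower_density (of_nat ` A)"
    unfolding lower_density_of_nat
    by (intro Liminf_bounded) (auto simp: eventually_at_top_linorder)
  then show ?thesis using a(1) by (metis ereal_less(2) less_le_trans zero_less_divide_1_iff zero_less_mult_iff zero_less_numeral)
qed

lemma ruler_lower_density:
  assumes "\<And>i. ruler i = s \<Longrightarrow> ruler_pos i \<in> A"
  shows "lower_density (of_nat ` A) > 0"
proof (rule lower_density_pos_if_linear)
  let ?i = "\<lambda>j. 2 ^ Suc s * j + (2 ^ s - 1)"
  let ?g = "\<lambda>j. ruler_pos (?i j)"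
  show "inj ?g"
  proof (rule injI)
    fix j k assume "?g j = ?g k"
    then have "?i j = ?i k" using ruler_pos_dist(3)[of "?i j" "?i k"] by (cases "?i j = ?i k") auto
    then have "2 ^ Suc s * j = 2 ^ Suc s * k" by (simp only: add_right_cancel)
    then show "j = k" by simp
  qed
  show "range ?g \<subseteq> A" using assms ruler_progression by blast
  show "real (?g j) \<le> 8 * 2 ^ s * (real j + 1)" for j
  proof -
    have "(2::nat) ^ s \<ge> 1" by simp
    then have "4 * Suc (?i j) \<le> 8 * 2 ^ s * (j + 1)" by (simp add: algebra_simps)
    with ruler_pos_le[of "?i j"] have "?g j \<le> 8 * 2 ^ s * (j + 1)" by (rule le_trans)
    then have "real (?g j) \<le> real (8 * 2 ^ s * (j + 1))" by (rule of_nat_mono)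
    then show ?thesis by (simp add: algebra_simps)
  qed
qed simp

text \<open>Of a decay of order \<open>x\<^sup>-\<^sup>2\<close>, the factor \<open>x\<^sup>1\<^sup>/\<^sup>2\<close> is given up to absorb the constants of the
  individual functionals; what remains is still summable.\<close>

definition decay_rate :: "real \<Rightarrow> real" where
  "decay_rate x = 1 / (x * sqrt x)"

lemma decay_rate_antimono: "0 < x \<Longrightarrow> x \<le> y \<Longrightarrow> decay_rate y \<le> decay_rate x"
  unfolding decay_rate_def by (intro divide_left_mono mult_mono) auto

lemma decay_rate_nonneg: "x \<ge> 0 \<Longrightarrow> decay_rate x \<ge> 0"
  by (simp add: decay_rate_def)

lemma sqrt_over_square: "x > 0 \<Longrightarrow> sqrt x / x\<^sup>2 = decay_rate x"
  unfolding decay_rate_def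
  by (simp add: field_simps power2_eq_square)

lemma summable_decay_rate: "summable (\<lambda>n. decay_rate (real (Suc n)))"
proof -
  have "summable (\<lambda>n. real n powr (- 3 / 2))" by (subst summable_real_powr_iff) simp
  then have "summable (\<lambda>n. real (Suc n) powr (- 3 / 2))" by (subst summable_Suc_iff)
  moreover have "real (Suc n) powr (- 3 / 2) = decay_rate (real (Suc n))" for n
  proof -
    have "real (Suc n) powr (- 3 / 2) = 1 / (real (Suc n) powr (1 + 1 / 2))"
      by (subst powr_minus_divide[symmetric]) simp
    also have "real (Suc n) powr (1 + 1 / 2) = real (Suc n) * sqrt (real (Suc n))"
      by (subst powr_add) (simp add: powr_half_sqrt)
    finally show ?thesis by (simp add: decay_rate_def)
  qed
  ultimately show ?thesis by simp
qed

definition decay_total :: real where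
  "decay_total = (\<Sum>n. decay_rate (real (Suc n)))"

lemma sum_decay_rate_le: "finite F \<Longrightarrow> (\<Sum>n\<in>F. decay_rate (real (Suc n))) \<le> decay_total"
  unfolding decay_total_def
  by (intro sum_le_suminf summable_decay_rate decay_rate_nonneg ballI) auto

text \<open>On either side of \<open>k\<close> the distances are distinct positive integers, so each
  side is dominated by the full series, uniformly in \<open>k\<close> and \<open>m\<close>.\<close>

lemma sum_decay_rate_dist:
  "(\<Sum>i\<in>{..<m} - {k}. decay_rate \<bar>real k - real i\<bar>) \<le> 2 * decay_total"
proof -
  let ?d = "\<lambda>i. decay_rate \<bar>real k - real i\<bar>"
  have "(\<Sum>i\<in>{..<m} \<inter> {..<k}. ?d i) = (\<Sum>n\<in>(\<lambda>i. k - Suc i) ` ({..<m} \<inter> {..<k}). decay_rate (real (Suc n)))"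
    by (subst sum.reindex) (auto simp: inj_on_def intro!: sum.cong arg_cong[where f = decay_rate])
  then have 1: "(\<Sum>i\<in>{..<m} \<inter> {..<k}. ?d i) \<le> decay_total" by (simp add: sum_decay_rate_le del: of_nat_Suc)
  have "(\<Sum>i\<in>{..<m} \<inter> {k<..}. ?d i) = (\<Sum>n\<in>(\<lambda>i. i - Suc k) ` ({..<m} \<inter> {k<..}). decay_rate (real (Suc n)))"
    by (subst sum.reindex) (auto simp: inj_on_def intro!: sum.cong arg_cong[where f = decay_rate])
  then have 2: "(\<Sum>i\<in>{..<m} \<inter> {k<..}. ?d i) \<le> decay_total" by (simp add: sum_decay_rate_le del: of_nat_Suc)
  have eq: "{..<m} - {k} = ({..<m} \<inter> {..<k}) \<union> ({..<m} \<inter> {k<..})" by auto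
  have "(\<Sum>i\<in>{..<m} - {k}. ?d i) = (\<Sum>i\<in>{..<m} \<inter> {..<k}. ?d i) + (\<Sum>i\<in>{..<m} \<inter> {k<..}. ?d i)"
    unfolding eq by (intro sum.union_disjoint) auto
  with 1 2 show ?thesis by linarith
qed

text \<open>Coefficients come from a countable dense set and are given as lists of indices, a type
  that can be enumerated.\<close>

lemma countable_dense_polynomials:
  obtains P :: "nat list \<Rightarrow> complex \<Rightarrow> complex" where "\<And>xs. P xs holomorphic_on UNIV"
    "\<And>h R \<epsilon>. h holomorphic_on UNIV \<Longrightarrow> \<epsilon> > 0 \<Longrightarrow> \<exists>xs. \<forall>z. cmod z \<le> R \<longrightarrow> cmod (P xs z - h z) < \<epsilon>"
proof -
  obtain D :: "complex set" where D: "countable D" "\<And>X. open X \<Longrightarrow> X \<noteq> {} \<Longrightarrow> \<exists>d\<in>D. d \<in> X"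
    using countable_dense_setE by blast
  have "D \<noteq> {}" using D(2)[of UNIV] by auto
  define e where "e = from_nat_into D"
  have e: "\<exists>i. dist c (e i) < \<delta>" if "\<delta> > 0" for c \<delta>
  proof -
    obtain d where "d \<in> D" "d \<in> ball c \<delta>" using D(2)[of "ball c \<delta>"] \<open>\<delta> > 0\<close> by auto
    then show ?thesis using from_nat_into_surj[OF D(1)] by (metis e_def mem_ball)
  qed
  define P where "P xs z = (\<Sum>j<length xs. e (xs ! j) * z ^ j)" for xs z
  show ?thesis
  proof (rule that[of P])
    show "P xs holomorphic_on UNIV" for xs unfolding P_def by (intro holomorphic_intros)
    fix h :: "complex \<Rightarrow> complex" and R' \<epsilon> :: real
    assume h: "h holomorphic_on UNIV" and \<epsilon>: "\<epsilon> > 0"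
    define R where "R = max 1 R'"
    have R: "R \<ge> 1" "R' \<le> R" by (auto simp: R_def)
    let ?c = "\<lambda>n. (deriv ^^ n) h 0 / fact n"
    have ul: "uniform_limit (cball 0 R) (\<lambda>m z. \<Sum>n<m. ?c n * z ^ n) h sequentially"
      by (rule entire_taylor_uniform_limit[OF h]) (simp add: R_def)
    have "\<forall>\<^sub>F m in sequentially. \<forall>z\<in>cball 0 R. dist (\<Sum>n<m. ?c n * z ^ n) (h z) < \<epsilon> / 2"
      by (rule uniform_limitD[OF ul]) (use \<epsilon> in simp)
    then obtain m where m: "\<And>z. z \<in> cball 0 R \<Longrightarrow> dist (\<Sum>n<m. ?c n * z ^ n) (h z) < \<epsilon> / 2"
      unfolding eventually_sequentially by blast
    \<comment> \<open>Coefficient \<open>n\<close> is matched within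
      \<open>\<delta> / R ^ n\<close>, so each of the \<open>m\<close> terms is off by at most
      \<open>\<delta>\<close> on the disc.\<close>
    define \<delta> where "\<delta> = \<epsilon> / (2 * (real m + 1))"
    have \<delta>: "\<delta> > 0" using \<epsilon> by (simp add: \<delta>_def)
    have "\<exists>i. dist (?c n) (e i) < \<delta> / R ^ n" for n using \<delta> R by (intro e) simp
    then obtain a where a: "\<And>n. dist (?c n) (e (a n)) < \<delta> / R ^ n" by metis
    show "\<exists>xs. \<forall>z. cmod z \<le> R' \<longrightarrow> cmod (P xs z - h z) < \<epsilon>"
    proof (intro exI[of _ "map a [0..<m]"] allI impI)
      fix z :: complex assume z: "cmod z \<le> R'"
      have "cmod (P (map a [0..<m]) z - (\<Sum>n<m. ?c n * z ^ n)) = cmod (\<Sum>n<m. (e (a n) - ?c n) * z ^ n)"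
        by (simp add: P_def left_diff_distrib sum_subtractf)
      also have "\<dots> \<le> (\<Sum>n<m. \<delta>)"
      proof (rule sum_norm_le)
        fix n
        have "cmod (e (a n) - ?c n) * cmod z ^ n \<le> \<delta> / R ^ n * R ^ n"
          using a[of n] z R \<delta> by (intro mult_mono power_mono) (auto simp: dist_norm norm_minus_commute less_imp_le)
        then show "cmod ((e (a n) - ?c n) * z ^ n) \<le> \<delta>" using R by (simp add: norm_mult norm_power)
      qed
      also have "\<dots> < \<epsilon> / 2" using \<epsilon> by (simp add: \<delta>_def field_simps)
      finally have "cmod (P (map a [0..<m]) z - (\<Sum>n<m. ?c n * z ^ n)) < \<epsilon> / 2" .
      moreover have "cmod ((\<Sum>n<m. ?c n * z ^ n) - h z) < \<epsilon> / 2"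
        using m[of z] z R by (simp add: dist_norm)
      ultimately show "cmod (P (map a [0..<m]) z - h z) < \<epsilon>"
        using norm_diff_triangle_less by fastforce
    qed
  qed
qed

section \<open>The frequently hypercyclic series\<close>

text \<open>\<open>Y l\<close> is the \<open>l\<close>-th approximant, \<open>C l\<close> its decay
  constant, \<open>N l\<close> the separation reserved for it. In \<open>N_large\<close> the square
  root of that separation absorbs the constants of all approximants up to \<open>l\<close>, the
  bound \<open>exp (A * l) / r0\<^sup>2\<close> for exponential kernels on the disc of radius
  \<open>l\<close>, and a factor \<open>l + 1\<close> that makes the errors tend to 0.\<close>

locale ruler_series =
  fixes \<alpha> \<beta> r0 A :: real and \<psi> :: "complex \<Rightarrow> complex"
    and Y :: "nat \<Rightarrow> int \<Rightarrow> (complex \<Rightarrow> complex) \<Rightarrow> complex" and C :: "nat \<Rightarrow> real" and N :: "nat \<Rightarrow> nat"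
  assumes Y: "Y l \<in> wave_functionals \<alpha> \<beta>"
    and C: "C l \<ge> 0" "functional_decay (imag_seg \<alpha> \<beta>) (Y l) (C l)"
    and r0: "0 < r0" "r0 \<le> 1" and A: "A > 0"
    and \<psi>_holo: "u \<in> imag_seg \<alpha> \<beta> \<Longrightarrow> \<psi> holomorphic_on ball u r0"
    and \<psi>_bound: "u \<in> imag_seg \<alpha> \<beta> \<Longrightarrow> v \<in> ball u r0 \<Longrightarrow> cmod (\<psi> v) \<le> A"
    and N: "strict_mono N" "N l \<ge> 1"
    and N_large: "l' \<le> l \<Longrightarrow> C l' * ((exp (A * real l) / r0\<^sup>2 + 1) * (real l + 1)) \<le> sqrt (N l)"
begin

abbreviation J :: "complex set" where "J \<equiv> imag_seg \<alpha> \<beta>"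

text \<open>Summand \<open>i\<close> after \<open>n\<close> applications: it starts
  \<open>ruler_pos i\<close> steps back and reaches time 0 at \<open>n = ruler_pos i\<close>. It
  carries the approximant \<open>l\<close> with \<open>N l = Suc (ruler i)\<close>; since
  \<open>N\<close> may skip values, a slot can be empty.\<close>

definition slot :: "nat \<Rightarrow> nat \<Rightarrow> (complex \<Rightarrow> complex) \<Rightarrow> complex" where
  "slot n i h = (if Suc (ruler i) \<in> range N
     then Y (inv N (Suc (ruler i))) (int n - int (ruler_pos i)) h else 0)"

lemma slot_eq: "Suc (ruler i) = N l \<Longrightarrow> slot n i = Y l (int n - int (ruler_pos i))"
  using N(1) by (auto simp: slot_def fun_eq_iff strict_mono_imp_inj_on inv_f_f)

lemma slot_cases:
  obtains l where "Suc (ruler i) = N l" | "\<And>n h. slot n i h = 0"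
  by (cases "Suc (ruler i) \<in> range N") (auto simp: slot_def)

lemma J_compact: "compact J" by (rule compact_imag_seg)

lemma \<psi>_cont: "continuous_on J \<psi>"
proof (rule continuous_at_imp_continuous_on, intro ballI)
  fix u assume "u \<in> J"
  then show "isCont \<psi> u"
    using holomorphic_on_imp_continuous_on[OF \<psi>_holo] r0 by (simp add: continuous_on_eq_continuous_at)
qed

lemma \<psi>_boundJ: "u \<in> J \<Longrightarrow> cmod (\<psi> u) \<le> A"
  using \<psi>_bound[of u u] r0 by simp

lemma slot_bounded: "bounded_functional J (slot n i)"
proof (cases i rule: slot_cases)
  case (1 l)
  then show ?thesis using wave_functionals_bounded[OF Y] by (simp add: slot_eq)
next
  case 2
  then have "slot n i = (\<lambda>h. 0)" by auto
  then show ?thesis by (simp add: bounded_functional_zero_functional)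
qed

lemma slot_shift: "slot 0 i (\<lambda>u. exp u ^ n * h u) = slot n i h"
proof (cases i rule: slot_cases)
  case (1 l)
  then show ?thesis using wave_functionals_shift[OF Y, of l "- int (ruler_pos i)" n h] by (simp add: slot_eq)
qed simp

text \<open>The position is at least \<open>N l\<close>, so its square root exceeds
  \<open>C l\<close>, and quadratic decay turns into \<open>decay_rate\<close>. The kernel is
  arbitrary because exponentials, powers and Cauchy kernels all occur.\<close>

lemma slot_norm:
  assumes r: "0 < r" "r \<le> 1" and B: "B \<ge> 0" and h: "\<And>u. u \<in> J \<Longrightarrow> h holomorphic_on ball u r"
    "\<And>u v. u \<in> J \<Longrightarrow> v \<in> ball u r \<Longrightarrow> cmod (h v) \<le> B"
  shows "cmod (slot 0 i h) \<le> B / r\<^sup>2 * decay_rate (real (Suc i))"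
proof (cases i rule: slot_cases)
  case (1 l)
  let ?p = "real (ruler_pos i)"
  have p: "?p > 0" "real (Suc i) \<le> ?p" "real (N l) \<le> ?p"
    using ruler_pos_ge[of i] 1 by simp_all
  have "1 * 1 \<le> (exp (A * l) / r0\<^sup>2 + 1) * (real l + 1)" by (intro mult_mono) auto
  from mult_left_mono[OF this C(1)[of l]] have "C l \<le> sqrt (N l)" using N_large[of l l] by simp
  also have "\<dots> \<le> sqrt ?p" using p by simp
  finally have Cl: "C l \<le> sqrt ?p" .
  have "cmod (slot 0 i h) \<le> C l * B / (r\<^sup>2 * (of_int (int 0 - int (ruler_pos i)))\<^sup>2)"
    unfolding slot_eq[OF 1] by (rule functional_decayD[OF C(2) r _ h]) (use p in auto)
  also have "\<dots> = B / r\<^sup>2 * (C l / ?p\<^sup>2)" by simp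
  also have "\<dots> \<le> B / r\<^sup>2 * (sqrt ?p / ?p\<^sup>2)"
    using B by (intro mult_left_mono divide_right_mono Cl) auto
  also have "sqrt ?p / ?p\<^sup>2 = decay_rate ?p" using p by (intro sqrt_over_square)
  also have "B / r\<^sup>2 * decay_rate ?p \<le> B / r\<^sup>2 * decay_rate (real (Suc i))"
    using B p by (intro mult_left_mono decay_rate_antimono) auto
  finally show ?thesis .
next
  case 2
  then show ?thesis using B decay_rate_nonneg[of "real (Suc i)"] by simp
qed

lemma exp_kernel:
  assumes "u \<in> J"
  shows "(\<lambda>u. exp (\<psi> u * z)) holomorphic_on ball u r0"
    "v \<in> ball u r0 \<Longrightarrow> cmod (exp (\<psi> v * z)) \<le> exp (A * cmod z)"
proof -
  show "(\<lambda>u. exp (\<psi> u * z)) holomorphic_on ball u r0" by (intro holomorphic_intros \<psi>_holo assms)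
  show "cmod (exp (\<psi> v * z)) \<le> exp (A * cmod z)" if "v \<in> ball u r0"
    by (intro norm_exp_mult_le \<psi>_bound[OF assms that])
qed

lemma slot_exp_norm: "cmod (slot 0 i (\<lambda>u. exp (\<psi> u * z))) \<le> exp (A * cmod z) / r0\<^sup>2 * decay_rate (real (Suc i))"
  by (intro slot_norm r0 exp_kernel) auto

text \<open>The two positions are separated by both \<open>N l\<close> and \<open>N k\<close>. If
  \<open>l \<le> k\<close>, then \<open>N k\<close> absorbs the constant of \<open>l\<close>; if
  \<open>l > k\<close>, the slot of \<open>l\<close> itself keeps far enough away. The surplus
  \<open>k + 1\<close> makes the total disturbance vanish as \<open>k\<close> grows.\<close>

lemma slot_interference:
  assumes k: "Suc (ruler k') = N k" and i: "i \<noteq> k'" and z: "cmod z \<le> k"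
  shows "cmod (slot (ruler_pos k') i (\<lambda>u. exp (\<psi> u * z))) \<le> 1 / (real k + 1) * decay_rate \<bar>real k' - real i\<bar>"
proof (cases i rule: slot_cases)
  case (1 l)
  define d where "d = \<bar>real (ruler_pos k') - real (ruler_pos i)\<bar>"
  have d: "real (N l) \<le> d" "real (N k) \<le> d" "\<bar>real k' - real i\<bar> \<le> d" "d > 0"
    using ruler_pos_dist[of i k'] i 1 k N(2)[of l] by (auto simp: d_def)
  define M where "M = max l k"
  have "C l * (exp (A * k) / r0\<^sup>2 * (real k + 1)) \<le> C l * ((exp (A * M) / r0\<^sup>2 + 1) * (real M + 1))"
  proof (intro mult_left_mono mult_mono C(1))
    have "exp (A * k) / r0\<^sup>2 \<le> exp (A * M) / r0\<^sup>2"
      using A by (intro divide_right_mono) (auto simp: M_def)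
    then show "exp (A * k) / r0\<^sup>2 \<le> exp (A * M) / r0\<^sup>2 + 1" by simp
  qed (auto simp: M_def)
  also have "\<dots> \<le> sqrt (N M)" by (rule N_large) (simp add: M_def)
  also have "\<dots> \<le> sqrt d" using d(1,2) by (auto simp: M_def max_def)
  finally have main: "C l * exp (A * k) / r0\<^sup>2 \<le> sqrt d / (real k + 1)" by (simp add: field_simps)
  have n: "int (ruler_pos k') - int (ruler_pos i) \<noteq> 0" using d(4) by (auto simp: d_def)
  have "exp (A * cmod z) \<le> exp (A * k)" using z A by simp
  then have "cmod (slot (ruler_pos k') i (\<lambda>u. exp (\<psi> u * z))) \<le>
      C l * exp (A * k) / (r0\<^sup>2 * (of_int (int (ruler_pos k') - int (ruler_pos i)))\<^sup>2)"
    unfolding slot_eq[OF 1]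
    by (intro functional_decayD[OF C(2) r0 n] exp_kernel order_trans[OF exp_kernel(2)]) auto
  also have "\<dots> = C l * exp (A * k) / r0\<^sup>2 / d\<^sup>2" by (simp add: d_def)
  also have "\<dots> \<le> sqrt d / (real k + 1) / d\<^sup>2" by (intro divide_right_mono main) auto
  also have "\<dots> = 1 / (real k + 1) * (sqrt d / d\<^sup>2)" by simp
  also have "sqrt d / d\<^sup>2 = decay_rate d" using d by (intro sqrt_over_square)
  also have "1 / (real k + 1) * decay_rate d \<le> 1 / (real k + 1) * decay_rate \<bar>real k' - real i\<bar>"
    using i d by (intro mult_left_mono decay_rate_antimono) auto
  finally show ?thesis .
next
  case 2
  then show ?thesis by (simp add: decay_rate_nonneg)
qed

definition part :: "nat \<Rightarrow> (complex \<Rightarrow> complex) \<Rightarrow> complex" where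
  "part m h = (\<Sum>i<m. slot 0 i h)"

lemma part_bounded: "bounded_functional J (part m)"
  unfolding part_def by (intro bounded_functional_sum_functional slot_bounded)

definition wave :: "complex \<Rightarrow> complex" where
  "wave z = (\<Sum>i. slot 0 i (\<lambda>u. exp (\<psi> u * z)))"

lemma uniform_limit_part:
  assumes r: "0 < r" "r \<le> 1" and B: "B \<ge> 0" and h: "\<And>u z. u \<in> J \<Longrightarrow> z \<in> X \<Longrightarrow> h z holomorphic_on ball u r"
    "\<And>u v z. u \<in> J \<Longrightarrow> z \<in> X \<Longrightarrow> v \<in> ball u r \<Longrightarrow> cmod (h z v) \<le> B"
  shows "uniform_limit X (\<lambda>m z. part m (h z)) (\<lambda>z. \<Sum>i. slot 0 i (h z)) sequentially"
  unfolding part_def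
proof (rule Weierstrass_m_test)
  show "norm (slot 0 i (h z)) \<le> B / r\<^sup>2 * decay_rate (real (Suc i))" if "z \<in> X" for i z
    using that by (intro slot_norm r B h) auto
  show "summable (\<lambda>i. B / r\<^sup>2 * decay_rate (real (Suc i)))"
    by (intro summable_mult summable_decay_rate)
qed

lemma uniform_limit_wave: "uniform_limit (cball 0 R) (\<lambda>m z. part m (\<lambda>u. exp (\<psi> u * z))) wave sequentially"
  unfolding wave_def
proof (rule uniform_limit_part[OF r0, of "exp (A * R)"])
  fix u v z :: complex assume *: "u \<in> J" "z \<in> cball 0 R" "v \<in> ball u r0"
  have "cmod (exp (\<psi> v * z)) \<le> exp (A * cmod z)" by (rule exp_kernel(2)[OF *(1,3)])
  also have "\<dots> \<le> exp (A * R)" using *(2) A by simp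
  finally show "cmod (exp (\<psi> v * z)) \<le> exp (A * R)" .
qed (auto intro: exp_kernel)

lemma part_entire: "(\<lambda>z. part m (\<lambda>u. exp (\<psi> u * z))) holomorphic_on UNIV"
  by (rule exp_transform_entire[OF part_bounded J_compact \<psi>_cont])

lemma wave_entire: "wave holomorphic_on UNIV"
proof (rule holomorphic_uniform_sequence[OF open_UNIV part_entire])
  fix x :: complex
  have "cball x 1 \<subseteq> cball 0 (cmod x + 1)"
  proof
    fix w assume "w \<in> cball x 1"
    then show "w \<in> cball 0 (cmod x + 1)"
      using norm_triangle_ineq2[of w x] by (simp add: dist_norm norm_minus_commute)
  qed
  then show "\<exists>d>0. cball x d \<subseteq> UNIV \<and>
      uniform_limit (cball x d) (\<lambda>m z. part m (\<lambda>u. exp (\<psi> u * z))) wave sequentially"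
    using uniform_limit_on_subset[OF uniform_limit_wave] by (intro exI[of _ 1]) auto
qed

lemma wave_exponential_type: "exponential_type wave"
proof (rule exponential_typeI[OF wave_entire])
  fix z
  have "cmod (wave z) \<le> (\<Sum>i. exp (A * cmod z) / r0\<^sup>2 * decay_rate (real (Suc i)))"
    unfolding wave_def by (intro norm_suminf_le slot_exp_norm summable_mult summable_decay_rate)
  also have "\<dots> = exp (A * cmod z) / r0\<^sup>2 * decay_total"
    unfolding decay_total_def by (rule suminf_mult[OF summable_decay_rate])
  finally show "cmod (wave z) \<le> decay_total / r0\<^sup>2 * exp (A * cmod z)" by (simp add: mult_ac)
qed

text \<open>At time \<open>ruler_pos k'\<close> the summand \<open>k'\<close> is exactly
  \<open>Y k 0\<close>, and all others are disturbances. The bound is uniform in the partial sums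
  and passes to the limit because iterates of the operator are continuous.\<close>

lemma wave_orbit:
  assumes \<phi>: "exponential_type \<phi>" "\<And>u. u \<in> J \<Longrightarrow> \<phi> (\<psi> u) = exp u"
    and k: "Suc (ruler k') = N k" and z: "cmod z \<le> k"
  shows "cmod ((diff_operator \<phi> ^^ ruler_pos k') wave z - Y k 0 (\<lambda>u. exp (\<psi> u * z))) \<le> 2 * decay_total / (real k + 1)"
proof -
  let ?n = "ruler_pos k'" and ?E = "\<lambda>u. exp (\<psi> u * z)"
  have hol: "\<phi> holomorphic_on UNIV" using \<phi>(1) by (simp add: exponential_type_def)
  have part: "(diff_operator \<phi> ^^ ?n) (\<lambda>z. part m (\<lambda>u. exp (\<psi> u * z))) z = (\<Sum>i<m. slot ?n i ?E)" for m
  proof -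
    have c: "continuous_on J (\<lambda>u. \<phi> (\<psi> u) ^ ?n * ?E u)"
      by (intro continuous_intros \<psi>_cont continuous_on_compose2[OF holomorphic_on_imp_continuous_on[OF hol] \<psi>_cont]) auto
    have "part m (\<lambda>u. \<phi> (\<psi> u) ^ ?n * ?E u) = part m (\<lambda>u. exp u ^ ?n * ?E u)"
      by (rule bounded_functional_cong[OF part_bounded c]) (use \<phi>(2) in auto)
    also have "\<dots> = (\<Sum>i<m. slot ?n i ?E)" by (simp add: part_def slot_shift)
    finally show ?thesis
      by (simp add: diff_operator_funpow_exp_transform[OF part_bounded J_compact \<psi>_cont hol])
  qed
  have "uniform_limit (cball 0 (cmod z)) (\<lambda>m. (diff_operator \<phi> ^^ ?n) (\<lambda>z. part m (\<lambda>u. exp (\<psi> u * z))))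
      ((diff_operator \<phi> ^^ ?n) wave) sequentially"
    by (rule diff_operator_uniform_limit[OF \<phi>(1) part_entire wave_entire uniform_limit_wave])
  then have "(\<lambda>m. (diff_operator \<phi> ^^ ?n) (\<lambda>z. part m (\<lambda>u. exp (\<psi> u * z))) z) \<longlonglongrightarrow> (diff_operator \<phi> ^^ ?n) wave z"
    by (rule tendsto_uniform_limitI) simp
  then have "(\<lambda>m. (\<Sum>i<m. slot ?n i ?E) - Y k 0 ?E) \<longlonglongrightarrow> (diff_operator \<phi> ^^ ?n) wave z - Y k 0 ?E"
    unfolding part by (intro tendsto_diff tendsto_const)
  then show ?thesis
  proof (rule Lim_norm_ubound[OF sequentially_bot])
    show "\<forall>\<^sub>F m in sequentially. norm ((\<Sum>i<m. slot ?n i ?E) - Y k 0 ?E) \<le> 2 * decay_total / (real k + 1)"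
    proof (rule eventually_sequentiallyI)
      fix m assume m: "m \<ge> Suc k'"
      have "(\<Sum>i<m. slot ?n i ?E) = slot ?n k' ?E + (\<Sum>i\<in>{..<m} - {k'}. slot ?n i ?E)"
        by (rule sum.remove) (use m in auto)
      also have "slot ?n k' ?E = Y k 0 ?E" by (simp add: slot_eq[OF k])
      finally have "norm ((\<Sum>i<m. slot ?n i ?E) - Y k 0 ?E) = norm (\<Sum>i\<in>{..<m} - {k'}. slot ?n i ?E)" by simp
      also have "\<dots> \<le> (\<Sum>i\<in>{..<m} - {k'}. 1 / (real k + 1) * decay_rate \<bar>real k' - real i\<bar>)"
        by (intro sum_norm_le slot_interference[OF k _ z]) auto
      also have "\<dots> \<le> 1 / (real k + 1) * (2 * decay_total)"
        unfolding sum_distrib_left[symmetric] by (intro mult_left_mono sum_decay_rate_dist) auto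
      finally show "norm ((\<Sum>i<m. slot ?n i ?E) - Y k 0 ?E) \<le> 2 * decay_total / (real k + 1)" by simp
    qed
  qed
qed

text \<open>The continuation is the sum of the Cauchy transforms of the slots, all of which live on
  one arc. Near infinity each partial sum equals the Borel series of its own exponential transform,
  and Tannery's theorem, with the geometric majorant from \<open>power_bound\<close>, carries this
  to the limit.\<close>

lemma wave_borel_carrier:
  assumes N': "open N'" "\<psi> holomorphic_on N'" "J \<subseteq> N'"
    and K: "compact K" "convex K" "\<psi> ` J \<subseteq> K"
  shows "borel_carrier wave K"
proof -
  define g where "g z = (\<Sum>i. slot 0 i (\<lambda>u. 1 / (z - \<psi> u)))" for z
  have local: "\<exists>d>0. cball z d \<subseteq> - (\<psi> ` J) \<and>
      uniform_limit (cball z d) (\<lambda>m z. part m (\<lambda>u. 1 / (z - \<psi> u))) g sequentially"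
    if z: "z \<in> - (\<psi> ` J)" for z
  proof -
    have "closed (\<psi> ` J)" by (intro compact_imp_closed compact_continuous_image \<psi>_cont J_compact)
    then obtain e where e: "e > 0" "ball z e \<subseteq> - (\<psi> ` J)" using z by (meson open_Compl openE)
    define d where "d = e / 4"
    have d: "d > 0" using e by (simp add: d_def)
    \<comment> \<open>Decay is available only for kernels holomorphic and bounded on balls around
      the parameter segment. On \<open>N''\<close> the values of \<open>\<psi>\<close> keep distance
      \<open>2 * d\<close> from \<open>z\<close>, so \<open>1 / d\<close> bounds the Cauchy kernel
      for all \<open>w\<close> within \<open>d\<close> of \<open>z\<close>.\<close>
    define N'' where "N'' = {v \<in> N'. 2 * d < dist z (\<psi> v)}"
    have "open N''"
      unfolding N''_def
      using continuous_open_preimage[OF continuous_on_dist[OF continuous_on_const[of _ z]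
              holomorphic_on_imp_continuous_on[OF N'(2)]] N'(1), of "{2 * d<..}"]
      by (simp add: vimage_def Int_def)
    moreover have "J \<subseteq> N''"
    proof
      fix u assume u: "u \<in> J"
      then have "\<psi> u \<notin> ball z e" using e(2) by blast
      then show "u \<in> N''" using u N'(3) e(1) by (auto simp: N''_def d_def)
    qed
    ultimately obtain r1 where r1: "r1 > 0" "(\<Union>u\<in>J. cball u r1) \<subseteq> N''"
      using compact_subset_open_imp_cball_epsilon_subset[OF J_compact] by blast
    define r where "r = min r1 1"
    have r: "0 < r" "r \<le> 1" using r1 by (auto simp: r_def)
    have far: "v \<in> N'" "d \<le> cmod (w - \<psi> v)" if "u \<in> J" "v \<in> ball u r" "w \<in> cball z d" for u v w
    proof -
      have "v \<in> N''" using that r1(2) by (auto simp: r_def subset_eq)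
      then have v: "v \<in> N'" "2 * d < dist z (\<psi> v)" by (auto simp: N''_def)
      have "dist z (\<psi> v) \<le> dist z w + dist w (\<psi> v)" by (rule dist_triangle)
      with v that show "v \<in> N'" "d \<le> cmod (w - \<psi> v)" by (auto simp: dist_norm)
    qed
    have "uniform_limit (cball z d) (\<lambda>m z. part m (\<lambda>u. 1 / (z - \<psi> u))) g sequentially"
      unfolding g_def
    proof (rule uniform_limit_part[OF r, of "1 / d"])
      show "0 \<le> 1 / d" using d by simp
      fix u w assume uw: "u \<in> J" "w \<in> cball z d"
      show "(\<lambda>u. 1 / (w - \<psi> u)) holomorphic_on ball u r"
      proof (intro holomorphic_intros holomorphic_on_subset[OF N'(2)] subsetI)
        show "v \<in> N'" if "v \<in> ball u r" for v using far(1)[OF uw(1) that uw(2)] .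
        show "w - \<psi> v \<noteq> 0" if "v \<in> ball u r" for v using far(2)[OF uw(1) that uw(2)] d by auto
      qed
      show "cmod (1 / (w - \<psi> v)) \<le> 1 / d" if "v \<in> ball u r" for v
      proof -
        have le: "d \<le> cmod (w - \<psi> v)" by (rule far(2)[OF uw(1) that uw(2)])
        show ?thesis unfolding norm_divide norm_one by (intro divide_left_mono le mult_pos_pos) (use d le in linarith)+
      qed
    qed
    moreover have "cball z d \<subseteq> - (\<psi> ` J)" using e by (auto simp: d_def subset_eq)
    ultimately show ?thesis using d by blast
  qed
  have "g holomorphic_on - (\<psi> ` J)"
  proof (rule holomorphic_uniform_sequence[OF _ _ local])
    show "open (- (\<psi> ` J))"
      by (intro open_Compl compact_imp_closed compact_continuous_image \<psi>_cont J_compact)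
    show "(\<lambda>z. part m (\<lambda>u. 1 / (z - \<psi> u))) holomorphic_on - (\<psi> ` J)" for m
      by (rule cauchy_transform_holomorphic[OF part_bounded J_compact \<psi>_cont])
  qed
  then have gK: "g holomorphic_on - K" by (rule holomorphic_on_subset) (use K(3) in auto)
  have deriv: "(\<lambda>m. part m (\<lambda>u. \<psi> u ^ n)) \<longlonglongrightarrow> (deriv ^^ n) wave 0" for n
  proof -
    have "(\<lambda>m. (deriv ^^ n) (\<lambda>z. part m (\<lambda>u. exp (\<psi> u * z))) 0) \<longlonglongrightarrow> (deriv ^^ n) wave 0"
    proof (rule higher_deriv_complex_uniform_limit[where A = "ball 0 1"])
      show "uniform_limit (ball 0 1) (\<lambda>m z. part m (\<lambda>u. exp (\<psi> u * z))) wave sequentially"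
        by (rule uniform_limit_on_subset[OF uniform_limit_wave[of 1]]) auto
      show "\<forall>\<^sub>F m in sequentially. (\<lambda>z. part m (\<lambda>u. exp (\<psi> u * z))) holomorphic_on ball 0 1"
        by (intro always_eventually allI holomorphic_on_subset[OF part_entire]) auto
    qed auto
    then show ?thesis by (simp add: exp_transform_higher_deriv[OF part_bounded J_compact \<psi>_cont])
  qed
  have power_bound: "cmod (part m (\<lambda>u. \<psi> u ^ n)) \<le> A ^ n / r0\<^sup>2 * decay_total" for m n
  proof -
    have "cmod (part m (\<lambda>u. \<psi> u ^ n)) \<le> (\<Sum>i<m. A ^ n / r0\<^sup>2 * decay_rate (real (Suc i)))"
      unfolding part_def
    proof (intro sum_norm_le slot_norm r0)
      show "0 \<le> A ^ n" using A by simp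
      show "(\<lambda>u. \<psi> u ^ n) holomorphic_on ball u r0" if "u \<in> J" for u
        by (intro holomorphic_intros \<psi>_holo that)
      show "cmod (\<psi> v ^ n) \<le> A ^ n" if "u \<in> J" "v \<in> ball u r0" for u v
        unfolding norm_power by (intro power_mono \<psi>_bound[OF that]) auto
    qed
    also have "\<dots> \<le> A ^ n / r0\<^sup>2 * decay_total"
      unfolding sum_distrib_left[symmetric] using A by (intro mult_left_mono sum_decay_rate_le) auto
    finally show ?thesis .
  qed
  have "\<forall>\<^sub>F z in at_infinity. g z = borel_transform wave z"
  proof -
    have "\<forall>\<^sub>F z in at_infinity. z \<notin> cball (0::complex) A" by (rule eventually_notin_bounded) simp
    then show ?thesis
    proof eventually_elim
      case (elim z)
      then have z: "cmod z > A" by simp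
      then have zJ: "z \<in> - (\<psi> ` J)" using \<psi>_boundJ by force
      obtain d where d: "d > 0" and ul: "uniform_limit (cball z d) (\<lambda>m z. part m (\<lambda>u. 1 / (z - \<psi> u))) g sequentially"
        using local[OF zJ] by blast
      then have lim1: "(\<lambda>m. part m (\<lambda>u. 1 / (z - \<psi> u))) \<longlonglongrightarrow> g z"
        by (intro tendsto_uniform_limitI[OF ul]) (use d in simp)
      have "A / cmod z < 1" using z A by (subst divide_less_eq_1_pos) linarith+
      then have M: "summable (\<lambda>n. (decay_total / r0\<^sup>2 / cmod z) * (A / cmod z) ^ n)"
        using A by (intro summable_mult summable_geometric) auto
      have bound: "cmod (part m (\<lambda>u. \<psi> u ^ n) / z ^ Suc n) \<le> (decay_total / r0\<^sup>2 / cmod z) * (A / cmod z) ^ n" for m n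
      proof -
        have "cmod (part m (\<lambda>u. \<psi> u ^ n) / z ^ Suc n) \<le> (A ^ n / r0\<^sup>2 * decay_total) / cmod z ^ Suc n"
          unfolding norm_divide norm_power by (intro divide_right_mono power_bound) auto
        then show ?thesis by (simp add: power_divide mult_ac)
      qed
      have "(\<lambda>m. part m (\<lambda>u. \<psi> u ^ n) / z ^ Suc n) \<longlonglongrightarrow> (deriv ^^ n) wave 0 / z ^ Suc n" for n
        by (intro tendsto_divide deriv tendsto_const) (use z A in auto)
      then have "(\<lambda>m. \<Sum>n. part m (\<lambda>u. \<psi> u ^ n) / z ^ Suc n) \<longlonglongrightarrow> (\<Sum>n. (deriv ^^ n) wave 0 / z ^ Suc n)"
        by (rule tannerys_theorem[THEN conjunct2, THEN conjunct2, OF _ always_eventually M])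
           (use bound in auto)
      moreover have "(\<Sum>n. part m (\<lambda>u. \<psi> u ^ n) / z ^ Suc n) = part m (\<lambda>u. 1 / (z - \<psi> u))" for m
        using cauchy_transform_at_infinity[OF part_bounded J_compact \<psi>_cont A \<psi>_boundJ z] by (simp add: sums_iff)
      ultimately show "g z = borel_transform wave z"
        using lim1 by (simp add: borel_transform_def LIMSEQ_unique)
    qed
  qed
  with gK K show ?thesis unfolding borel_carrier_def by blast
qed

end

section \<open>Choice of the approximants and of their separations\<close>

lemma freq_hypercyclic_exponential_type_exists:
  assumes \<phi>: "exponential_type \<phi>" and nc: "\<not> \<phi> constant_on UNIV"
    and K: "compact K" "convex K" and S: "continuum S" "S \<subseteq> K \<inter> {z. cmod (\<phi> z) = 1}"
  shows "\<exists>f \<in> freq_hypercyclic (diff_operator \<phi>) entire_space.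
    exponential_type f \<and> conj_indicator_diagram f \<subseteq> K"
proof -
  have hol: "\<phi> holomorphic_on UNIV" using \<phi> by (simp add: exponential_type_def)
  have unimodular: "S \<subseteq> {z. cmod (\<phi> z) = 1}" using S(2) by blast
  obtain \<psi> N0 \<alpha> \<beta> where N0: "open N0" "\<psi> holomorphic_on N0" and ab: "\<alpha> < \<beta>" "\<beta> - \<alpha> < 2 * pi"
    and \<phi>\<psi>: "\<And>u. u \<in> N0 \<Longrightarrow> \<phi> (\<psi> u) = exp u"
    and arc: "\<And>t. t \<in> {\<alpha>..\<beta>} \<Longrightarrow> \<i> * complex_of_real t \<in> N0 \<and> \<psi> (\<i> * complex_of_real t) \<in> S"
    by (rule unimodular_arc[OF hol nc S(1) unimodular]) (rule that; assumption)
  let ?J = "imag_seg \<alpha> \<beta>"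
  have J: "?J \<subseteq> N0" "\<psi> ` ?J \<subseteq> K" using arc S(2) by (auto simp: imag_seg_def)
  have cont: "continuous_on ?J \<psi>"
    by (rule continuous_on_subset[OF holomorphic_on_imp_continuous_on[OF N0(2)] J(1)])
  have inj: "inj_on \<psi> ?J"
  proof (rule inj_onI)
    fix u v assume uv: "u \<in> ?J" "v \<in> ?J" "\<psi> u = \<psi> v"
    then have "exp u = exp v" using \<phi>\<psi> J(1) by (metis subsetD)
    moreover have "\<bar>Im u - Im v\<bar> < 2 * pi" using uv(1,2) ab(2) by (auto simp: imag_seg_def)
    ultimately show "u = v" by (simp add: exp_complex_eqI)
  qed
  obtain B where B: "B > 0" "\<And>u. u \<in> ?J \<Longrightarrow> cmod (\<psi> u) \<le> B"
    using norm_continuous_bound[OF compact_imag_seg cont] by blast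
  \<comment> \<open>The margin 1 extends the bound from the segment to a neighbourhood
    \<open>N1\<close>, which contains balls of a uniform radius.\<close>
  define A where "A = B + 1"
  define N1 where "N1 = {v \<in> N0. cmod (\<psi> v) < A}"
  have "open N1"
    unfolding N1_def
    using continuous_open_preimage[OF continuous_on_norm[OF holomorphic_on_imp_continuous_on[OF N0(2)]] N0(1), of "{..<A}"]
    by (simp add: vimage_def Int_def)
  moreover have "?J \<subseteq> N1" using B J(1) by (force simp: N1_def A_def)
  ultimately obtain r1 where r1: "r1 > 0" "(\<Union>u\<in>?J. cball u r1) \<subseteq> N1"
    using compact_subset_open_imp_cball_epsilon_subset[OF compact_imag_seg] by blast
  define r0 where "r0 = min r1 1"
  have r0: "0 < r0" "r0 \<le> 1" using r1 by (auto simp: r0_def)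
  have near: "ball u r0 \<subseteq> N1" if "u \<in> ?J" for u using that r1(2) by (auto simp: r0_def subset_eq)
  obtain P :: "nat list \<Rightarrow> complex \<Rightarrow> complex" where P: "\<And>xs. P xs holomorphic_on UNIV"
    "\<And>h R \<epsilon>. h holomorphic_on UNIV \<Longrightarrow> \<epsilon> > 0 \<Longrightarrow> \<exists>xs. \<forall>z. cmod z \<le> R \<longrightarrow> cmod (P xs z - h z) < \<epsilon>"
    using countable_dense_polynomials by blast
  \<comment> \<open>Decoding to a pair and keeping its first component makes every polynomial the
    target of infinitely many \<open>l\<close>, hence with arbitrarily good accuracy.\<close>
  define target where "target l = P (fst (from_nat l :: nat list \<times> nat))" for l
  have "\<exists>Y\<in>wave_functionals \<alpha> \<beta>. \<forall>z. cmod z \<le> real l \<longrightarrow>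
      cmod (Y 0 (\<lambda>u. exp (\<psi> u * z)) - target l z) < 1 / (real l + 1)" for l
  proof -
    have "wave_approximable \<alpha> \<beta> \<psi> (target l)"
      unfolding target_def by (rule wave_approximable_entire[OF cont inj ab(1) P(1)])
    moreover have "1 / (real l + 1) > 0" by simp
    ultimately show ?thesis unfolding wave_approximable_def by blast
  qed
  then obtain Y where Y: "\<And>l. Y l \<in> wave_functionals \<alpha> \<beta>"
    and Y_close: "\<And>l z. cmod z \<le> real l \<Longrightarrow> cmod (Y l 0 (\<lambda>u. exp (\<psi> u * z)) - target l z) < 1 / (real l + 1)"
    by metis
  obtain C where C: "\<And>l. C l \<ge> 0" "\<And>l. functional_decay ?J (Y l) (C l)"
    using wave_functionals_decay[OF Y] by metis
  \<comment> \<open>The decay constants are fixed before \<open>N\<close>. The square in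
    \<open>N\<close> gives \<open>D l \<le> sqrt (N l)\<close>, and the sum over
    \<open>i \<le> l\<close> makes \<open>N\<close> strictly increasing.\<close>
  define D where "D l = (\<Sum>l'\<le>l. C l') * ((exp (A * real l) / r0\<^sup>2 + 1) * (real l + 1))" for l
  define N where "N l = (\<Sum>i\<le>l. Suc (nat \<lceil>(D i)\<^sup>2\<rceil>))" for l
  interpret ruler_series \<alpha> \<beta> r0 A \<psi> Y C N
  proof
    show "\<psi> holomorphic_on ball u r0" if "u \<in> ?J" for u
      by (rule holomorphic_on_subset[OF N0(2)]) (use near[OF that] in \<open>auto simp: N1_def\<close>)
    show "cmod (\<psi> v) \<le> A" if "u \<in> ?J" "v \<in> ball u r0" for u v
      using near[OF that(1)] that(2) by (auto simp: N1_def)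
    show "strict_mono N" by (rule strict_monoI_Suc) (simp add: N_def)
    show "1 \<le> N l" for l
    proof -
      have "N 0 \<le> N l" unfolding N_def by (rule sum_mono2) auto
      then show ?thesis by (simp add: N_def)
    qed
    show "C l' * ((exp (A * real l) / r0\<^sup>2 + 1) * (real l + 1)) \<le> sqrt (real (N l))" if "l' \<le> l" for l' l
    proof -
      have "C l' \<le> (\<Sum>l'\<le>l. C l')" by (rule member_le_sum) (use that C(1) in auto)
      then have "C l' * ((exp (A * real l) / r0\<^sup>2 + 1) * (real l + 1)) \<le> D l"
        unfolding D_def by (intro mult_right_mono) auto
      also have "\<dots> \<le> sqrt (real (N l))"
      proof (rule real_le_rsqrt)
        have "Suc (nat \<lceil>(D l)\<^sup>2\<rceil>) \<le> N l" unfolding N_def by (rule member_le_sum) auto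
        then have "real (nat \<lceil>(D l)\<^sup>2\<rceil>) \<le> real (N l)" by simp
        then show "(D l)\<^sup>2 \<le> real (N l)" using real_nat_ceiling_ge[of "(D l)\<^sup>2"] by linarith
      qed
      finally show ?thesis .
    qed
  qed (use Y C r0 B in \<open>auto simp: A_def\<close>)
  have \<phi>J: "\<phi> (\<psi> u) = exp u" if "u \<in> ?J" for u using that J(1) \<phi>\<psi> by blast
  have "wave \<in> freq_hypercyclic (diff_operator \<phi>) entire_space"
    unfolding freq_hypercyclic_def topspace_entire_space
  proof (intro CollectI conjI allI impI wave_entire)
    fix U assume U: "openin entire_space U \<and> U \<noteq> {}"
    then obtain h where h: "h \<in> U" by blast
    with U have hh: "h holomorphic_on UNIV" unfolding openin_entire_space by blast
    obtain L e where L: "compact L" "e > 0"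
      "{g. g holomorphic_on UNIV \<and> (\<forall>z\<in>L. dist (g z) (h z) < e)} \<subseteq> U"
      using U h unfolding openin_entire_space by meson
    obtain R where R: "\<And>z. z \<in> L \<Longrightarrow> cmod z \<le> R"
      using compact_imp_bounded[OF L(1)] bounded_iff by blast
    obtain xs where xs: "\<And>z. cmod z \<le> R \<Longrightarrow> cmod (P xs z - h z) < e / 2"
      using P(2)[OF hh, of "e / 2" R] L(2) by auto
    \<comment> \<open>For \<open>k \<ge> b\<close> the disc of radius \<open>k\<close> contains
      \<open>L\<close>, and the disturbance \<open>2 * decay_total / (k + 1)\<close> and the
      approximation error \<open>1 / (k + 1)\<close> together stay below
      \<open>e / 2\<close>.\<close>
    define b where "b = max R (2 * (2 * decay_total + 1) / e)"
    have "infinite (range (\<lambda>j::nat. to_nat (xs, j)))"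
      by (rule range_inj_infinite) (auto simp: inj_on_def)
    then obtain k where k: "k \<in> range (\<lambda>j::nat. to_nat (xs, j))" "k > nat \<lceil>b\<rceil>"
      unfolding infinite_nat_iff_unbounded by blast
    have kb: "b \<le> real k" using k(2) real_nat_ceiling_ge[of b] by linarith
    have tk: "target k = P xs" using k(1) by (auto simp: target_def)
    have kR: "R \<le> real k" using kb by (simp add: b_def)
    have "2 * (2 * decay_total + 1) / e \<le> real k" using kb by (simp add: b_def)
    then have "2 * (2 * decay_total + 1) \<le> real k * e" using L(2) by (simp add: pos_divide_le_eq)
    then have "2 * decay_total + 1 < (real k + 1) * (e / 2)" using L(2) by (simp add: algebra_simps)
    then have small: "(2 * decay_total + 1) / (real k + 1) < e / 2" by (simp add: pos_divide_less_eq mult.commute)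
    show "lower_density (of_nat ` {n. (diff_operator \<phi> ^^ n) wave \<in> U}) > 0"
    proof (rule ruler_lower_density[of "N k - 1"], intro CollectI subsetD[OF L(3)] conjI ballI)
      fix i assume i: "ruler i = N k - 1"
      then have i': "Suc (ruler i) = N k" using N(2)[of k] by simp
      show "(diff_operator \<phi> ^^ ruler_pos i) wave holomorphic_on UNIV"
        by (rule diff_operator_funpow_entire[OF \<phi> wave_entire])
      fix z assume "z \<in> L"
      then have zR: "cmod z \<le> R" by (rule R)
      let ?T = "(diff_operator \<phi> ^^ ruler_pos i) wave z" and ?y = "Y k 0 (\<lambda>u. exp (\<psi> u * z))"
      have "cmod (?T - ?y) \<le> 2 * decay_total / (real k + 1)"
        by (rule wave_orbit[OF \<phi> \<phi>J i']) (use zR kR in auto)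
      moreover have "cmod (?y - P xs z) < 1 / (real k + 1)" using Y_close[of z k] zR kR tk by simp
      moreover have "cmod (?T - P xs z) \<le> cmod (?T - ?y) + cmod (?y - P xs z)"
        using norm_triangle_ineq[of "?T - ?y" "?y - P xs z"] by simp
      ultimately have "cmod (?T - P xs z) < 2 * decay_total / (real k + 1) + 1 / (real k + 1)" by linarith
      also have "\<dots> = (2 * decay_total + 1) / (real k + 1)" by (simp add: add_divide_distrib)
      also have "\<dots> < e / 2" by (rule small)
      finally have "cmod (?T - P xs z) < e / 2" .
      moreover have "cmod (P xs z - h z) < e / 2" by (rule xs[OF zR])
      moreover have "cmod (?T - h z) \<le> cmod (?T - P xs z) + cmod (P xs z - h z)"
        using norm_triangle_ineq[of "?T - P xs z" "P xs z - h z"] by simp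
      ultimately show "dist ?T (h z) < e" unfolding dist_norm by linarith
    qed
  qed
  moreover have "conj_indicator_diagram wave \<subseteq> K"
    by (rule borel_carrier_conj_indicator_diagram(2)[OF wave_borel_carrier[OF N0 J(1) K J(2)]])
  ultimately show ?thesis using wave_exponential_type by blast
qed

theorem theorem1p3:
  fixes \<phi> :: "complex \<Rightarrow> complex"
  assumes "exponential_type \<phi>" and "\<not> \<phi> constant_on UNIV"
  shows "(\<forall>K. compact K \<and> convex K \<and> (\<exists>S. continuum S \<and> S \<subseteq> K \<inter> {z. cmod (\<phi> z) = 1}) \<longrightarrow>
            (\<exists>f \<in> freq_hypercyclic (diff_operator \<phi>) entire_space.
               exponential_type f \<and> conj_indicator_diagram f \<subseteq> K))
       \<and> \<not> (\<exists>f \<in> freq_hypercyclic (diff_operator \<phi>) entire_space.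
               exponential_type f \<and> is_singleton (conj_indicator_diagram f))"
  using freq_hypercyclic_exponential_type_exists[OF assms] not_freq_hypercyclic_singleton[OF assms]
  by blast

end
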